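(* A finitely generated group $G$ embeds into $BS(n,n)$ for some integer $n\ge1$ if and only if $G$ is torsion-free and either $G$ is free, or $G$ is a central extension of $\mathbb{Z}$ by a free product of cyclic groups.
   Context: $BS(n,n)=\langle a,t\mid ta^nt^{-1}=a^n\rangle$. "$G$ is a central extension of $\mathbb{Z}$ by a free product of cyclic groups" means that there is an exact sequence $1\to\mathbb{Z}\to G\to P\to1$ in which the image of $\mathbb{Z}$ is central in $G$ and $P$ is a free product of (finite or infinite) cyclic groups. *)

theory Defs
  imports "HOL-Algebra.Elementary_Groups"
begin

section \<open>Group presentations\<close>

text \<open>A word is a list of signed generators: \<open>(x, True)\<close> is the letter \<open>x\<close> and
  \<open>(x, False)\<close> is its formal inverse. A relation \<open>r = s\<close> is the pair of words \<open>(r, s)\<close>.\<close>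

type_synonym 'x word = "('x \<times> bool) list"

definition words :: "'x set \<Rightarrow> 'x word set" where
  "words X = lists (X \<times> UNIV)"

inductive_set pres_cong :: "'x set \<Rightarrow> ('x word \<times> 'x word) set \<Rightarrow> ('x word \<times> 'x word) set"
  for X R where
  refl: "w \<in> words X \<Longrightarrow> (w, w) \<in> pres_cong X R"
| sym: "(v, w) \<in> pres_cong X R \<Longrightarrow> (w, v) \<in> pres_cong X R"
| trans: "(u, v) \<in> pres_cong X R \<Longrightarrow> (v, w) \<in> pres_cong X R \<Longrightarrow> (u, w) \<in> pres_cong X R"
| cancel: "u \<in> words X \<Longrightarrow> v \<in> words X \<Longrightarrow> x \<in> X \<Longrightarrow>
    (u @ [(x, b), (x, \<not> b)] @ v, u @ v) \<in> pres_cong X R"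
| relation: "u \<in> words X \<Longrightarrow> v \<in> words X \<Longrightarrow> r \<in> words X \<Longrightarrow> s \<in> words X \<Longrightarrow> (r, s) \<in> R \<Longrightarrow>
    (u @ r @ v, u @ s @ v) \<in> pres_cong X R"

definition presented_group :: "'x set \<Rightarrow> ('x word \<times> 'x word) set \<Rightarrow> 'x word set monoid" where
  "presented_group X R =
    \<lparr>carrier = words X // pres_cong X R,
     monoid.mult = (\<lambda>A B. pres_cong X R `` {u @ v | u v. u \<in> A \<and> v \<in> B}),
     one = pres_cong X R `` {[]}\<rparr>"

lemma words_append [simp]: "u @ v \<in> words X \<longleftrightarrow> u \<in> words X \<and> v \<in> words X"
  by (auto simp: words_def)

lemma words_Nil [simp]: "[] \<in> words X"
  by (simp add: words_def)

lemma words_Cons [simp]: "(x, b) # w \<in> words X \<longleftrightarrow> x \<in> X \<and> w \<in> words X"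
  by (auto simp: words_def)

lemma pres_cong_words: "(u, v) \<in> pres_cong X R \<Longrightarrow> u \<in> words X \<and> v \<in> words X"
  by (induction rule: pres_cong.induct) auto

lemma equiv_pres_cong: "equiv (words X) (pres_cong X R)"
proof (rule equivI)
  show "pres_cong X R \<subseteq> words X \<times> words X"
    using pres_cong_words by fastforce
  show "refl_on (words X) (pres_cong X R)"
    using pres_cong.refl by (auto simp: refl_on_def)
  show "Relation.sym (pres_cong X R)"
    using pres_cong.sym by (auto simp: sym_def)
  show "Relation.trans (pres_cong X R)"
    using pres_cong.trans by (metis transI)
qed

lemma pres_cong_ctxt:
  assumes "(v, w) \<in> pres_cong X R" "a \<in> words X" "b \<in> words X"
  shows "(a @ v @ b, a @ w @ b) \<in> pres_cong X R"
  using assms(1)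
proof (induction rule: pres_cong.induct)
  case (refl w)
  then show ?case using assms by (simp add: pres_cong.refl)
next
  case (sym v w)
  then show ?case by (blast intro: pres_cong.sym)
next
  case (trans u v w)
  then show ?case by (blast intro: pres_cong.trans)
next
  case (cancel u v x c)
  then show ?case using assms pres_cong.cancel[of "a @ u" X "v @ b" x c R] by simp
next
  case (relation u v r s)
  then show ?case using assms pres_cong.relation[of "a @ u" X "v @ b" r s R] by simp
qed

lemma pres_cong_append:
  assumes "(u, u') \<in> pres_cong X R" "(v, v') \<in> pres_cong X R"
  shows "(u @ v, u' @ v') \<in> pres_cong X R"
proof -
  have "(u @ v, u' @ v) \<in> pres_cong X R"
    using pres_cong_ctxt[OF assms(1), of "[]" v] pres_cong_words[OF assms(2)] by simp
  moreover have "(u' @ v, u' @ v') \<in> pres_cong X R"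
    using pres_cong_ctxt[OF assms(2), of u' "[]"] pres_cong_words[OF assms(1)] by simp
  ultimately show ?thesis by (rule pres_cong.trans)
qed

lemma presented_group_mult:
  assumes "u \<in> words X" "v \<in> words X"
  shows "pres_cong X R `` {u} \<otimes>\<^bsub>presented_group X R\<^esub> pres_cong X R `` {v} =
    pres_cong X R `` {u @ v}"
proof -
  have "(u @ v, w) \<in> pres_cong X R \<longleftrightarrow>
      (\<exists>u' v'. (u, u') \<in> pres_cong X R \<and> (v, v') \<in> pres_cong X R \<and> (u' @ v', w) \<in> pres_cong X R)"
    for w
    using assms by (meson pres_cong.refl pres_cong.sym pres_cong.trans pres_cong_append)
  then show ?thesis
    by (auto simp: presented_group_def Image_def)
qed

lemma pres_cong_inverse:
  assumes "w \<in> words X"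
  shows "(rev (map (apsnd Not) w) @ w, []) \<in> pres_cong X R"
  using assms
proof (induction w)
  case Nil
  then show ?case by (simp add: pres_cong.refl)
next
  case (Cons l w)
  obtain x b where l: "l = (x, b)" by force
  have x: "x \<in> X" and w: "w \<in> words X" using Cons.prems by (auto simp: l)
  have "rev (map (apsnd Not) w) \<in> words X"
    using w by (fastforce simp: words_def)
  from pres_cong.cancel[OF this w x, of "\<not> b" R]
  have "(rev (map (apsnd Not) (l # w)) @ l # w, rev (map (apsnd Not) w) @ w) \<in> pres_cong X R"
    by (simp add: l)
  then show ?case using Cons.IH[OF w] by (rule pres_cong.trans)
qed

lemma group_presented_group: "group (presented_group X R)"
proof (rule groupI)
  let ?G = "presented_group X R"
  have cl: "pres_cong X R `` {w} \<in> carrier ?G" if "w \<in> words X" for w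
    using that by (simp add: presented_group_def quotientI)
  have rep: "\<exists>w\<in>words X. A = pres_cong X R `` {w}" if "A \<in> carrier ?G" for A
    using that by (auto simp: presented_group_def quotient_def)
  have one: "\<one>\<^bsub>?G\<^esub> = pres_cong X R `` {[]}"
    by (simp add: presented_group_def)
  show "\<one>\<^bsub>?G\<^esub> \<in> carrier ?G"
    by (simp add: one cl)
  show "A \<otimes>\<^bsub>?G\<^esub> B \<in> carrier ?G" if "A \<in> carrier ?G" "B \<in> carrier ?G" for A B
    using rep[OF that(1)] rep[OF that(2)] by (auto simp: presented_group_mult cl)
  show "A \<otimes>\<^bsub>?G\<^esub> B \<otimes>\<^bsub>?G\<^esub> C = A \<otimes>\<^bsub>?G\<^esub> (B \<otimes>\<^bsub>?G\<^esub> C)"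
    if "A \<in> carrier ?G" "B \<in> carrier ?G" "C \<in> carrier ?G" for A B C
    using rep[OF that(1)] rep[OF that(2)] rep[OF that(3)] by (auto simp: presented_group_mult)
  show "\<one>\<^bsub>?G\<^esub> \<otimes>\<^bsub>?G\<^esub> A = A" if "A \<in> carrier ?G" for A
    using rep[OF that] by (auto simp: one presented_group_mult)
  show "\<exists>B\<in>carrier ?G. B \<otimes>\<^bsub>?G\<^esub> A = \<one>\<^bsub>?G\<^esub>" if "A \<in> carrier ?G" for A
  proof -
    obtain w where w: "w \<in> words X" "A = pres_cong X R `` {w}" using rep[OF \<open>A \<in> carrier ?G\<close>] by blast
    let ?w = "rev (map (apsnd Not) w)"
    have w': "?w \<in> words X" using w(1) by (fastforce simp: words_def)
    have "pres_cong X R `` {?w} \<otimes>\<^bsub>?G\<^esub> A = pres_cong X R `` {?w @ w}"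
      by (simp add: w presented_group_mult w')
    also have "\<dots> = \<one>\<^bsub>?G\<^esub>"
      unfolding one using equiv_class_eq[OF equiv_pres_cong pres_cong_inverse[OF w(1)]] .
    finally show ?thesis using cl[OF w'] by blast
  qed
qed

definition free_group :: "'x set \<Rightarrow> 'x word set monoid" where
  "free_group X = presented_group X {}"

text \<open>The free product of the groups \<open>H i\<close>, presented by the disjoint union of their
  carriers subject to all their multiplication tables.\<close>

definition free_product :: "'i set \<Rightarrow> ('i \<Rightarrow> 'g monoid) \<Rightarrow> ('i \<times> 'g) word set monoid" where
  "free_product I H = presented_group (Sigma I (\<lambda>i. carrier (H i)))
    {([((i, g), True), ((i, h), True)], [((i, g \<otimes>\<^bsub>H i\<^esub> h), True)]) | i g h.
      i \<in> I \<and> g \<in> carrier (H i) \<and> h \<in> carrier (H i)}"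

datatype bs_gen = Gen_a | Gen_t

text \<open>\<open>BS m n\<close> is generated by \<open>a, t\<close> with the relation \<open>t a^m t^-1 = a^n\<close>.\<close>

definition BS :: "nat \<Rightarrow> nat \<Rightarrow> bs_gen word set monoid" where
  "BS m n = presented_group UNIV
    {([(Gen_t, True)] @ replicate m (Gen_a, True) @ [(Gen_t, False)], replicate n (Gen_a, True))}"


section \<open>Properties of groups\<close>

definition finitely_generated :: "('a, 'b) monoid_scheme \<Rightarrow> bool" where
  "finitely_generated G \<longleftrightarrow> (\<exists>S. finite S \<and> S \<subseteq> carrier G \<and> generate G S = carrier G)"

definition torsion_free :: "('a, 'b) monoid_scheme \<Rightarrow> bool" where
  "torsion_free G \<longleftrightarrow>
    (\<forall>x\<in>carrier G. \<forall>n::nat. n > 0 \<longrightarrow> x [^]\<^bsub>G\<^esub> n = \<one>\<^bsub>G\<^esub> \<longrightarrow> x = \<one>\<^bsub>G\<^esub>)"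

definition embeds_into :: "('a, 'c) monoid_scheme \<Rightarrow> ('b, 'd) monoid_scheme \<Rightarrow> bool" where
  "embeds_into G H \<longleftrightarrow> mon G H \<noteq> {}"

text \<open>A basis of a free group is a subset of it, so it is no restriction to take the
  generating set \<open>X\<close> from the element type of \<open>G\<close>.\<close>

definition is_free_group :: "('a, 'b) monoid_scheme \<Rightarrow> bool" where
  "is_free_group G \<longleftrightarrow> (\<exists>X::'a set. G \<cong> free_group X)"

text \<open>The number of factors is arbitrary. Trivial factors can be dropped, and each nontrivial
  factor is isomorphic to a subgroup of \<open>P\<close> and can be indexed by one of its nontrivial
  elements; hence it is no restriction to take both the index set and the factors over the
  element type of \<open>P\<close>.\<close>

definition is_free_product_of_cyclic_groups :: "'a monoid \<Rightarrow> bool" where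
  "is_free_product_of_cyclic_groups P \<longleftrightarrow>
    group P \<and>
    (\<exists>(I::'a set) (C::'a \<Rightarrow> 'a monoid).
      (\<forall>i\<in>I. group (C i) \<and> cyclic_group (C i)) \<and> P \<cong> free_product I C)"

text \<open>There is an exact sequence \<open>1 \<rightarrow> A \<rightarrow> G \<rightarrow> P \<rightarrow> 1\<close> in which the image of \<open>A\<close> is central
  in \<open>G\<close>. (The library's \<open>exact_seq\<close> forces all groups to have the same element type.)\<close>

definition is_central_extension ::
    "('c, 'd) monoid_scheme \<Rightarrow> ('a, 'b) monoid_scheme \<Rightarrow> ('e, 'f) monoid_scheme \<Rightarrow> bool" where
  "is_central_extension A G P \<longleftrightarrow>
    (\<exists>\<iota> \<pi>. \<iota> \<in> mon A G \<and> \<pi> \<in> epi G P \<and> kernel G P \<pi> = \<iota> ` carrier A \<and>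
      (\<forall>z\<in>\<iota> ` carrier A. \<forall>x\<in>carrier G. z \<otimes>\<^bsub>G\<^esub> x = x \<otimes>\<^bsub>G\<^esub> z))"

text \<open>In an exact sequence as above, \<open>P\<close> is isomorphic to a group of cosets in \<open>G\<close>; hence it is
  no restriction to take the elements of \<open>P\<close> to be sets of elements of \<open>G\<close>.\<close>

definition is_central_extension_of_Z_by_free_product_of_cyclic_groups ::
    "('a, 'b) monoid_scheme \<Rightarrow> bool" where
  "is_central_extension_of_Z_by_free_product_of_cyclic_groups G \<longleftrightarrow>
    (\<exists>P::'a set monoid. is_free_product_of_cyclic_groups P \<and> is_central_extension integer_group G P)"

end

theory Submission
  imports Defs "HOL-Algebra.Multiplicative_Group" "HOL-Combinatorics.Permutations"
begin

text \<open>In \<open>BS(n,n)\<close> the element \<open>a\<^sup>n\<close> is central of infinite order, and dividing by it gives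
  \<open>Q = \<langle>a, t | a\<^sup>n\<rangle>\<close>, the free product of \<open>\<int>/n\<close> and \<open>\<int>\<close>. By the Kurosh subgroup theorem every
  subgroup of \<open>Q\<close> is a free product of cyclic groups. A subgroup of \<open>BS(n,n)\<close> either meets \<open>\<langle>a\<^sup>n\<rangle>\<close>
  trivially, and then it is a torsion-free subgroup of \<open>Q\<close>, hence free, or it is a central extension
  of an infinite cyclic subgroup of \<open>\<langle>a\<^sup>n\<rangle>\<close> by a subgroup of \<open>Q\<close>. Conversely, a finitely generated free
  product of cyclic groups embeds into \<open>Q\<close> if \<open>n\<close> is a multiple of the finite orders of the factors;
  the images of the generators lift to \<open>BS(n,n)\<close>, and for a torsion-free central extension the powers of
  the lifts can be adjusted so that the map extends to an embedding. Both the Kurosh theorem and the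
  embedding into \<open>Q\<close> come from letting \<open>Q\<close> act by monomial permutations with weights in a free
  product of cyclic groups \<open>K\<close>: the weight picked up at a base point is a homomorphism to \<open>K\<close>.\<close>

section \<open>Homomorphisms out of presented groups\<close>

text \<open>Freeness is encoded by maps instead of normal forms: \<open>cyc_indep G J\<close> asks
  for a homomorphism from the span of \<open>J\<close> back to the presented free product, and such
  homomorphisms are read off from actions. An action of \<open>Q\<close> is just a pair of
  permutations, the first with trivial n-th power.

  The delicate point of the converse is a basis element j of finite order m. A lift u to
  \<open>G\<close> satisfies u^m = z^s, where z generates the central subgroup, so its partner in
  BS(n,n) has to be an m-th root of (a^n)^s. A conjugate of a^((n/m) s) is one, and its image in
  \<open>Q\<close> still has order m exactly when s and m are coprime; torsion-freeness supplies
  this. Hence j goes to a conjugate of the s-th power of a^(n/m), not of a^(n/m) itself, and the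
  cycles in the action carry as weight a root \<alpha> of j with \<alpha>^s = j.

  The powers of t already serve to keep the factors apart, so an infinite factor uses a^-1 t a in
  place of t. This needs a nontrivial in \<open>Q\<close>, that is n \<ge> 2; indeed BS(1,1) is
  abelian.\<close>

definition weval :: "('a, 'b) monoid_scheme \<Rightarrow> ('x \<Rightarrow> 'a) \<Rightarrow> 'x word \<Rightarrow> 'a" where
  "weval G f w = foldr (\<lambda>(x, b) r. (if b then f x else inv\<^bsub>G\<^esub> f x) \<otimes>\<^bsub>G\<^esub> r) w \<one>\<^bsub>G\<^esub>"

definition pgen :: "'x set \<Rightarrow> ('x word \<times> 'x word) set \<Rightarrow> 'x \<Rightarrow> 'x word set" where
  "pgen X R x = pres_cong X R `` {[(x, True)]}"

lemma weval_Nil [simp]: "weval G f [] = \<one>\<^bsub>G\<^esub>"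
  by (simp add: weval_def)

lemma weval_Cons [simp]:
  "weval G f ((x, b) # w) = (if b then f x else inv\<^bsub>G\<^esub> f x) \<otimes>\<^bsub>G\<^esub> weval G f w"
  by (simp add: weval_def)

context group
begin

lemma weval_closed: "w \<in> words X \<Longrightarrow> f \<in> X \<rightarrow> carrier G \<Longrightarrow> weval G f w \<in> carrier G"
  by (induction w) (auto simp: Pi_iff)

lemma weval_append:
  "v \<in> words X \<Longrightarrow> w \<in> words X \<Longrightarrow> f \<in> X \<rightarrow> carrier G \<Longrightarrow>
    weval G f (v @ w) = weval G f v \<otimes> weval G f w"
proof (induction v)
  case (Cons l v)
  then show ?case by (cases l) (auto simp: m_assoc weval_closed Pi_iff)
qed (simp add: weval_closed)

lemma weval_replicate:
  "f x \<in> carrier G \<Longrightarrow> weval G f (replicate n (x, True)) = f x [^] n"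
proof (induction n)
  case (Suc n)
  then have "weval G f (replicate (Suc n) (x, True)) = f x \<otimes> f x [^] n" by simp
  also have "\<dots> = f x [^] Suc n" using Suc by (intro nat_pow_Suc2[symmetric])
  finally show ?case .
qed simp

lemma weval_pres_cong:
  assumes "(v, w) \<in> pres_cong X R" "f \<in> X \<rightarrow> carrier G"
    and "\<And>r s. (r, s) \<in> R \<Longrightarrow> r \<in> words X \<Longrightarrow> s \<in> words X \<Longrightarrow> weval G f r = weval G f s"
  shows "weval G f v = weval G f w"
  using assms(1)
proof (induction rule: pres_cong.induct)
  case (cancel u v x b)
  have "f x \<in> carrier G" using assms(2) cancel(3) by auto
  then have "weval G f ([(x, b), (x, \<not> b)] @ v) = weval G f v"
    using weval_closed[OF cancel(2) assms(2)] by (simp add: m_assoc[symmetric])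
  moreover have "weval G f (u @ ([(x, b), (x, \<not> b)] @ v)) = weval G f u \<otimes> weval G f ([(x, b), (x, \<not> b)] @ v)"
    using cancel assms(2) by (intro weval_append[of _ X]) auto
  ultimately show ?case using weval_append[OF cancel(1,2) assms(2)] by simp
next
  case (relation u v r s)
  then have "weval G f (r @ v) = weval G f (s @ v)"
    using weval_append[OF _ _ assms(2)] assms(3) by simp
  then show ?case
    using weval_append[OF relation(1) _ assms(2)] relation by simp
qed auto

text \<open>Von Dyck's theorem. The value on a class is computed from an arbitrary representative
  word; \<open>weval_pres_cong\<close> makes the choice irrelevant.\<close>

lemma presented_group_hom:
  assumes f: "f \<in> X \<rightarrow> carrier G"
    and rel: "\<And>r s. (r, s) \<in> R \<Longrightarrow> r \<in> words X \<Longrightarrow> s \<in> words X \<Longrightarrow> weval G f r = weval G f s"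
  obtains F where "F \<in> hom (presented_group X R) G" "\<And>x. x \<in> X \<Longrightarrow> F (pgen X R x) = f x"
proof
  define F where "F A = weval G f (SOME w. w \<in> A)" for A
  have F: "F (pres_cong X R `` {w}) = weval G f w" if "w \<in> words X" for w
  proof -
    have "w \<in> pres_cong X R `` {w}" using that by (simp add: pres_cong.refl)
    then have "(SOME v. v \<in> pres_cong X R `` {w}) \<in> pres_cong X R `` {w}"
      by (rule someI)
    then show ?thesis unfolding F_def
      using weval_pres_cong[OF _ f, of w "SOME v. v \<in> pres_cong X R `` {w}" R] rel by simp
  qed
  have rep: "\<exists>w\<in>words X. A = pres_cong X R `` {w}" if "A \<in> carrier (presented_group X R)" for A
    using that by (auto simp: presented_group_def quotient_def)
  show "F \<in> hom (presented_group X R) G"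
  proof (rule homI)
    show "F A \<in> carrier G" if "A \<in> carrier (presented_group X R)" for A
      using rep[OF that] by (auto simp: F weval_closed[OF _ f])
    show "F (A \<otimes>\<^bsub>presented_group X R\<^esub> B) = F A \<otimes> F B"
      if "A \<in> carrier (presented_group X R)" "B \<in> carrier (presented_group X R)" for A B
      using rep[OF that(1)] rep[OF that(2)]
      by (auto simp: F presented_group_mult weval_append[OF _ _ f])
  qed
  show "F (pgen X R x) = f x" if "x \<in> X" for x
    using that f F[of "[(x, True)]"] by (simp add: pgen_def Pi_iff)
qed

end

lemma one_presented_group: "\<one>\<^bsub>presented_group X R\<^esub> = pres_cong X R `` {[]}"
  by (simp add: presented_group_def)

lemma pgen_closed [intro]: "x \<in> X \<Longrightarrow> pgen X R x \<in> carrier (presented_group X R)"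
  by (simp add: presented_group_def pgen_def quotientI)

lemma inv_pgen:
  assumes "x \<in> X"
  shows "inv\<^bsub>presented_group X R\<^esub> pgen X R x = pres_cong X R `` {[(x, False)]}"
proof -
  interpret group "presented_group X R" by (rule group_presented_group)
  have "pres_cong X R `` {[(x, False)]} \<otimes>\<^bsub>presented_group X R\<^esub> pgen X R x = \<one>\<^bsub>presented_group X R\<^esub>"
    using assms equiv_class_eq[OF equiv_pres_cong pres_cong_inverse[of "[(x, True)]" X R]]
    by (simp add: pgen_def presented_group_mult one_presented_group)
  moreover have "pres_cong X R `` {[(x, False)]} \<in> carrier (presented_group X R)"
    using assms by (simp add: presented_group_def quotientI)
  ultimately show ?thesis using pgen_closed[OF assms] inv_equality by blast
qed

lemma weval_pgen:
  "w \<in> words X \<Longrightarrow> weval (presented_group X R) (pgen X R) w = pres_cong X R `` {w}"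
proof (induction w)
  case (Cons l w)
  obtain x b where "l = (x, b)" by force
  then show ?case using Cons
    by (cases b) (simp_all add: inv_pgen, simp_all add: pgen_def presented_group_mult)
qed (simp add: one_presented_group)

lemma presented_group_relation:
  assumes "(r, s) \<in> R" "r \<in> words X" "s \<in> words X"
  shows "weval (presented_group X R) (pgen X R) r = weval (presented_group X R) (pgen X R) s"
  using assms equiv_class_eq[OF equiv_pres_cong pres_cong.relation[of "[]" X "[]" r s R]]
  by (simp add: weval_pgen)

lemma generate_presented_group:
  "generate (presented_group X R) (pgen X R ` X) = carrier (presented_group X R)"
proof -
  interpret group "presented_group X R" by (rule group_presented_group)
  have "pres_cong X R `` {w} \<in> generate (presented_group X R) (pgen X R ` X)" if "w \<in> words X" for w
    using that
  proof (induction w)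
    case Nil
    then show ?case using generate.one by (metis one_presented_group)
  next
    case (Cons l w)
    obtain x b where l: "l = (x, b)" by force
    have "pres_cong X R `` {[(x, b)]} \<in> generate (presented_group X R) (pgen X R ` X)"
    proof (cases b)
      case True
      then show ?thesis using Cons.prems l
        by (auto simp: pgen_def[symmetric] intro: generate.incl)
    next
      case False
      then show ?thesis using Cons.prems l
        by (auto simp: inv_pgen[symmetric] intro: generate.inv)
    qed
    from generate.eng[OF this Cons.IH] show ?case
      using Cons.prems by (simp add: l presented_group_mult)
  qed
  then have "carrier (presented_group X R) \<subseteq> generate (presented_group X R) (pgen X R ` X)"
    by (auto simp: presented_group_def quotient_def)
  then show ?thesis using generate_incl[of "pgen X R ` X"] pgen_closed by blast
qed

text \<open>The uniqueness half of all universal properties below. It is stated for the span of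
  \<open>S\<close> as a group of its own because the homomorphisms that come from a basis are
  defined only there.\<close>

lemma hom_eq_on_generate:
  assumes "group G" "group L" "S \<subseteq> carrier G"
    and F: "F \<in> hom (G\<lparr>carrier := generate G S\<rparr>) L" and F': "F' \<in> hom (G\<lparr>carrier := generate G S\<rparr>) L"
    and eq: "\<And>s. s \<in> S \<Longrightarrow> F s = F' s" and x: "x \<in> generate G S"
  shows "F x = F' x"
proof -
  interpret G: group G by fact
  have sub: "subgroup (generate G S) G" by (rule G.generate_is_subgroup) fact
  interpret H: group "G\<lparr>carrier := generate G S\<rparr>" by (rule G.subgroup_imp_group) (rule sub)
  interpret F: group_hom "G\<lparr>carrier := generate G S\<rparr>" L F
    using assms(2) F by (simp add: group_hom_def group_hom_axioms_def H.group_axioms)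
  interpret F': group_hom "G\<lparr>carrier := generate G S\<rparr>" L F'
    using assms(2) F' by (simp add: group_hom_def group_hom_axioms_def H.group_axioms)
  show ?thesis using x
  proof (induction rule: generate.induct)
    case (inv h)
    then have "h \<in> generate G S" by (rule generate.incl)
    then show ?case using F.hom_inv[of h] F'.hom_inv[of h] eq[OF inv]
      by (simp add: G.m_inv_consistent[OF sub])
  next
    case (eng h1 h2)
    then show ?case using F.hom_mult[of h1 h2] F'.hom_mult[of h1 h2] by simp
  qed (use eq F.hom_one F'.hom_one in auto)
qed

lemma hom_eq_on_presented_group:
  assumes "group L" "F \<in> hom (presented_group X R) L" "F' \<in> hom (presented_group X R) L"
    and "\<And>x. x \<in> X \<Longrightarrow> F (pgen X R x) = F' (pgen X R x)" "y \<in> carrier (presented_group X R)"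
  shows "F y = F' y"
  using hom_eq_on_generate[OF group_presented_group assms(1), of "pgen X R ` X" X R F F' y] assms
    pgen_closed by (auto simp: generate_presented_group)

section \<open>Free bases of cyclic free products\<close>

definition cyc_rels :: "'x set \<Rightarrow> ('x \<Rightarrow> nat) \<Rightarrow> ('x word \<times> 'x word) set" where
  "cyc_rels J m = {(replicate (m j) (j, True), []) | j. j \<in> J}"

definition cyc_pres :: "'x set \<Rightarrow> ('x \<Rightarrow> nat) \<Rightarrow> 'x word set monoid" where
  "cyc_pres J m = presented_group J (cyc_rels J m)"

definition cgen :: "'x set \<Rightarrow> ('x \<Rightarrow> nat) \<Rightarrow> 'x \<Rightarrow> 'x word set" where
  "cgen J m = pgen J (cyc_rels J m)"

lemma group_cyc_pres: "group (cyc_pres J m)"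
  by (simp add: cyc_pres_def group_presented_group)

lemma cgen_closed [intro]: "j \<in> J \<Longrightarrow> cgen J m j \<in> carrier (cyc_pres J m)"
  by (auto simp: cyc_pres_def cgen_def)

lemma generate_cyc_pres: "generate (cyc_pres J m) (cgen J m ` J) = carrier (cyc_pres J m)"
  by (simp add: cyc_pres_def cgen_def generate_presented_group)

lemma words_replicate: "x \<in> X \<Longrightarrow> replicate n (x, b) \<in> words X"
  by (induction n) auto

lemma cgen_pow:
  assumes "j \<in> J"
  shows "cgen J m j [^]\<^bsub>cyc_pres J m\<^esub> m j = \<one>\<^bsub>cyc_pres J m\<^esub>"
proof -
  interpret group "cyc_pres J m" by (rule group_cyc_pres)
  have "(replicate (m j) (j, True), []) \<in> cyc_rels J m"
    using assms by (auto simp: cyc_rels_def)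
  from presented_group_relation[OF this words_replicate[OF assms]]
  show ?thesis using weval_replicate[of "cgen J m" j "m j"] cgen_closed[OF assms]
    by (simp add: cyc_pres_def cgen_def)
qed

lemma (in group) cyc_pres_hom:
  assumes f: "f \<in> J \<rightarrow> carrier G" and rel: "\<And>j. j \<in> J \<Longrightarrow> f j [^] m j = \<one>"
  obtains F where "F \<in> hom (cyc_pres J m) G" "\<And>j. j \<in> J \<Longrightarrow> F (cgen J m j) = f j"
proof -
  have "weval G f r = weval G f s" if "(r, s) \<in> cyc_rels J m" for r s
    using that rel f by (auto simp: cyc_rels_def weval_replicate Pi_iff)
  from presented_group_hom[OF f this] show ?thesis
    using that unfolding cyc_pres_def cgen_def by metis
qed

text \<open>\<open>J\<close> generates the free product of its cyclic subgroups: the canonical map from the abstract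
  free product has an inverse on \<open>generate G J\<close>. An element of infinite order has \<open>ord = 0\<close>, hence
  contributes the trivial relation.\<close>

definition cyc_indep :: "('a, 'b) monoid_scheme \<Rightarrow> 'a set \<Rightarrow> bool" where
  "cyc_indep G J \<longleftrightarrow> J \<subseteq> carrier G - {\<one>\<^bsub>G\<^esub>} \<and>
    (\<exists>F \<in> hom (G\<lparr>carrier := generate G J\<rparr>) (cyc_pres J (group.ord G)).
      \<forall>j\<in>J. F j = cgen J (group.ord G) j)"

lemma hom_comp: "f \<in> hom G H \<Longrightarrow> g \<in> hom H K \<Longrightarrow> (\<lambda>x. g (f x)) \<in> hom G K"
  by (auto simp: hom_def Pi_iff)

lemma hom_ident: "(\<lambda>x. x) \<in> hom G G"
  by (auto simp: hom_def)

lemma cyc_indep_subset: "cyc_indep G J \<Longrightarrow> J \<subseteq> carrier G"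
  by (auto simp: cyc_indep_def)

lemma cyc_indep_not_one: "cyc_indep G J \<Longrightarrow> \<one>\<^bsub>G\<^esub> \<notin> J"
  by (auto simp: cyc_indep_def)

text \<open>Universal property of an internal free product of cyclic groups: the inverse of the
  canonical map is followed by the map out of the presentation.\<close>

lemma (in group) cyc_indep_hom:
  assumes J: "cyc_indep G J" and L: "group L" and f: "f \<in> J \<rightarrow> carrier L"
    and rel: "\<And>j. j \<in> J \<Longrightarrow> f j [^]\<^bsub>L\<^esub> ord j = \<one>\<^bsub>L\<^esub>"
  obtains F where "F \<in> hom (G\<lparr>carrier := generate G J\<rparr>) L" "\<And>j. j \<in> J \<Longrightarrow> F j = f j"
proof -
  obtain F where F: "F \<in> hom (G\<lparr>carrier := generate G J\<rparr>) (cyc_pres J ord)" "\<And>j. j \<in> J \<Longrightarrow> F j = cgen J ord j"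
    using J by (auto simp: cyc_indep_def)
  obtain F' where F': "F' \<in> hom (cyc_pres J ord) L" "\<And>j. j \<in> J \<Longrightarrow> F' (cgen J ord j) = f j"
    using group.cyc_pres_hom[OF L f rel] by metis
  show ?thesis
    using that[OF hom_comp[OF F(1) F'(1)]] F(2) F'(2) by simp
qed

section \<open>Pulling bases back along injective homomorphisms\<close>

lemma ord_inj_hom:
  assumes "group G" "group H" "h \<in> hom G H" "inj_on h (carrier G)" "x \<in> carrier G"
  shows "group.ord H (h x) = group.ord G x"
proof -
  interpret group_hom G H h using assms by (simp add: group_hom_def group_hom_axioms_def)
  have "h x [^]\<^bsub>H\<^esub> (n::nat) = \<one>\<^bsub>H\<^esub> \<longleftrightarrow> x [^]\<^bsub>G\<^esub> n = \<one>\<^bsub>G\<^esub>" for n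
    using assms(4,5) hom_nat_pow[of x n] hom_one
    by (metis G.nat_pow_closed G.one_closed inj_on_eq_iff)
  then show ?thesis using H.ord_unique[of "h x" "G.ord x"] assms(5) by (simp add: G.pow_eq_id)
qed

text \<open>Injections preserve orders, so the presentations on \<open>J\<close> and on its preimage
  have the same relations. This carries a basis found inside \<open>Q\<close> back to an abstract
  group.\<close>

lemma cyc_indep_vimage:
  assumes G: "group G" and L: "group L" and h: "h \<in> hom L G" and inj: "inj_on h (carrier L)"
    and J: "cyc_indep G J" and sub: "J \<subseteq> h ` carrier L"
  defines "J' \<equiv> {x \<in> carrier L. h x \<in> J}"
  shows "cyc_indep L J'" and "h ` generate L J' = generate G J"
proof -
  interpret group_hom L G h using G L h by (simp add: group_hom_def group_hom_axioms_def)
  let ?k = "inv_into (carrier L) h"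
  have k: "?k (h x) = x" if "x \<in> carrier L" for x using inj that by simp
  have hJ': "h ` J' = J" using sub by (auto simp: J'_def)
  have J'L: "J' \<subseteq> carrier L" by (auto simp: J'_def)
  show *: "h ` generate L J' = generate G J"
    using generate_img[OF J'L] hJ' by simp
  have kJ: "?k j \<in> J'" if "j \<in> J" for j
    using that sub hJ' k J'L by (metis (no_types, lifting) imageE subsetD)
  have ok: "G.ord (?k j) = H.ord j" if "j \<in> J" for j
    using ord_inj_hom[OF L G h inj, of "?k j"] kJ[OF that] J'L sub that
    by (metis (no_types, lifting) f_inv_into_f subsetD)
  \<comment> \<open>The target is already the free product on the preimages, so that precomposing
    with \<open>h\<close> gives the map that independence of \<open>J'\<close> requires.\<close>
  obtain F where F: "F \<in> hom (G\<lparr>carrier := generate G J\<rparr>) (cyc_pres J' G.ord)"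
    "\<And>j. j \<in> J \<Longrightarrow> F j = cgen J' G.ord (?k j)"
  proof (rule H.cyc_indep_hom[OF J group_cyc_pres, of "\<lambda>j. cgen J' G.ord (?k j)"])
    show "cgen J' G.ord (?k j) [^]\<^bsub>cyc_pres J' G.ord\<^esub> H.ord j = \<one>\<^bsub>cyc_pres J' G.ord\<^esub>"
      if "j \<in> J" for j
      using cgen_pow[OF kJ[OF that], of G.ord] ok[OF that] by simp
  qed (use kJ in auto)
  have "h \<in> hom (L\<lparr>carrier := generate L J'\<rparr>) (G\<lparr>carrier := generate G J\<rparr>)"
  proof (rule homI)
    show "h x \<in> carrier (G\<lparr>carrier := generate G J\<rparr>)" if "x \<in> carrier (L\<lparr>carrier := generate L J'\<rparr>)" for x
      using that * by auto
  qed (use G.generate_in_carrier[OF J'L] in simp)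
  from hom_comp[OF this F(1)] have "(\<lambda>x. F (h x)) \<in> hom (L\<lparr>carrier := generate L J'\<rparr>) (cyc_pres J' G.ord)" .
  moreover have "F (h j) = cgen J' G.ord j" if "j \<in> J'" for j
    using F(2)[of "h j"] that k by (auto simp: J'_def)
  moreover have "J' \<subseteq> carrier L - {\<one>\<^bsub>L\<^esub>}"
    using cyc_indep_not_one[OF J] by (auto simp: J'_def)
  ultimately show "cyc_indep L J'"
    unfolding cyc_indep_def by (intro conjI bexI[of _ "\<lambda>x. F (h x)"] ballI) simp_all
qed

lemma (in group) generate_diff_one:
  assumes "S \<subseteq> carrier G"
  shows "generate G (S - {\<one>}) = generate G S"
proof
  show "generate G (S - {\<one>}) \<subseteq> generate G S" by (rule mono_generate) auto
  have "S \<subseteq> generate G (S - {\<one>})" by (auto intro: generate.incl generate.one)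
  then show "generate G S \<subseteq> generate G (S - {\<one>})"
    by (rule generate_subgroup_incl) (use assms in \<open>auto intro: generate_is_subgroup\<close>)
qed

section \<open>Passing between bases and presentations\<close>

lemma cyc_basis_iso:
  assumes G: "group G" and J: "cyc_indep G J" and gen: "generate G J = carrier G"
  shows "G \<cong> cyc_pres J (group.ord G)"
proof -
  interpret group G by (rule G)
  obtain F where F: "F \<in> hom G (cyc_pres J ord)" "\<And>j. j \<in> J \<Longrightarrow> F j = cgen J ord j"
    using J by (auto simp: cyc_indep_def gen)
  have JG: "j \<in> J \<Longrightarrow> j \<in> carrier G" for j using cyc_indep_subset[OF J] by auto
  obtain F' where F': "F' \<in> hom (cyc_pres J ord) G" "\<And>j. j \<in> J \<Longrightarrow> F' (cgen J ord j) = j"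
    by (rule cyc_pres_hom[of "\<lambda>j. j" J ord]) (use JG in auto)
  have "F' (F x) = x" if "x \<in> carrier G" for x
    by (rule hom_eq_on_generate[OF G G cyc_indep_subset[OF J], where F = "\<lambda>x. F' (F x)" and F' = "\<lambda>x. x"])
      (simp_all add: gen that F(2) F'(2) hom_ident hom_comp[OF F(1) F'(1)])
  moreover have "F (F' y) = y" if "y \<in> carrier (cyc_pres J ord)" for y
    by (rule hom_eq_on_generate[OF group_cyc_pres group_cyc_pres[of J ord],
          where S = "cgen J ord ` J" and F = "\<lambda>x. F (F' x)" and F' = "\<lambda>x. x"])
      (use cgen_closed in \<open>auto simp: generate_cyc_pres that F(2) F'(2) hom_ident hom_comp[OF F'(1) F(1)]\<close>)
  ultimately show ?thesis
    using F(1) F'(1) group_isomorphisms_imp_iso[of G "cyc_pres J ord" F F']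
    by (auto simp: group_isomorphisms_def intro: is_isoI)
qed

lemma cyc_pres_free:
  assumes "\<And>j. j \<in> J \<Longrightarrow> m j = 0"
  shows "cyc_pres J m \<cong> free_group J"
proof -
  let ?F = "presented_group J {}"
  interpret F: group ?F by (rule group_presented_group)
  interpret C: group "cyc_pres J m" by (rule group_cyc_pres)
  obtain f where f: "f \<in> hom (cyc_pres J m) ?F" "\<And>j. j \<in> J \<Longrightarrow> f (cgen J m j) = pgen J {} j"
    using F.cyc_pres_hom[of "pgen J {}" J m] assms by auto
  obtain g where g: "g \<in> hom ?F (cyc_pres J m)" "\<And>j. j \<in> J \<Longrightarrow> g (pgen J {} j) = cgen J m j"
    using C.presented_group_hom[of "cgen J m" J "{}"] by auto
  have "g (f x) = x" if "x \<in> carrier (cyc_pres J m)" for x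
    by (rule hom_eq_on_generate[OF group_cyc_pres group_cyc_pres[of J m],
          where S = "cgen J m ` J" and F = "\<lambda>x. g (f x)" and F' = "\<lambda>x. x"])
      (use cgen_closed in \<open>auto simp: generate_cyc_pres that f(2) g(2) hom_ident hom_comp[OF f(1) g(1)]\<close>)
  moreover have "f (g x) = x" if "x \<in> carrier ?F" for x
    by (rule hom_eq_on_presented_group[OF F.group_axioms,
          where X = J and R = "{}" and F = "\<lambda>x. f (g x)" and F' = "\<lambda>x. x"])
      (simp_all add: that f(2) g(2) hom_ident hom_comp[OF g(1) f(1)])
  ultimately show ?thesis
    using f(1) g(1) group_isomorphisms_imp_iso[of "cyc_pres J m" ?F f g]
    by (auto simp: group_isomorphisms_def free_group_def intro: is_isoI)
qed

text \<open>Generators found later, such as Schreier generators, may be trivial, whereas a basis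
  must not contain \<open>\<one>\<close>. Discarding it leaves the span unchanged.\<close>

lemma (in group) cyc_indepI:
  assumes S: "S \<subseteq> carrier G"
    and F: "F \<in> hom (G\<lparr>carrier := generate G S\<rparr>) (cyc_pres (S - {\<one>}) ord)"
    and "\<And>s. s \<in> S \<Longrightarrow> s \<noteq> \<one> \<Longrightarrow> F s = cgen (S - {\<one>}) ord s"
  shows "cyc_indep G (S - {\<one>})"
  using assms unfolding cyc_indep_def by (auto simp: generate_diff_one)

text \<open>Collapsing all basis elements outside a finite set shows that a basis of a finitely
  generated group is finite.\<close>

lemma (in group) generate_finite_support:
  "x \<in> generate G J \<Longrightarrow> \<exists>K. finite K \<and> K \<subseteq> J \<and> x \<in> generate G K"
proof (induction rule: generate.induct)
  case one
  show ?case by (rule exI[of _ "{}"]) (auto intro: generate.one)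
next
  case (incl h)
  then show ?case by (intro exI[of _ "{h}"]) (auto intro: generate.incl)
next
  case (inv h)
  then show ?case by (intro exI[of _ "{h}"]) (auto intro: generate.inv)
next
  case (eng h1 h2)
  then obtain K1 K2 where "finite K1" "K1 \<subseteq> J" "h1 \<in> generate G K1" "finite K2" "K2 \<subseteq> J" "h2 \<in> generate G K2"
    by blast
  then show ?case
    using mono_generate[of K1 "K1 \<union> K2"] mono_generate[of K2 "K1 \<union> K2"]
    by (intro exI[of _ "K1 \<union> K2"]) (auto intro!: generate.eng)
qed

lemma (in group) cyc_basis_finite:
  assumes J: "cyc_indep G J" and gen: "generate G J = carrier G" and fg: "finitely_generated G"
  shows "finite J"
proof -
  obtain S where S: "finite S" "S \<subseteq> carrier G" "generate G S = carrier G"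
    using fg by (auto simp: finitely_generated_def)
  have "\<forall>s\<in>S. \<exists>K. finite K \<and> K \<subseteq> J \<and> s \<in> generate G K"
    using S(2) gen generate_finite_support by blast
  then obtain K where K: "\<And>s. s \<in> S \<Longrightarrow> finite (K s) \<and> K s \<subseteq> J \<and> s \<in> generate G (K s)"
    by metis
  define U where "U = (\<Union>s\<in>S. K s)"
  have U: "finite U" "U \<subseteq> J" using K S(1) by (auto simp: U_def)
  have UG: "U \<subseteq> carrier G" using U(2) cyc_indep_subset[OF J] by blast
  have "s \<in> generate G U" if "s \<in> S" for s
    using K[OF that] mono_generate[of "K s" U] that by (auto simp: U_def)
  then have "generate G S \<subseteq> generate G U"
    by (intro generate_subgroup_incl[OF _ generate_is_subgroup[OF UG]]) auto
  then have genU: "generate G U = carrier G" using S(3) generate_incl[OF UG] by blast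
  have "J \<subseteq> U"
  proof (rule ccontr)
    assume "\<not> J \<subseteq> U"
    then obtain i where i: "i \<in> J" "i \<notin> U" by blast
    have iG: "i \<in> carrier G" "i \<noteq> \<one>" using i(1) cyc_indep_subset[OF J] cyc_indep_not_one[OF J] by auto
    \<comment> \<open>The projection onto the factor of \<open>i\<close> kills \<open>U\<close>.
      Since \<open>U\<close> generates \<open>G\<close>, the projection is trivial, yet it fixes
      \<open>i\<close>.\<close>
    obtain F where "F \<in> hom (G\<lparr>carrier := generate G J\<rparr>) G"
      and F: "\<And>j. j \<in> J \<Longrightarrow> F j = (if j = i then i else \<one>)"
      by (rule cyc_indep_hom[OF J group_axioms, of "\<lambda>j. if j = i then i else \<one>"]) (use iG in auto)
    then have FG: "F \<in> hom G G" by (simp add: gen)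
    have "F i = \<one>"
      by (rule hom_eq_on_generate[OF group_axioms group_axioms UG, of F "\<lambda>_. \<one>"])
        (use FG F i U iG in \<open>auto simp: genU hom_def\<close>)
    with F[OF i(1)] iG show False by simp
  qed
  then show ?thesis using U finite_subset by blast
qed

text \<open>A map out of a free group is unconstrained, so it reaches the free product of cyclic
  groups whatever orders the images of the free generators have in \<open>G\<close>.\<close>

lemma (in group) free_basis:
  assumes free: "is_free_group G"
  obtains J where "cyc_indep G J" "generate G J = carrier G"
proof -
  obtain X :: "'a set" where X: "G \<cong> presented_group X {}" using free by (auto simp: is_free_group_def free_group_def)
  let ?P = "presented_group X {}"
  obtain h k where hk: "group_isomorphisms G ?P h k"
    using X iso_iff_group_isomorphisms[of _ ?P] unfolding is_iso_def by blast
  interpret k: group_hom ?P G k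
    using hk group_axioms
    by (simp add: group_hom_def group_hom_axioms_def group_presented_group group_isomorphisms_def)
  have khG: "k ` carrier ?P = carrier G"
  proof
    show "k ` carrier ?P \<subseteq> carrier G" by auto
    show "carrier G \<subseteq> k ` carrier ?P"
    proof
      fix y assume "y \<in> carrier G"
      then have "y = k (h y)" "h y \<in> carrier ?P" using hk by (auto simp: group_isomorphisms_def hom_def)
      then show "y \<in> k ` carrier ?P" by (rule image_eqI)
    qed
  qed
  define S where "S = k ` pgen X {} ` X"
  have S: "S \<subseteq> carrier G" unfolding S_def using pgen_closed by (auto intro!: k.hom_closed)
  have gS: "generate G S = carrier G"
    using k.generate_img[of "pgen X {} ` X"] khG
    by (simp add: S_def generate_presented_group image_subset_iff pgen_closed)
  let ?C = "cyc_pres (S - {\<one>}) ord"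
  interpret C: group ?C by (rule group_cyc_pres)
  \<comment> \<open>\<open>cgen\<close> is a group element only for members of the index set; a
    discarded generator goes to the identity.\<close>
  define e where "e s = (if s = \<one> then \<one>\<^bsub>?C\<^esub> else cgen (S - {\<one>}) ord s)" for s
  obtain F where F: "F \<in> hom ?P ?C" "\<And>x. x \<in> X \<Longrightarrow> F (pgen X {} x) = e (k (pgen X {} x))"
  proof (rule C.presented_group_hom)
    show "(\<lambda>x. e (k (pgen X {} x))) \<in> X \<rightarrow> carrier ?C"
    proof (rule Pi_I)
      fix x assume "x \<in> X"
      then have "k (pgen X {} x) \<in> S" by (simp add: S_def)
      then show "e (k (pgen X {} x)) \<in> carrier ?C"
        using cgen_closed[of "k (pgen X {} x)" "S - {\<one>}"] by (simp add: e_def)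
    qed
  qed auto
  have "cyc_indep G (S - {\<one>})"
  proof (rule cyc_indepI[OF S])
    show "(\<lambda>x. F (h x)) \<in> hom (G\<lparr>carrier := generate G S\<rparr>) ?C"
      using hom_comp[OF _ F(1), of h G] hk by (simp add: gS group_isomorphisms_def)
    show "F (h s) = cgen (S - {\<one>}) ord s" if s: "s \<in> S" "s \<noteq> \<one>" for s
    proof -
      obtain x where x: "x \<in> X" "s = k (pgen X {} x)" using s(1) by (auto simp: S_def)
      then have "h s = pgen X {} x" using hk pgen_closed[OF x(1)] by (auto simp: group_isomorphisms_def)
      then show ?thesis using F(2)[OF x(1)] x(2) s(2) by (simp add: e_def)
    qed
  qed
  then show ?thesis using that[of "S - {\<one>}"] by (simp add: generate_diff_one[OF S] gS)
qed

section \<open>Free products of cyclic groups\<close>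

definition fp_rels :: "'i set \<Rightarrow> ('i \<Rightarrow> 'g monoid) \<Rightarrow> (('i \<times> 'g) word \<times> ('i \<times> 'g) word) set" where
  "fp_rels I H = {([((i, g), True), ((i, h), True)], [((i, g \<otimes>\<^bsub>H i\<^esub> h), True)]) | i g h.
      i \<in> I \<and> g \<in> carrier (H i) \<and> h \<in> carrier (H i)}"

definition fp_in :: "'i set \<Rightarrow> ('i \<Rightarrow> 'g monoid) \<Rightarrow> 'i \<Rightarrow> 'g \<Rightarrow> ('i \<times> 'g) word set" where
  "fp_in I H i g = pgen (Sigma I (\<lambda>i. carrier (H i))) (fp_rels I H) (i, g)"

lemma free_product_eq: "free_product I H = presented_group (Sigma I (\<lambda>i. carrier (H i))) (fp_rels I H)"
  by (simp add: free_product_def fp_rels_def)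

lemma group_free_product: "group (free_product I H)"
  by (simp add: free_product_eq group_presented_group)

lemma fp_in_closed [intro]: "i \<in> I \<Longrightarrow> g \<in> carrier (H i) \<Longrightarrow> fp_in I H i g \<in> carrier (free_product I H)"
  by (auto simp: fp_in_def free_product_eq)

lemma fp_in_hom:
  assumes i: "i \<in> I" and H: "group (H i)"
  shows "fp_in I H i \<in> hom (H i) (free_product I H)"
proof (rule homI)
  let ?P = "free_product I H"
  interpret P: group ?P by (rule group_free_product)
  interpret H: group "H i" by (rule H)
  show cl: "fp_in I H i g \<in> carrier ?P" if "g \<in> carrier (H i)" for g
    using i that by (rule fp_in_closed)
  fix g h assume gh: "g \<in> carrier (H i)" "h \<in> carrier (H i)"
  have "([((i, g), True), ((i, h), True)], [((i, g \<otimes>\<^bsub>H i\<^esub> h), True)]) \<in> fp_rels I H"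
    using i gh by (auto simp: fp_rels_def)
  from presented_group_relation[OF this] i gh
  have "weval ?P (case_prod (fp_in I H)) [((i, g), True), ((i, h), True)] =
      weval ?P (case_prod (fp_in I H)) [((i, g \<otimes>\<^bsub>H i\<^esub> h), True)]"
    by (simp add: free_product_eq fp_in_def case_prod_beta')
  then show "fp_in I H i (g \<otimes>\<^bsub>H i\<^esub> h) = fp_in I H i g \<otimes>\<^bsub>?P\<^esub> fp_in I H i h"
    using cl[OF gh(1)] cl[OF gh(2)] cl[OF H.m_closed[OF gh]]
    by simp
qed

lemma (in group) free_product_hom:
  assumes f: "\<And>i. i \<in> I \<Longrightarrow> f i \<in> hom (H i) G"
  obtains F where "F \<in> hom (free_product I H) G"
    "\<And>i g. i \<in> I \<Longrightarrow> g \<in> carrier (H i) \<Longrightarrow> F (fp_in I H i g) = f i g"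
proof -
  have fc: "f i g \<in> carrier G" if "i \<in> I" "g \<in> carrier (H i)" for i g
    using f[OF that(1)] that(2) by (auto simp: hom_def)
  obtain F where "F \<in> hom (free_product I H) G"
    "\<And>x. x \<in> Sigma I (\<lambda>i. carrier (H i)) \<Longrightarrow>
        F (pgen (Sigma I (\<lambda>i. carrier (H i))) (fp_rels I H) x) = case_prod f x"
  proof (rule presented_group_hom[of "case_prod f"])
    show "case_prod f \<in> Sigma I (\<lambda>i. carrier (H i)) \<rightarrow> carrier G" using fc by auto
    show "weval G (case_prod f) r = weval G (case_prod f) s"
      if "(r, s) \<in> fp_rels I H" "r \<in> words (Sigma I (\<lambda>i. carrier (H i)))" for r s
      using that f fc by (auto simp: fp_rels_def hom_def)
  qed (auto simp: free_product_eq)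
  then show ?thesis using that by (simp add: fp_in_def)
qed

lemma hom_eq_on_free_product:
  assumes "group L" "F \<in> hom (free_product I H) L" "F' \<in> hom (free_product I H) L"
    and "\<And>i g. i \<in> I \<Longrightarrow> g \<in> carrier (H i) \<Longrightarrow> F (fp_in I H i g) = F' (fp_in I H i g)"
    and "y \<in> carrier (free_product I H)"
  shows "F y = F' y"
  using hom_eq_on_presented_group[OF assms(1), of F "Sigma I (\<lambda>i. carrier (H i))" "fp_rels I H" F' y] assms(2-)
  by (auto simp: free_product_eq fp_in_def)

text \<open>The factors are the cyclic subgroups generated by single basis elements, indexed by
  these elements themselves; this fits the types fixed in the definition.\<close>

lemma cyc_basis_free_product:
  fixes P :: "'a monoid" (structure)
  assumes P: "group P" and J: "cyc_indep P J" and gen: "generate P J = carrier P"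
  shows "is_free_product_of_cyclic_groups P"
proof -
  interpret group P by (rule P)
  have JP: "j \<in> carrier P" if "j \<in> J" for j using that cyc_indep_subset[OF J] by auto
  define C where "C j = subgroup_generated P {j}" for j
  let ?Q = "free_product J C"
  interpret Q: group ?Q by (rule group_free_product)
  have C: "group (C j)" for j by (simp add: C_def)
  have cc: "carrier (C j) = range (\<lambda>k::int. j [^] k)" if "j \<in> J" for j
    using carrier_subgroup_generated_by_singleton[OF JP[OF that]] by (simp add: C_def)
  have jC: "j \<in> carrier (C j)" if "j \<in> J" for j
    using cc[OF that] int_pow_1[OF JP[OF that]] by (metis rangeI)
  have powC: "j [^]\<^bsub>C j\<^esub> (k::int) = j [^] k" if "j \<in> J" for j k
    using int_pow_subgroup_generated[of j "{j}" k] jC[OF that] by (simp add: C_def)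
  obtain f where f: "f \<in> hom ?Q P" "\<And>j g. j \<in> J \<Longrightarrow> g \<in> carrier (C j) \<Longrightarrow> f (fp_in J C j g) = g"
  proof (rule free_product_hom[of J "\<lambda>_ g. g" C])
    show "(\<lambda>g. g) \<in> hom (C j) P" if "j \<in> J" for j
      unfolding C_def using carrier_subgroup_generated_subset[of "{j}"] by (auto simp: hom_def)
  qed blast
  obtain h where "h \<in> hom (P\<lparr>carrier := generate P J\<rparr>) ?Q" and h2: "\<And>j. j \<in> J \<Longrightarrow> h j = fp_in J C j j"
  proof (rule cyc_indep_hom[OF J Q.group_axioms, of "\<lambda>j. fp_in J C j j"])
    show "(\<lambda>j. fp_in J C j j) \<in> J \<rightarrow> carrier ?Q" using jC by auto
    show "fp_in J C j j [^]\<^bsub>?Q\<^esub> ord j = \<one>\<^bsub>?Q\<^esub>" if j: "j \<in> J" for j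
    proof -
      interpret i: group_hom "C j" ?Q "fp_in J C j"
        using fp_in_hom[OF j C] C Q.group_axioms by (simp add: group_hom_def group_hom_axioms_def)
      have "j [^]\<^bsub>C j\<^esub> ord j = \<one>\<^bsub>C j\<^esub>"
        using pow_ord_eq_1[OF JP[OF j]] pow_subgroup_generated[of P "{j}"] by (simp add: C_def)
      then show ?thesis using i.hom_nat_pow[OF jC[OF j], of "ord j"] by simp
    qed
  qed auto
  then have h1: "h \<in> hom P ?Q" by (simp add: gen)
  interpret h: group_hom P ?Q h
    using h1 P Q.group_axioms by (simp add: group_hom_def group_hom_axioms_def)
  have "f (h x) = x" if "x \<in> carrier P" for x
    by (rule hom_eq_on_generate[OF P P cyc_indep_subset[OF J], where F = "\<lambda>x. f (h x)" and F' = "\<lambda>x. x"])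
      (simp_all add: gen that h2 f(2) jC hom_ident hom_comp[OF h1 f(1)])
  moreover have "h (f x) = x" if "x \<in> carrier ?Q" for x
  proof (rule hom_eq_on_free_product[OF Q.group_axioms, where F = "\<lambda>x. h (f x)" and F' = "\<lambda>x. x"])
    fix j g assume j: "j \<in> J" "g \<in> carrier (C j)"
    interpret i: group_hom "C j" ?Q "fp_in J C j"
      using fp_in_hom[OF j(1) C] C Q.group_axioms by (simp add: group_hom_def group_hom_axioms_def)
    obtain k :: int where k: "g = j [^] k" using cc j by auto
    \<comment> \<open>Both maps are homomorphisms on the factor, which consists of the powers of
      \<open>j\<close>, so agreement at \<open>j\<close> suffices.\<close>
    have "h g = fp_in J C j j [^]\<^bsub>?Q\<^esub> k"
      using h.hom_int_pow[OF JP[OF j(1)], of k] h2[OF j(1)] k by simp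
    also have "\<dots> = fp_in J C j g"
      using i.hom_int_pow[OF jC[OF j(1)], of k] powC[OF j(1)] k by simp
    finally show "h (f (fp_in J C j g)) = fp_in J C j g" using f(2)[OF j] by simp
  qed (use that in \<open>simp_all add: hom_ident hom_comp[OF f(1) h1]\<close>)
  ultimately have "h \<in> iso P ?Q"
    using f(1) h1 group_isomorphisms_imp_iso[of P ?Q h f] by (auto simp: group_isomorphisms_def)
  moreover have "\<forall>j\<in>J. group (C j) \<and> cyclic_group (C j)"
    using C cyclic_group_generated by (simp add: C_def)
  ultimately show ?thesis
    unfolding is_free_product_of_cyclic_groups_def using P is_isoI by blast
qed

section \<open>Bases of abstract free products\<close>

text \<open>The order of \<open>d\<close> divides that of \<open>c\<close>, where order 0 means
  infinite; hence the power of \<open>d\<close> does not depend on the chosen exponent of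
  \<open>c\<close>.\<close>

lemma (in group) cyclic_hom:
  assumes C: "group C" "c \<in> carrier C" "carrier C = range (\<lambda>k::int. c [^]\<^bsub>C\<^esub> k)"
    and d: "d \<in> carrier G" "\<And>n::nat. c [^]\<^bsub>C\<^esub> n = \<one>\<^bsub>C\<^esub> \<Longrightarrow> d [^] n = \<one>"
  obtains f where "f \<in> hom C G" "\<And>k::int. f (c [^]\<^bsub>C\<^esub> k) = d [^] k"
proof -
  interpret C: group C by (rule C)
  have "ord d dvd C.ord c" using d(2)[of "C.ord c"] C(2) pow_eq_id[OF d(1)] by simp
  then have wd: "d [^] k = d [^] l" if "c [^]\<^bsub>C\<^esub> k = c [^]\<^bsub>C\<^esub> l" for k l :: int
    using that C.int_pow_eq[OF C(2), of k l] int_pow_eq[OF d(1), of k l]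
    by (meson dvd_trans int_dvd_int_iff)
  define f where "f x = d [^] (SOME k::int. x = c [^]\<^bsub>C\<^esub> k)" for x
  have f: "f (c [^]\<^bsub>C\<^esub> k) = d [^] k" for k :: int
  proof -
    have "c [^]\<^bsub>C\<^esub> k = c [^]\<^bsub>C\<^esub> (SOME l::int. c [^]\<^bsub>C\<^esub> k = c [^]\<^bsub>C\<^esub> l)"
      by (rule someI[where x = k]) simp
    from wd[OF this] show ?thesis by (simp add: f_def)
  qed
  have "f \<in> hom C G"
  proof (rule homI)
    show "f x \<in> carrier G" if "x \<in> carrier C" for x using d(1) by (simp add: f_def)
    fix x y assume "x \<in> carrier C" "y \<in> carrier C"
    then obtain k l :: int where "x = c [^]\<^bsub>C\<^esub> k" "y = c [^]\<^bsub>C\<^esub> l" using C(3) by auto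
    then show "f (x \<otimes>\<^bsub>C\<^esub> y) = f x \<otimes> f y"
      using f[of "k + l"] f[of k] f[of l] C.int_pow_mult[OF C(2), of k l] int_pow_mult[OF d(1), of k l] by simp
  qed
  then show ?thesis using that f by blast
qed

text \<open>Converse of \<open>cyc_basis_free_product\<close>: one generator is chosen in each
  factor and moved to \<open>G\<close>. Orders are measured on the images \<open>y i\<close> in
  \<open>G\<close>, and the inverse map is assembled factor by factor.\<close>

lemma (in group) free_product_basis:
  fixes C :: "'i \<Rightarrow> 'c monoid"
  assumes C: "\<And>i. i \<in> I \<Longrightarrow> group (C i) \<and> cyclic_group (C i)" and iso: "G \<cong> free_product I C"
  obtains J where "cyc_indep G J" "generate G J = carrier G"
proof -
  let ?P = "free_product I C"
  interpret P: group ?P by (rule group_free_product)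
  obtain h k where hk: "group_isomorphisms G ?P h k"
    using iso iso_iff_group_isomorphisms[of _ ?P] unfolding is_iso_def by blast
  interpret k: group_hom ?P G k
    using hk group_axioms P.group_axioms
    by (simp add: group_hom_def group_hom_axioms_def group_isomorphisms_def)
  have "\<exists>c. \<forall>i\<in>I. c i \<in> carrier (C i) \<and> carrier (C i) = range (\<lambda>n::int. c i [^]\<^bsub>C i\<^esub> n)"
    by (rule bchoice) (use C group.cyclic_group in blast)
  then obtain c where c: "\<And>i. i \<in> I \<Longrightarrow> c i \<in> carrier (C i)"
    "\<And>i. i \<in> I \<Longrightarrow> carrier (C i) = range (\<lambda>n::int. c i [^]\<^bsub>C i\<^esub> n)" by metis
  define y where "y i = k (fp_in I C i (c i))" for i
  have kin: "(\<lambda>g. k (fp_in I C i g)) \<in> hom (C i) G" if "i \<in> I" for i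
    using hom_comp[OF fp_in_hom[OF that] k.homh] C[OF that] by blast
  have yG: "y i \<in> carrier G" if "i \<in> I" for i
    using kin[OF that] c(1)[OF that] by (auto simp: y_def hom_def)
  have ypow: "k (fp_in I C i (c i [^]\<^bsub>C i\<^esub> n)) = y i [^] n" if "i \<in> I" for i and n :: int
  proof -
    interpret i: group_hom "C i" G "\<lambda>g. k (fp_in I C i g)"
      using kin[OF that] C[OF that] group_axioms by (simp add: group_hom_def group_hom_axioms_def)
    show ?thesis using i.hom_int_pow[OF c(1)[OF that], of n] by (simp add: y_def)
  qed
  define S where "S = y ` I"
  have S: "S \<subseteq> carrier G" using yG by (auto simp: S_def)
  have yS: "y i \<in> S" if "i \<in> I" for i using that by (simp add: S_def)
  have gS: "generate G S = carrier G"
  proof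
    show "generate G S \<subseteq> carrier G" by (rule generate_incl[OF S])
    have sub: "subgroup (generate G S) G" by (rule generate_is_subgroup[OF S])
    let ?X = "{p \<in> carrier ?P. k p \<in> generate G S}"
    have "subgroup ?X ?P"
      using sub by unfold_locales
        (auto simp: subgroup.m_closed subgroup.one_closed subgroup.m_inv_closed)
    moreover have "(\<lambda>(i, g). fp_in I C i g) ` Sigma I (\<lambda>i. carrier (C i)) \<subseteq> ?X"
    proof clarsimp
      fix i g assume i: "i \<in> I" "g \<in> carrier (C i)"
      then obtain n :: int where "g = c i [^]\<^bsub>C i\<^esub> n" using c(2) by auto
      then have "k (fp_in I C i g) = y i [^] n" using ypow[OF i(1)] by simp
      moreover have "y i \<in> generate G S" using i(1) by (auto simp: S_def intro: generate.incl)
      ultimately show "fp_in I C i g \<in> carrier ?P \<and> k (fp_in I C i g) \<in> generate G S"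
        using subgroup_int_pow_closed[OF sub] fp_in_closed[of i I g C, OF i] by simp
    qed
    ultimately have "generate ?P ((\<lambda>(i, g). fp_in I C i g) ` Sigma I (\<lambda>i. carrier (C i))) \<subseteq> ?X"
      by (intro P.generate_subgroup_incl)
    moreover have "generate ?P ((\<lambda>(i, g). fp_in I C i g) ` Sigma I (\<lambda>i. carrier (C i))) = carrier ?P"
      using generate_presented_group[of "Sigma I (\<lambda>i. carrier (C i))" "fp_rels I C"]
      by (simp add: free_product_eq fp_in_def case_prod_beta')
    ultimately have X: "carrier ?P \<subseteq> ?X" by simp
    show "carrier G \<subseteq> generate G S"
    proof
      fix x assume "x \<in> carrier G"
      then have "x = k (h x)" "h x \<in> carrier ?P" using hk by (auto simp: group_isomorphisms_def hom_def)
      then show "x \<in> generate G S" using X by auto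
    qed
  qed
  let ?C = "cyc_pres (S - {\<one>}) ord"
  interpret C: group ?C by (rule group_cyc_pres)
  define e where "e s = (if s = \<one> then \<one>\<^bsub>?C\<^esub> else cgen (S - {\<one>}) ord s)" for s
  have eC: "e (y i) \<in> carrier ?C" if "i \<in> I" for i
    using cgen_closed[of "y i" "S - {\<one>}"] yS[OF that] by (simp add: e_def)
  have epow: "e s [^]\<^bsub>?C\<^esub> ord s = \<one>\<^bsub>?C\<^esub>" if "s \<in> S" for s
    using cgen_pow[of s "S - {\<one>}" ord] that by (auto simp: e_def)
  have "\<exists>f. \<forall>i\<in>I. f i \<in> hom (C i) ?C \<and> (\<forall>n::int. f i (c i [^]\<^bsub>C i\<^esub> n) = e (y i) [^]\<^bsub>?C\<^esub> n)"
  proof (rule bchoice, rule ballI)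
    fix i assume i: "i \<in> I"
    then interpret i: group_hom "C i" G "\<lambda>g. k (fp_in I C i g)"
      using kin[OF i] C[OF i] group_axioms by (simp add: group_hom_def group_hom_axioms_def)
    show "\<exists>f. f \<in> hom (C i) ?C \<and> (\<forall>n::int. f (c i [^]\<^bsub>C i\<^esub> n) = e (y i) [^]\<^bsub>?C\<^esub> n)"
    proof (rule C.cyclic_hom[OF _ c(1)[OF i] c(2)[OF i] eC[OF i]])
      fix n :: nat assume "c i [^]\<^bsub>C i\<^esub> n = \<one>\<^bsub>C i\<^esub>"
      \<comment> \<open>Each power relation of \<open>c i\<close> also holds for \<open>y i\<close>,
        so its exponent is a multiple of \<open>ord (y i)\<close>, and \<open>e (y i)\<close>
        satisfies it too.\<close>
      then have "y i [^] n = \<one>"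
        using i.hom_nat_pow[OF c(1)[OF i], of n] i.hom_one by (simp add: y_def)
      then obtain q where "n = ord (y i) * q" using pow_eq_id[OF yG[OF i]] by (auto elim: dvdE)
      then show "e (y i) [^]\<^bsub>?C\<^esub> n = \<one>\<^bsub>?C\<^esub>"
        using C.nat_pow_pow[OF eC[OF i], of "ord (y i)" q] epow[OF yS[OF i]] by simp
    qed (use C[OF i] in blast)+
  qed
  then obtain f where f: "\<And>i. i \<in> I \<Longrightarrow> f i \<in> hom (C i) ?C"
    "\<And>i n. i \<in> I \<Longrightarrow> f i (c i [^]\<^bsub>C i\<^esub> (n::int)) = e (y i) [^]\<^bsub>?C\<^esub> n" by metis
  obtain F where F: "F \<in> hom ?P ?C" "\<And>i g. i \<in> I \<Longrightarrow> g \<in> carrier (C i) \<Longrightarrow> F (fp_in I C i g) = f i g"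
    using C.free_product_hom[of I f C] f(1) by metis
  have "cyc_indep G (S - {\<one>})"
  proof (rule cyc_indepI[OF S])
    show "(\<lambda>x. F (h x)) \<in> hom (G\<lparr>carrier := generate G S\<rparr>) ?C"
      using hom_comp[OF _ F(1), of h G] hk by (simp add: gS group_isomorphisms_def)
    show "F (h s) = cgen (S - {\<one>}) ord s" if s: "s \<in> S" "s \<noteq> \<one>" for s
    proof -
      obtain i where i: "i \<in> I" "s = y i" using s(1) by (auto simp: S_def)
      interpret Ci: group "C i" using C[OF i(1)] by blast
      have "h s = fp_in I C i (c i)"
        using hk fp_in_closed[of i I "c i" C, OF i(1) c(1)[OF i(1)]] i(2) by (auto simp: group_isomorphisms_def y_def)
      then have "F (h s) = e (y i)"
        using F(2)[OF i(1) c(1)[OF i(1)]] f(2)[OF i(1), of 1] c(1)[OF i(1)] eC[OF i(1)] by simp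
      then show ?thesis using s(2) i(2) by (simp add: e_def)
    qed
  qed
  then show ?thesis using that[of "S - {\<one>}"] by (simp add: generate_diff_one[OF S] gS)
qed

section \<open>Wreath products\<close>

text \<open>The unrestricted wreath product of \<open>K\<close> with the symmetric group of \<open>X\<close>, realised as
  the permutations of \<open>X \<times> K\<close> that commute with right multiplication by \<open>K\<close>.\<close>

definition wreath :: "'x set \<Rightarrow> ('k, 'b) monoid_scheme \<Rightarrow> ('x \<times> 'k \<Rightarrow> 'x \<times> 'k) monoid" where
  "wreath X K = \<lparr>carrier = {p. p permutes X \<times> carrier K \<and>
      (\<forall>x\<in>X. \<forall>k\<in>carrier K. \<forall>l\<in>carrier K. p (x, k \<otimes>\<^bsub>K\<^esub> l) = apsnd (\<lambda>m. m \<otimes>\<^bsub>K\<^esub> l) (p (x, k)))},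
    monoid.mult = (\<circ>), one = id\<rparr>"

text \<open>A monomial matrix: the permutation \<open>\<sigma>\<close> of the coordinates together
  with weights acting by left multiplication. It is the identity off
  \<open>X \<times> carrier K\<close>, as \<open>permutes\<close> demands.\<close>

definition monomial :: "'x set \<Rightarrow> ('k, 'b) monoid_scheme \<Rightarrow> ('x \<Rightarrow> 'x) \<Rightarrow> ('x \<Rightarrow> 'k) \<Rightarrow> 'x \<times> 'k \<Rightarrow> 'x \<times> 'k" where
  "monomial X K \<sigma> w = (\<lambda>(x, k). if x \<in> X \<and> k \<in> carrier K then (\<sigma> x, w x \<otimes>\<^bsub>K\<^esub> k) else (x, k))"

lemma wreath_simps [simp]:
  "p \<otimes>\<^bsub>wreath X K\<^esub> q = p \<circ> q" "\<one>\<^bsub>wreath X K\<^esub> = id"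
  by (simp_all add: wreath_def)

lemma wreath_pow: "p [^]\<^bsub>wreath X K\<^esub> (n::nat) = p ^^ n"
  by (induction n) (simp_all add: funpow_Suc_right del: funpow.simps)

lemma wreath_closed:
  assumes "p \<in> carrier (wreath X K)" "x \<in> X" "k \<in> carrier K"
  shows "\<exists>y\<in>X. \<exists>l\<in>carrier K. p (x, k) = (y, l)"
proof -
  have "p (x, k) \<in> X \<times> carrier K"
    using assms permutes_in_image[of p "X \<times> carrier K"] by (auto simp: wreath_def)
  then show ?thesis by auto
qed

lemma wreath_translate:
  "p \<in> carrier (wreath X K) \<Longrightarrow> x \<in> X \<Longrightarrow> k \<in> carrier K \<Longrightarrow> l \<in> carrier K \<Longrightarrow>
    p (x, k) = (y, m) \<Longrightarrow> p (x, k \<otimes>\<^bsub>K\<^esub> l) = (y, m \<otimes>\<^bsub>K\<^esub> l)"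
  by (auto simp: wreath_def)

text \<open>Commuting with right translations, \<open>p\<close> acts on the fibre over
  \<open>x\<close> by left multiplication with one weight, visible at the identity of
  \<open>K\<close>.\<close>

lemma wreath_translate_one:
  assumes "group K" "p \<in> carrier (wreath X K)" "x \<in> X" "k \<in> carrier K" "p (x, \<one>\<^bsub>K\<^esub>) = (y, m)"
  shows "p (x, k) = (y, m \<otimes>\<^bsub>K\<^esub> k)"
proof -
  interpret group K by fact
  show ?thesis using wreath_translate[OF assms(2,3) one_closed assms(4,5)] assms(4) by simp
qed

lemma group_wreath:
  fixes K (structure)
  assumes K: "group K"
  shows "group (wreath X K)"
proof (rule groupI)
  let ?W = "wreath X K"
  interpret K: group K by (rule K)
  show "p \<otimes>\<^bsub>?W\<^esub> q \<in> carrier ?W" if "p \<in> carrier ?W" "q \<in> carrier ?W" for p q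
  proof -
    have "(p \<circ> q) (x, k \<otimes> l) = apsnd (\<lambda>m. m \<otimes> l) ((p \<circ> q) (x, k))"
      if x: "x \<in> X" "k \<in> carrier K" "l \<in> carrier K" for x k l
    proof -
      obtain y m where m: "y \<in> X" "m \<in> carrier K" "q (x, k) = (y, m)"
        using wreath_closed[OF \<open>q \<in> carrier ?W\<close> x(1,2)] by blast
      obtain z r where "p (y, m) = (z, r)" by force
      then show ?thesis
        using wreath_translate[OF \<open>q \<in> carrier ?W\<close> x m(3)]
          wreath_translate[OF \<open>p \<in> carrier ?W\<close> m(1,2) x(3)] m(3) by simp
    qed
    then show ?thesis using that by (auto simp: wreath_def permutes_compose)
  qed
  show "\<one>\<^bsub>?W\<^esub> \<in> carrier ?W" by (auto simp: wreath_def permutes_id)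
  show "\<exists>q\<in>carrier ?W. q \<otimes>\<^bsub>?W\<^esub> p = \<one>\<^bsub>?W\<^esub>" if p: "p \<in> carrier ?W" for p
  proof (rule bexI[of _ "inv_into UNIV p"])
    have perm: "p permutes X \<times> carrier K" using p by (simp add: wreath_def)
    show "inv_into UNIV p \<otimes>\<^bsub>?W\<^esub> p = \<one>\<^bsub>?W\<^esub>" using permutes_inv_o(2)[OF perm] by simp
    have "inv_into UNIV p (x, k \<otimes> l) = apsnd (\<lambda>m. m \<otimes> l) (inv_into UNIV p (x, k))"
      if x: "x \<in> X" "k \<in> carrier K" "l \<in> carrier K" for x k l
    proof -
      have "inv_into UNIV p (x, k) \<in> X \<times> carrier K"
        using permutes_in_image[OF permutes_inv[OF perm]] x by auto
      then obtain y m where m: "y \<in> X" "m \<in> carrier K" "inv_into UNIV p (x, k) = (y, m)" by auto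
      then have "p (y, m) = (x, k)" using permutes_inverses(1)[OF perm, of "(x, k)"] by simp
      from wreath_translate[OF p m(1,2) x(3) this]
      have "inv_into UNIV p (x, k \<otimes> l) = (y, m \<otimes> l)"
        using permutes_inverses(2)[OF perm, of "(y, m \<otimes> l)"] by simp
      then show ?thesis using m(3) by simp
    qed
    then show "inv_into UNIV p \<in> carrier ?W" using permutes_inv[OF perm] by (auto simp: wreath_def)
  qed
qed (auto simp: comp_assoc)

lemma monomial_wreath:
  fixes K (structure)
  assumes K: "group K" and \<sigma>: "\<sigma> permutes X" and w: "\<And>x. x \<in> X \<Longrightarrow> w x \<in> carrier K"
  shows "monomial X K \<sigma> w \<in> carrier (wreath X K)"
proof -
  interpret K: group K by (rule K)
  let ?\<tau> = "inv_into UNIV \<sigma>"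
  have \<sigma>X: "\<sigma> x \<in> X" "?\<tau> x \<in> X" if "x \<in> X" for x
    using that permutes_in_image[OF \<sigma>] permutes_in_image[OF permutes_inv[OF \<sigma>]] by auto
  have inv: "\<sigma> (?\<tau> x) = x" "?\<tau> (\<sigma> x) = x" for x using permutes_inverses[OF \<sigma>] by auto
  have "bij_betw (monomial X K \<sigma> w) (X \<times> carrier K) (X \<times> carrier K)"
    by (rule bij_betw_byWitness[where f' = "\<lambda>(x, k). (?\<tau> x, inv w (?\<tau> x) \<otimes> k)"])
      (use \<sigma>X w in \<open>auto simp: monomial_def inv K.m_assoc[symmetric]\<close>)
  moreover have "monomial X K \<sigma> w z = z" if "z \<notin> X \<times> carrier K" for z
    using that by (cases z) (auto simp: monomial_def)
  ultimately have "monomial X K \<sigma> w permutes X \<times> carrier K" by (rule bij_imp_permutes)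
  then show ?thesis using w by (auto simp: wreath_def monomial_def K.m_assoc)
qed

text \<open>\<open>c\<close> is the product of the weights around a closed path of length
  \<open>l\<close>; going round \<open>r\<close> times multiplies on the left by its
  \<open>r\<close>-th power.\<close>

lemma wreath_pow_orbit:
  fixes K (structure)
  assumes K: "group K" and p: "p \<in> carrier (wreath X K)" and x: "x\<^sub>0 \<in> X"
    and c: "(p ^^ l) (x\<^sub>0, \<one>) = (x\<^sub>0, c)" "c \<in> carrier K" and k: "k \<in> carrier K"
  shows "(p ^^ (l * r)) (x\<^sub>0, k) = (x\<^sub>0, c [^] r \<otimes> k)"
proof -
  interpret K: group K by (rule K)
  interpret W: group "wreath X K" by (rule group_wreath[OF K])
  have pl: "p ^^ l \<in> carrier (wreath X K)" using W.nat_pow_closed[OF p] by (simp add: wreath_pow)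
  have "((p ^^ l) ^^ r) (x\<^sub>0, k) = (x\<^sub>0, c [^] r \<otimes> k)"
  proof (induction r)
    case (Suc r)
    have "(p ^^ l) (x\<^sub>0, c [^] r \<otimes> k) = (x\<^sub>0, c \<otimes> (c [^] r \<otimes> k))"
      using wreath_translate_one[OF K pl x _ c(1)] c(2) k by simp
    also have "c \<otimes> (c [^] r \<otimes> k) = c [^] Suc r \<otimes> k"
      using c(2) k K.nat_pow_Suc2[OF c(2), of r] by (simp add: K.m_assoc[symmetric])
    finally show ?case using Suc by simp
  qed (use k in simp)
  then show ?thesis by (simp add: funpow_mult)
qed

text \<open>At the base point of the cycle this is the previous lemma, and powers of
  \<open>p\<close> commute, which moves it to the other points. It serves to check the relation a^n
  = 1 cycle by cycle.\<close>

lemma wreath_pow_fixes_orbit: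
  fixes K (structure)
  assumes K: "group K" and p: "p \<in> carrier (wreath X K)" and x: "x\<^sub>0 \<in> X"
    and c: "(p ^^ l) (x\<^sub>0, \<one>) = (x\<^sub>0, c)" "c \<in> carrier K" "c [^] q = \<one>" and k: "k \<in> carrier K"
  shows "(p ^^ (l * q)) ((p ^^ j) (x\<^sub>0, k)) = (p ^^ j) (x\<^sub>0, k)"
proof -
  interpret K: group K by (rule K)
  have "(p ^^ (l * q)) ((p ^^ j) (x\<^sub>0, k)) = (p ^^ j) ((p ^^ (l * q)) (x\<^sub>0, k))"
    by (simp flip: funpow_add[unfolded o_def fun_eq_iff, rule_format] add: add.commute)
  then show ?thesis using wreath_pow_orbit[OF K p x c(1,2) k, of q] c(3) k by simp
qed

section \<open>Subgroups of the free product of Z/n and Z\<close>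

lemma (in group) inv_cancel:
  "x \<in> carrier G \<Longrightarrow> y \<in> carrier G \<Longrightarrow> inv x \<otimes> (x \<otimes> y) = y"
  "x \<in> carrier G \<Longrightarrow> y \<in> carrier G \<Longrightarrow> x \<otimes> (inv x \<otimes> y) = y"
  by (simp_all add: m_assoc[symmetric])

lemma range_bs_gen: "range f = {f Gen_a, f Gen_t}"
proof -
  have "f x \<in> {f Gen_a, f Gen_t}" for x by (cases x) simp_all
  then show ?thesis by blast
qed

definition quot_rels :: "nat \<Rightarrow> (bs_gen word \<times> bs_gen word) set" where
  "quot_rels n = {(replicate n (Gen_a, True), [])}"

locale Zn_free_Z = group Q for Q :: "bs_gen word set monoid" (structure) +
  fixes n :: nat and a t :: "bs_gen word set"
  assumes n_pos: "n > 0"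
    and Q_eq: "Q = presented_group UNIV (quot_rels n)"
    and a_eq: "a = pgen UNIV (quot_rels n) Gen_a"
    and t_eq: "t = pgen UNIV (quot_rels n) Gen_t"
begin

lemma a_closed [simp, intro]: "a \<in> carrier Q" and t_closed [simp, intro]: "t \<in> carrier Q"
  by (simp_all add: Q_eq a_eq t_eq pgen_closed)

lemma a_pow_n: "a [^] n = \<one>"
proof -
  have "weval Q (pgen UNIV (quot_rels n)) (replicate n (Gen_a, True)) = \<one>"
    using presented_group_relation[of "replicate n (Gen_a, True)" "[]" "quot_rels n" UNIV]
    by (simp add: quot_rels_def Q_eq words_replicate)
  then show ?thesis using weval_replicate[of "pgen UNIV (quot_rels n)" Gen_a n] a_closed
    by (simp add: a_eq)
qed

lemma Q_hom:
  fixes L (structure)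
  assumes L: "group L" and \<alpha>: "\<alpha> \<in> carrier L" "\<alpha> [^]\<^bsub>L\<^esub> n = \<one>\<^bsub>L\<^esub>" and \<tau>: "\<tau> \<in> carrier L"
  obtains F where "F \<in> hom Q L" "F a = \<alpha>" "F t = \<tau>"
proof -
  interpret L: group L by (rule L)
  obtain F where "F \<in> hom Q L"
    and F: "\<And>x. x \<in> UNIV \<Longrightarrow> F (pgen UNIV (quot_rels n) x) = case_bs_gen \<alpha> \<tau> x"
    unfolding Q_eq
  proof (rule L.presented_group_hom[of "case_bs_gen \<alpha> \<tau>" UNIV "quot_rels n"])
    show "case_bs_gen \<alpha> \<tau> \<in> UNIV \<rightarrow> carrier L" using \<alpha> \<tau> by (auto split: bs_gen.split)
    show "weval L (case_bs_gen \<alpha> \<tau>) r = weval L (case_bs_gen \<alpha> \<tau>) s" if "(r, s) \<in> quot_rels n" for r s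
      using that \<alpha> by (auto simp: quot_rels_def L.weval_replicate)
  qed auto
  then show ?thesis using that F[of Gen_a] F[of Gen_t] by (simp add: a_eq t_eq)
qed

lemma generate_Q: "generate Q {a, t} = carrier Q"
  using generate_presented_group[of UNIV "quot_rels n"] by (simp add: Q_eq a_eq t_eq range_bs_gen)

text \<open>As \<open>a\<close> has finite order, its inverse is a positive power, so no case for
  \<open>inv a\<close> arises.\<close>

lemma Q_induct [consumes 1, case_names one a t inv_t]:
  assumes g: "g \<in> carrier Q" and one: "P \<one>"
    and a: "\<And>g. g \<in> carrier Q \<Longrightarrow> P g \<Longrightarrow> P (a \<otimes> g)"
    and t: "\<And>g. g \<in> carrier Q \<Longrightarrow> P g \<Longrightarrow> P (t \<otimes> g)"
    and inv_t: "\<And>g. g \<in> carrier Q \<Longrightarrow> P g \<Longrightarrow> P (inv t \<otimes> g)"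
  shows "P g"
proof -
  have a_pow: "P (a [^] k \<otimes> h)" if "h \<in> carrier Q" "P h" for h and k :: nat
  proof (induction k)
    case (Suc k)
    have "a [^] Suc k \<otimes> h = a \<otimes> (a [^] k \<otimes> h)"
      using that nat_pow_Suc2[OF a_closed, of k] by (simp add: m_assoc)
    then show ?case using a[OF _ Suc] that by simp
  qed (use that in simp)
  have inv_a: "inv a = a [^] (n - 1)"
    using a_pow_n n_pos nat_pow_Suc[of a "n - 1"] by (intro inv_equality) simp_all
  have *: "P (x \<otimes> h)" if "x \<in> generate Q {a, t}" "h \<in> carrier Q" "P h" for x h
    using that
  proof (induction x arbitrary: h rule: generate.induct)
    case (inv x)
    then show ?case using a_pow inv_t inv_a by auto
  next
    case (eng x y)
    then have "x \<in> carrier Q" "y \<in> carrier Q" by (simp_all add: generate_Q)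
    then show ?case using eng by (simp add: m_assoc)
  qed (use a t in auto)
  then show ?thesis using *[of g \<one>] g one by (simp add: generate_Q)
qed

subsection \<open>Schreier transversals\<close>

text \<open>The Schreier condition for left cosets: an element is reached from \<open>\<one>\<close>
  by prepending letters without leaving \<open>T\<close>. The letter \<open>a\<close> is used only
  forwards, because an orbit is filled upwards from its first element.\<close>

inductive linked :: "bs_gen word set set \<Rightarrow> bs_gen word set \<Rightarrow> bool" for T where
  one: "linked T \<one>"
| a: "linked T g \<Longrightarrow> g \<in> T \<Longrightarrow> a \<otimes> g \<in> T \<Longrightarrow> linked T (a \<otimes> g)"
| t: "linked T g \<Longrightarrow> g \<in> T \<Longrightarrow> t \<otimes> g \<in> T \<Longrightarrow> linked T (t \<otimes> g)"
| inv_t: "linked T g \<Longrightarrow> g \<in> T \<Longrightarrow> inv t \<otimes> g \<in> T \<Longrightarrow> linked T (inv t \<otimes> g)"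

lemma linked_mono: "linked T g \<Longrightarrow> T \<subseteq> T' \<Longrightarrow> linked T' g"
  by (induction rule: linked.induct) (auto intro: linked.intros)

text \<open>\<open>g, a g, \<dots>, a^(l-1) g\<close> represent one \<open>\<langle>a\<rangle>\<close>-orbit of left cosets of \<open>H\<close>.\<close>

definition segment :: "bs_gen word set set \<Rightarrow> bs_gen word set set \<Rightarrow> bs_gen word set \<Rightarrow> nat \<Rightarrow> bool" where
  "segment H T g l \<longleftrightarrow> l > 0 \<and> l dvd n \<and> inv g \<otimes> a [^] l \<otimes> g \<in> H \<and> (\<forall>i<l. a [^] i \<otimes> g \<in> T)"

text \<open>A partial Schreier transversal, a form suited to Zorn's lemma. The last clause makes
  \<open>T\<close> consist of whole \<open>\<langle>a\<rangle>\<close>-orbits, so that every torsion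
  generator arises from closing one such orbit.\<close>

definition transversal :: "bs_gen word set set \<Rightarrow> bs_gen word set set \<Rightarrow> bool" where
  "transversal H T \<longleftrightarrow> T \<subseteq> carrier Q \<and> \<one> \<in> T \<and>
    (\<forall>g\<in>T. \<forall>g'\<in>T. inv g \<otimes> g' \<in> H \<longrightarrow> g = g') \<and> (\<forall>g\<in>T. linked T g) \<and>
    (\<forall>g\<in>T. \<exists>g\<^sub>0\<in>T. \<exists>l. \<exists>j<l. segment H T g\<^sub>0 l \<and> g = a [^] j \<otimes> g\<^sub>0)"

lemma a_pow_Suc: "g \<in> carrier Q \<Longrightarrow> a \<otimes> (a [^] j \<otimes> g) = a [^] Suc j \<otimes> g" for j :: nat
  using nat_pow_Suc2[OF a_closed, of j] by (simp add: m_assoc)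

text \<open>\<open>?c k \<in> H\<close> says that a^k fixes the coset g H. The length
  \<open>l\<close> is the least positive such exponent, that is the size of the orbit; it divides
  \<open>n\<close> because a^n fixes every coset.\<close>

lemma new_segment:
  assumes H: "subgroup H Q" and g: "g \<in> carrier Q"
  obtains l where "segment H {a [^] i \<otimes> g | i. i < l} g l"
    "\<And>i j. i < l \<Longrightarrow> j < l \<Longrightarrow> inv (a [^] i \<otimes> g) \<otimes> (a [^] j \<otimes> g) \<in> H \<Longrightarrow> i = j"
proof -
  let ?c = "\<lambda>k::nat. inv g \<otimes> a [^] k \<otimes> g"
  have c_add: "?c (k + k') = ?c k \<otimes> ?c k'" for k k'
    using g by (simp add: nat_pow_mult[OF a_closed, of k k', symmetric] m_assoc inv_cancel)
  have cc: "?c k \<in> carrier Q" for k using g by simp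
  have c_mult: "?c k \<in> H \<Longrightarrow> ?c (k * q) \<in> H" for k q
    by (induction q) (use g in \<open>simp_all add: subgroup.one_closed[OF H] subgroup.m_closed[OF H] c_add\<close>)
  have c_diff: "?c k' \<in> H" if "?c (k + k') \<in> H" "?c k \<in> H" for k k'
  proof -
    have "?c k' = inv (?c k) \<otimes> ?c (k + k')" using cc c_add by (simp add: m_assoc[symmetric])
    then show ?thesis using that subgroup.m_closed[OF H] subgroup.m_inv_closed[OF H] by metis
  qed
  define l where "l = (LEAST k. k > 0 \<and> ?c k \<in> H)"
  have "n > 0 \<and> ?c n \<in> H" using n_pos g a_pow_n subgroup.one_closed[OF H] by simp
  then have l: "l > 0" "?c l \<in> H" unfolding l_def by (rule LeastI2; simp)+
  have least: "k = 0" if "?c k \<in> H" "k < l" for k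
    using not_less_Least[of k "\<lambda>k. k > 0 \<and> ?c k \<in> H"] that by (auto simp: l_def)
  have "?c (l * (n div l) + n mod l) \<in> H"
    unfolding mult_div_mod_eq using \<open>n > 0 \<and> ?c n \<in> H\<close> by blast
  from c_diff[OF this c_mult[OF l(2)]] have "n mod l = 0"
    by (rule least) (rule mod_less_divisor[OF l(1)])
  then have "l dvd n" by (rule mod_0_imp_dvd)
  then have "segment H {a [^] i \<otimes> g | i. i < l} g l" using l by (auto simp: segment_def)
  moreover have "i = j" if ij: "i < l" "j < l" "inv (a [^] i \<otimes> g) \<otimes> (a [^] j \<otimes> g) \<in> H" for i j
  proof -
    have *: "j' = i'" if "i' \<le> j'" "j' < l" "inv (a [^] i' \<otimes> g) \<otimes> (a [^] j' \<otimes> g) \<in> H" for i' j' :: nat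
    proof -
      have "a [^] j' = a [^] i' \<otimes> a [^] (j' - i')" using that(1) by (simp add: nat_pow_mult)
      then have "inv (a [^] i' \<otimes> g) \<otimes> (a [^] j' \<otimes> g) = ?c (j' - i')"
        using g by (simp add: m_assoc inv_mult_group inv_cancel)
      then show ?thesis using least[of "j' - i'"] that by auto
    qed
    have "inv (inv (a [^] i \<otimes> g) \<otimes> (a [^] j \<otimes> g)) = inv (a [^] j \<otimes> g) \<otimes> (a [^] i \<otimes> g)"
      using g by (simp add: inv_mult_group)
    then have "inv (a [^] j \<otimes> g) \<otimes> (a [^] i \<otimes> g) \<in> H" using subgroup.m_inv_closed[OF H ij(3)] by simp
    then show ?thesis using *[of i j] *[of j i] ij by (cases "i \<le> j") auto
  qed
  ultimately show ?thesis using that by blast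
qed

lemma segment_mono: "segment H T g l \<Longrightarrow> T \<subseteq> T' \<Longrightarrow> segment H T' g l"
  by (auto simp: segment_def)

definition covered :: "bs_gen word set set \<Rightarrow> bs_gen word set set \<Rightarrow> bs_gen word set set" where
  "covered H T = {g \<in> carrier Q. \<exists>m\<in>T. inv m \<otimes> g \<in> H}"

text \<open>Since \<open>T\<close> contains whole orbits, a step of \<open>a\<close> moves on inside
  a segment or returns from its last coset to the first.\<close>

lemma covered_a:
  assumes H: "subgroup H Q" and T: "transversal H T" and g: "g \<in> covered H T"
  shows "a \<otimes> g \<in> covered H T"
proof -
  obtain m where m: "m \<in> T" "inv m \<otimes> g \<in> H" "g \<in> carrier Q" using g by (auto simp: covered_def)
  obtain g\<^sub>0 l j where s: "g\<^sub>0 \<in> T" "j < l" "segment H T g\<^sub>0 l" "m = a [^] j \<otimes> g\<^sub>0"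
    using T m(1) unfolding transversal_def by metis
  have g0: "g\<^sub>0 \<in> carrier Q" using T s(1) by (auto simp: transversal_def)
  have mQ: "m \<in> carrier Q" using T m(1) by (auto simp: transversal_def)
  show ?thesis
  proof (cases "Suc j < l")
    case True
    then have "a [^] Suc j \<otimes> g\<^sub>0 \<in> T" using s(3) by (auto simp: segment_def)
    moreover have "a [^] Suc j \<otimes> g\<^sub>0 = a \<otimes> m" using a_pow_Suc[OF g0, of j] unfolding s(4) by (rule HOL.sym)
    ultimately have "a \<otimes> m \<in> T" by simp
    moreover have "inv (a \<otimes> m) \<otimes> (a \<otimes> g) = inv m \<otimes> g"
      using mQ m(3) by (simp add: inv_mult_group m_assoc inv_cancel)
    ultimately show ?thesis using m(2,3) unfolding covered_def by (intro CollectI conjI bexI[of _ "a \<otimes> m"]) simp_all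
  next
    case False
    then have l: "l = Suc j" using s(2) by simp
    have "a [^] l \<otimes> g\<^sub>0 = a \<otimes> m" using a_pow_Suc[OF g0, of j] unfolding l s(4) by (rule HOL.sym)
    then have "inv g\<^sub>0 \<otimes> a [^] l \<otimes> g\<^sub>0 = inv g\<^sub>0 \<otimes> (a \<otimes> m)" using g0 by (simp add: m_assoc)
    then have "inv g\<^sub>0 \<otimes> a [^] l \<otimes> g\<^sub>0 \<otimes> (inv m \<otimes> g) = inv g\<^sub>0 \<otimes> (a \<otimes> g)"
      using g0 m(3) mQ by (simp add: m_assoc inv_cancel)
    moreover have "inv g\<^sub>0 \<otimes> a [^] l \<otimes> g\<^sub>0 \<otimes> (inv m \<otimes> g) \<in> H"
      using s(3) m(2) subgroup.m_closed[OF H] by (auto simp: segment_def)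
    ultimately show ?thesis using s(1) m(3) by (auto simp: covered_def)
  qed
qed

text \<open>The whole \<open>\<langle>a\<rangle>\<close>-orbit of the new coset is adjoined at once,
  attached to the tree by the single edge from \<open>x\<close> to
  \<open>s \<otimes> x\<close>.\<close>

lemma extend_transversal:
  assumes H: "subgroup H Q" and T: "transversal H T" and x: "x \<in> T"
    and s: "s = t \<or> s = inv t" and g: "s \<otimes> x \<notin> covered H T"
  obtains T' where "transversal H T'" "T \<subset> T'"
proof -
  have TQ: "T \<subseteq> carrier Q" using T by (simp add: transversal_def)
  have sQ: "s \<otimes> x \<in> carrier Q" using s x TQ by auto
  define g where "g = s \<otimes> x"
  have gQ: "g \<in> carrier Q" and gn: "g \<notin> covered H T" using sQ assms(5) by (simp_all add: g_def)
  obtain l where l: "segment H {a [^] i \<otimes> g | i. i < l} g l"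
    "\<And>i j. i < l \<Longrightarrow> j < l \<Longrightarrow> inv (a [^] i \<otimes> g) \<otimes> (a [^] j \<otimes> g) \<in> H \<Longrightarrow> i = j"
    using new_segment[OF H gQ] by blast
  let ?N = "{a [^] i \<otimes> g | i. i < l}"
  have l0: "l > 0" "l dvd n" using l(1) by (auto simp: segment_def)
  have NQ: "?N \<subseteq> carrier Q" using gQ by auto
  have gN: "g \<in> ?N" using l0 gQ by (auto intro!: exI[of _ 0])
  have cov_pow: "a [^] k \<otimes> h \<in> covered H T" if "h \<in> covered H T" for k :: nat and h
  proof (induction k)
    case 0
    then show ?case using that by (simp add: covered_def)
  next
    case (Suc k)
    then show ?case using covered_a[OF H T Suc] that a_pow_Suc[of h k] by (simp add: covered_def del: nat_pow_Suc)
  qed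
  \<comment> \<open>Covered cosets are closed under \<open>a\<close>; rotating an element of the new
    orbit onwards by \<open>n - i\<close> steps would reach \<open>g\<close>.\<close>
  have Nn: "h \<notin> covered H T" if "h \<in> ?N" for h
  proof
    assume h: "h \<in> covered H T"
    obtain i where i: "i < l" "h = a [^] i \<otimes> g" using \<open>h \<in> ?N\<close> by auto
    have "i \<le> n" using i(1) dvd_imp_le[OF l0(2) n_pos] by simp
    then have "a [^] (n - i) \<otimes> h = g"
      using gQ a_pow_n nat_pow_mult[OF a_closed, of "n - i" i] by (simp add: i(2) m_assoc[symmetric])
    then show False using cov_pow[OF h, of "n - i"] gn by simp
  qed
  have cross: "inv m \<otimes> h \<notin> H" if "m \<in> T" "h \<in> ?N" for m h
    using Nn[OF that(2)] NQ that by (auto simp: covered_def)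
  have cross': "inv h \<otimes> m \<notin> H" if "m \<in> T" "h \<in> ?N" for m h
  proof
    assume "inv h \<otimes> m \<in> H"
    then have "inv (inv h \<otimes> m) \<in> H" by (rule subgroup.m_inv_closed[OF H])
    moreover have "h \<in> carrier Q" "m \<in> carrier Q" using that TQ NQ by blast+
    then have "inv (inv h \<otimes> m) = inv m \<otimes> h" by (simp add: inv_mult_group)
    ultimately show False using cross[OF that] by simp
  qed
  define T' where "T' = T \<union> ?N"
  have sub: "T \<subseteq> T'" "?N \<subseteq> T'" by (auto simp: T'_def)
  have lx: "linked T' x" using T x linked_mono[OF _ sub(1)] by (auto simp: transversal_def)
  have "x \<in> T'" "g \<in> T'" using x gN sub by auto
  then have lg: "linked T' g" using s lx linked.t[of T' x] linked.inv_t[of T' x] by (auto simp: g_def)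
  have NI: "a [^] i \<otimes> g \<in> T'" if "i < l" for i using that sub(2) by blast
  have ln: "linked T' (a [^] i \<otimes> g)" if "i < l" for i
    using that
  proof (induction i)
    case 0
    then show ?case using lg gQ by simp
  next
    case (Suc i)
    have "a [^] i \<otimes> g \<in> T'" "a [^] Suc i \<otimes> g \<in> T'"
      using NI[of i] NI[OF Suc.prems] Suc.prems by (simp_all only: Suc_lessD)
    then show ?case using linked.a[of T' "a [^] i \<otimes> g"] Suc a_pow_Suc[OF gQ, of i] by (simp del: nat_pow_Suc)
  qed
  have "transversal H T'"
    unfolding transversal_def
  proof (intro conjI ballI impI)
    show "T' \<subseteq> carrier Q" using TQ NQ by (simp add: T'_def)
    show "\<one> \<in> T'" using T by (auto simp: T'_def transversal_def)
    show "h = h'" if "h \<in> T'" "h' \<in> T'" "inv h \<otimes> h' \<in> H" for h h'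
    proof -
      have "h \<in> T \<and> h' \<in> T \<or> h \<in> ?N \<and> h' \<in> ?N"
        using that cross cross' unfolding T'_def by blast
      then show ?thesis
      proof
        assume "h \<in> T \<and> h' \<in> T"
        then show ?thesis using T that(3) by (auto simp: transversal_def)
      next
        assume "h \<in> ?N \<and> h' \<in> ?N"
        then obtain i j where "i < l" "j < l" "h = a [^] i \<otimes> g" "h' = a [^] j \<otimes> g" by blast
        then show ?thesis using l(2)[of i j] that(3) by simp
      qed
    qed
    show "linked T' h" if "h \<in> T'" for h
    proof (cases "h \<in> T")
      case True
      then have "linked T h" using T by (simp add: transversal_def)
      then show ?thesis using sub(1) by (rule linked_mono)
    next
      case False
      then obtain i where "i < l" "h = a [^] i \<otimes> g" using \<open>h \<in> T'\<close> unfolding T'_def by blast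
      then show ?thesis using ln by simp
    qed
    show "\<exists>g\<^sub>0\<in>T'. \<exists>l. \<exists>j<l. segment H T' g\<^sub>0 l \<and> h = a [^] j \<otimes> g\<^sub>0" if "h \<in> T'" for h
    proof (cases "h \<in> T")
      case True
      then obtain g\<^sub>0 l' j where "g\<^sub>0 \<in> T" "j < l'" "segment H T g\<^sub>0 l'" "h = a [^] j \<otimes> g\<^sub>0"
        using T unfolding transversal_def by metis
      then show ?thesis using segment_mono[OF _ sub(1)] sub(1) by blast
    next
      case False
      then obtain i where "i < l" "h = a [^] i \<otimes> g" using \<open>h \<in> T'\<close> unfolding T'_def by blast
      then show ?thesis using segment_mono[OF l(1) sub(2)] \<open>g \<in> T'\<close> by blast
    qed
  qed
  moreover have "g \<notin> T"
    using cross[OF _ gN] gQ subgroup.one_closed[OF H] by (metis l_inv)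
  then have "T \<subset> T'" using \<open>g \<in> T'\<close> sub(1) by blast
  ultimately show ?thesis using that by blast
qed

text \<open>The starting point is the orbit of the coset \<open>H\<close>, with representative
  \<open>\<one>\<close> as the root of the tree.\<close>

lemma base_transversal:
  assumes H: "subgroup H Q"
  obtains T where "transversal H T"
proof -
  obtain l where l: "segment H {a [^] i \<otimes> \<one> | i. i < l} \<one> l"
    "\<And>i j. i < l \<Longrightarrow> j < l \<Longrightarrow> inv (a [^] i \<otimes> \<one>) \<otimes> (a [^] j \<otimes> \<one>) \<in> H \<Longrightarrow> i = j"
    using new_segment[OF H one_closed] by blast
  let ?N = "{a [^] i \<otimes> \<one> | i. i < l}"
  have oneN: "\<one> \<in> ?N" using l(1) by (auto simp: segment_def intro!: exI[of _ 0])
  have ln: "linked ?N (a [^] i \<otimes> \<one>)" if "i < l" for i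
    using that
  proof (induction i)
    case 0
    then show ?case by (simp add: linked.one)
  next
    case (Suc i)
    have "a [^] i \<otimes> \<one> \<in> ?N" "a [^] Suc i \<otimes> \<one> \<in> ?N" using Suc.prems
      by (intro CollectI exI[of _ i] exI[of _ "Suc i"] conjI HOL.refl; simp)+
    then show ?case
      using linked.a[of ?N "a [^] i \<otimes> \<one>"] Suc a_pow_Suc[OF one_closed, of i] by (simp del: nat_pow_Suc r_one)
  qed
  have "transversal H ?N"
    unfolding transversal_def
  proof (intro conjI ballI impI)
    show "?N \<subseteq> carrier Q" by auto
    show "\<one> \<in> ?N" by (rule oneN)
    show "g = g'" if "g \<in> ?N" "g' \<in> ?N" "inv g \<otimes> g' \<in> H" for g g'
    proof -
      obtain i j where "i < l" "g = a [^] i \<otimes> \<one>" "j < l" "g' = a [^] j \<otimes> \<one>"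
        using \<open>g \<in> ?N\<close> \<open>g' \<in> ?N\<close> by blast
      then show ?thesis using l(2)[of i j] \<open>inv g \<otimes> g' \<in> H\<close> by simp
    qed
    show "linked ?N g" if "g \<in> ?N" for g using that ln by blast
    show "\<exists>g\<^sub>0\<in>?N. \<exists>l. \<exists>j<l. segment H ?N g\<^sub>0 l \<and> g = a [^] j \<otimes> g\<^sub>0" if "g \<in> ?N" for g
    proof -
      obtain j where "j < l" "g = a [^] j \<otimes> \<one>" using \<open>g \<in> ?N\<close> by blast
      then show ?thesis using l(1) oneN by blast
    qed
  qed
  then show ?thesis using that by blast
qed

text \<open>A maximal partial transversal admits no extension by \<open>t\<close> or
  \<open>inv t\<close>, and covered cosets are always closed under \<open>a\<close>; so it covers
  everything reachable from \<open>\<one>\<close>.\<close>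

lemma transversal_exists:
  assumes H: "subgroup H Q"
  obtains T where "transversal H T" "covered H T = carrier Q"
proof -
  have "\<exists>M\<in>Collect (transversal H). \<forall>X\<in>Collect (transversal H). M \<subseteq> X \<longrightarrow> X = M"
  proof (rule subset_Zorn_nonempty)
    show "Collect (transversal H) \<noteq> {}" using base_transversal[OF H] by blast
    fix C assume C: "C \<noteq> {}" "subset.chain (Collect (transversal H)) C"
    have tr: "transversal H T" if "T \<in> C" for T using C(2) that by (auto simp: subset_chain_def)
    have sub: "T \<subseteq> \<Union>C" if "T \<in> C" for T using that by blast
    show "\<Union>C \<in> Collect (transversal H)"
      unfolding mem_Collect_eq transversal_def
    proof (intro conjI ballI impI)
      show "\<Union>C \<subseteq> carrier Q" using tr by (intro Union_least) (simp add: transversal_def)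
      show "\<one> \<in> \<Union>C" using tr C(1) unfolding transversal_def by blast
      show "g = g'" if "g \<in> \<Union>C" "g' \<in> \<Union>C" "inv g \<otimes> g' \<in> H" for g g'
      proof -
        obtain T1 T2 where T12: "T1 \<in> C" "g \<in> T1" "T2 \<in> C" "g' \<in> T2"
          using \<open>g \<in> \<Union>C\<close> \<open>g' \<in> \<Union>C\<close> by blast
        then have "T1 \<subseteq> T2 \<or> T2 \<subseteq> T1" using C(2) by (auto simp: subset_chain_def)
        then obtain T where "T \<in> C" "g \<in> T" "g' \<in> T" using T12 by blast
        then show ?thesis using tr that(3) unfolding transversal_def by blast
      qed
      show "linked (\<Union>C) g" if "g \<in> \<Union>C" for g
      proof -
        obtain T where T: "T \<in> C" "g \<in> T" using \<open>g \<in> \<Union>C\<close> by blast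
        then have "linked T g" using tr by (simp add: transversal_def)
        then show ?thesis using sub[OF T(1)] by (rule linked_mono)
      qed
      show "\<exists>g\<^sub>0\<in>\<Union>C. \<exists>l. \<exists>j<l. segment H (\<Union>C) g\<^sub>0 l \<and> g = a [^] j \<otimes> g\<^sub>0" if "g \<in> \<Union>C" for g
      proof -
        obtain T where T: "T \<in> C" "g \<in> T" using \<open>g \<in> \<Union>C\<close> by blast
        then obtain g\<^sub>0 l j where "g\<^sub>0 \<in> T" "j < l" "segment H T g\<^sub>0 l" "g = a [^] j \<otimes> g\<^sub>0"
          using tr unfolding transversal_def by metis
        then show ?thesis using segment_mono[OF _ sub[OF T(1)]] T(1) by blast
      qed
    qed
  qed
  then obtain T where T: "transversal H T" and max: "\<And>X. transversal H X \<Longrightarrow> T \<subseteq> X \<Longrightarrow> X = T" by auto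
  have TQ: "T \<subseteq> carrier Q" using T by (simp add: transversal_def)
  have st: "s \<otimes> g \<in> covered H T" if s: "s = t \<or> s = inv t" and g: "g \<in> covered H T" for s g
  proof -
    obtain m where m: "m \<in> T" "inv m \<otimes> g \<in> H" "g \<in> carrier Q" using g by (auto simp: covered_def)
    have sQ: "s \<in> carrier Q" and mQ: "m \<in> carrier Q" using s m TQ by auto
    have "s \<otimes> m \<in> covered H T"
    proof (rule ccontr)
      assume "s \<otimes> m \<notin> covered H T"
      from extend_transversal[OF H T m(1) s this] obtain T' where "transversal H T'" "T \<subset> T'" .
      then show False using max[of T'] by blast
    qed
    then obtain m' where m': "m' \<in> T" "inv m' \<otimes> (s \<otimes> m) \<in> H" by (auto simp: covered_def)
    have "inv m' \<otimes> (s \<otimes> m) \<otimes> (inv m \<otimes> g) = inv m' \<otimes> (s \<otimes> g)"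
      using m' TQ sQ mQ m(3) by (auto simp: m_assoc inv_cancel subset_iff)
    then have "inv m' \<otimes> (s \<otimes> g) \<in> H" using m'(2) m(2) subgroup.m_closed[OF H] by metis
    then show ?thesis using m'(1) sQ m(3) by (auto simp: covered_def)
  qed
  have "g \<in> covered H T" if "g \<in> carrier Q" for g
    using that
  proof (induction rule: Q_induct)
    case one
    have "\<one> \<in> T" "inv \<one> \<otimes> \<one> \<in> H" using T subgroup.one_closed[OF H] by (simp_all add: transversal_def)
    then show ?case unfolding covered_def by blast
  next
    case (a g)
    show ?case by (rule covered_a[OF H T a(2)])
  next
    case (t g)
    show ?case using t(2) by (rule st[rotated]) simp
  next
    case (inv_t g)
    show ?case using inv_t(2) by (rule st[rotated]) simp
  qed
  moreover have "covered H T \<subseteq> carrier Q" unfolding covered_def by blast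
  ultimately have "covered H T = carrier Q" by blast
  with T show ?thesis by (rule that)
qed

end

section \<open>Kurosh's theorem for the free product of Z/n and Z\<close>

lemma (in group) conj_pow:
  assumes "x \<in> carrier G" "g \<in> carrier G"
  shows "(inv g \<otimes> x \<otimes> g) [^] (k::nat) = inv g \<otimes> x [^] k \<otimes> g"
  by (induction k) (use assms in \<open>simp_all add: m_assoc inv_cancel\<close>)

lemma cyc_rels_cong: "(\<And>j. j \<in> J \<Longrightarrow> m j = m' j) \<Longrightarrow> cyc_rels J m = cyc_rels J m'"
  unfolding cyc_rels_def by (metis (no_types, lifting))

text \<open>If the relator of \<open>j\<close> is trivial, the exponent sum in \<open>j\<close> is a
  homomorphism to the integers, and it takes the value 1 at \<open>j\<close>.\<close>

lemma ord_eq_of_cyc_pres_hom: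
  assumes G: "group G" and S: "subgroup S G" and F: "F \<in> hom (G\<lparr>carrier := S\<rparr>) (cyc_pres J m)"
    and j: "j \<in> J" "j \<in> S" "F j = cgen J m j" and m: "m j = 0"
  shows "group.ord G j = 0"
proof -
  interpret G: group G by (rule G)
  interpret S: group "G\<lparr>carrier := S\<rparr>" by (rule G.subgroup_imp_group[OF S])
  interpret F: group_hom "G\<lparr>carrier := S\<rparr>" "cyc_pres J m" F
    using F by (simp add: group_hom_def group_hom_axioms_def group_cyc_pres S.group_axioms)
  interpret Z: group integer_group by simp
  obtain \<chi> where \<chi>: "\<chi> \<in> hom (cyc_pres J m) integer_group"
    "\<And>i. i \<in> J \<Longrightarrow> \<chi> (cgen J m i) = (if i = j then 1 else 0)"
    by (rule Z.cyc_pres_hom[of "\<lambda>i. if i = j then 1 else 0" J m]) (use m in auto)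
  interpret \<chi>: group_hom "cyc_pres J m" integer_group \<chi>
    using \<chi>(1) by (simp add: group_hom_def group_hom_axioms_def group_cyc_pres)
  have jG: "j \<in> carrier G" using j(2) subgroup.subset[OF S] by blast
  have "k = 0" if "j [^]\<^bsub>G\<^esub> k = \<one>\<^bsub>G\<^esub>" for k :: nat
  proof -
    have "j [^]\<^bsub>G\<lparr>carrier := S\<rparr>\<^esub> k = \<one>\<^bsub>G\<lparr>carrier := S\<rparr>\<^esub>"
      using that G.nat_pow_consistent[of j k S] by simp
    then have "F j [^]\<^bsub>cyc_pres J m\<^esub> k = \<one>\<^bsub>cyc_pres J m\<^esub>"
      using F.hom_nat_pow[of j k] F.hom_one j(2) by simp
    then have "\<chi> (cgen J m j) [^]\<^bsub>integer_group\<^esub> k = 0"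
      using \<chi>.hom_nat_pow[of "cgen J m j" k] \<chi>.hom_one cgen_closed[OF j(1), of m] j(3) by simp
    then show ?thesis using \<chi>(2)[OF j(1)] by simp
  qed
  then show ?thesis using G.ord_eq_0[OF jG] by blast
qed

context Zn_free_Z
begin

text \<open>The Schreier generators of \<open>H\<close> act on \<open>T \<times> K\<close> through the wreath product, where
  \<open>K\<close> is the abstract free product of cyclic groups on them; reading off the \<open>K\<close>-component at
  the base point inverts the canonical map from \<open>K\<close> to \<open>H\<close>.\<close>

theorem kurosh:
  assumes H: "subgroup H Q"
  obtains J where "cyc_indep Q J" "generate Q J = H"
    "\<And>j. j \<in> J \<Longrightarrow> ord j \<noteq> 0 \<Longrightarrow> \<exists>g\<in>carrier Q. \<exists>l::nat. j = inv g \<otimes> a [^] l \<otimes> g"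
proof -
  note Hm = subgroup.m_closed[OF H] and Hi = subgroup.m_inv_closed[OF H] and H1 = subgroup.one_closed[OF H]
  obtain T where T: "transversal H T" and cov: "covered H T = carrier Q"
    by (rule transversal_exists[OF H])
  have TQ: "x \<in> carrier Q" if "x \<in> T" for x using T that by (auto simp: transversal_def)
  have T1: "\<one> \<in> T" using T by (simp add: transversal_def)
  define \<rho> where "\<rho> g = (SOME m. m \<in> T \<and> inv m \<otimes> g \<in> H)" for g
  have "\<exists>m. m \<in> T \<and> inv m \<otimes> g \<in> H" if "g \<in> carrier Q" for g
    using cov that unfolding covered_def by blast
  then have "\<rho> g \<in> T \<and> inv (\<rho> g) \<otimes> g \<in> H" if "g \<in> carrier Q" for g
    unfolding \<rho>_def using that by (metis (mono_tags, lifting) someI_ex)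
  then have \<rho>T: "\<rho> g \<in> T" and \<rho>H: "inv (\<rho> g) \<otimes> g \<in> H" if "g \<in> carrier Q" for g using that by auto
  have \<rho>Q: "\<rho> g \<in> carrier Q" if "g \<in> carrier Q" for g using TQ \<rho>T that by blast
  have \<rho>_eq: "\<rho> g = m" if g: "g \<in> carrier Q" and m: "m \<in> T" "inv m \<otimes> g \<in> H" for g m
  proof -
    have "inv (\<rho> g) \<otimes> m = (inv (\<rho> g) \<otimes> g) \<otimes> inv (inv m \<otimes> g)"
      using g \<rho>Q[OF g] TQ[OF m(1)] by (simp add: inv_mult_group m_assoc inv_cancel)
    then have "inv (\<rho> g) \<otimes> m \<in> H" using Hm[OF \<rho>H[OF g] Hi[OF m(2)]] by simp
    then show ?thesis using T \<rho>T[OF g] m(1) unfolding transversal_def by blast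
  qed
  have \<rho>_id: "\<rho> x = x" if "x \<in> T" for x
    by (rule \<rho>_eq) (use TQ[OF that] that H1 in simp_all)
  have \<rho>_inv: "\<rho> (inv s \<otimes> \<rho> (s \<otimes> x)) = x" if s: "s \<in> carrier Q" and x: "x \<in> T" for s x
  proof (rule \<rho>_eq)
    have sx: "s \<otimes> x \<in> carrier Q" using s TQ[OF x] by simp
    have "inv x \<otimes> (inv s \<otimes> \<rho> (s \<otimes> x)) = inv (inv (\<rho> (s \<otimes> x)) \<otimes> (s \<otimes> x))"
      using s TQ[OF x] \<rho>Q[OF sx] by (simp add: inv_mult_group m_assoc)
    then show "inv x \<otimes> (inv s \<otimes> \<rho> (s \<otimes> x)) \<in> H" using Hi[OF \<rho>H[OF sx]] by simp
    show "inv s \<otimes> \<rho> (s \<otimes> x) \<in> carrier Q" using s \<rho>Q[OF sx] by simp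
  qed (rule x)
  \<comment> \<open>The Schreier generator of the edge from \<open>x\<close> labelled
    \<open>s\<close>. It is trivial on the edges that stay inside \<open>T\<close>.\<close>
  define \<gamma> where "\<gamma> s x = inv (\<rho> (s \<otimes> x)) \<otimes> (s \<otimes> x)" for s x
  have \<gamma>H: "\<gamma> s x \<in> H" if "s \<in> carrier Q" "x \<in> T" for s x
    unfolding \<gamma>_def by (rule \<rho>H) (use that TQ in simp)
  have \<gamma>_tree: "\<rho> (s \<otimes> x) = s \<otimes> x" "\<gamma> s x = \<one>" if "s \<otimes> x \<in> T" for s x
    using \<rho>_id[OF that] TQ[OF that] by (simp_all add: \<gamma>_def)
  define \<sigma> where "\<sigma> s x = (if x \<in> T then \<rho> (s \<otimes> x) else x)" for s x
  have \<sigma>: "\<sigma> s permutes T" if s: "s \<in> carrier Q" for s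
  proof (rule bij_imp_permutes)
    have i: "inv s \<in> carrier Q" using s by simp
    show "bij_betw (\<sigma> s) T T"
    proof (rule bij_betw_byWitness[where f' = "\<sigma> (inv s)"])
      show "\<forall>x\<in>T. \<sigma> (inv s) (\<sigma> s x) = x"
        using \<rho>_inv[OF s] \<rho>T s TQ by (simp add: \<sigma>_def)
      show "\<forall>x\<in>T. \<sigma> s (\<sigma> (inv s) x) = x"
        using \<rho>_inv[OF i] \<rho>T i s TQ by (simp add: \<sigma>_def)
      show "\<sigma> s ` T \<subseteq> T" "\<sigma> (inv s) ` T \<subseteq> T"
        using \<rho>T s i TQ by (simp_all add: \<sigma>_def image_subset_iff)
    qed
  qed (simp add: \<sigma>_def)
  define S where "S = \<gamma> a ` T \<union> \<gamma> t ` T"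
  have SH: "S \<subseteq> H" unfolding S_def using \<gamma>H by blast
  have HQ: "H \<subseteq> carrier Q" by (rule subgroup.subset[OF H])
  have SQ: "S \<subseteq> carrier Q" using SH HQ by blast
  \<comment> \<open>Generators that come only from \<open>t\<close>-edges are declared free. That
    their order is really infinite follows at the end from the homomorphism \<open>F\<close>
    itself.\<close>
  define \<mu> where "\<mu> s = (if s \<in> \<gamma> a ` T then ord s else 0)" for s
  define J where "J = S - {\<one>}"
  define K where "K = cyc_pres J \<mu>"
  interpret K: group K unfolding K_def by (rule group_cyc_pres)
  interpret W: group "wreath T K" by (rule group_wreath) (rule K.group_axioms)
  define e where "e s = (if s = \<one> then \<one>\<^bsub>K\<^esub> else cgen J \<mu> s)" for s
  have cK: "cgen J \<mu> s \<in> carrier K" "cgen J \<mu> s [^]\<^bsub>K\<^esub> \<mu> s = \<one>\<^bsub>K\<^esub>" if "s \<in> J" for s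
    using cgen_closed[OF that, of \<mu>] cgen_pow[OF that, of \<mu>] by (simp_all add: K_def)
  have eK: "e s \<in> carrier K" if "s \<in> S" for s
    using that cK(1)[of s] by (cases "s = \<one>") (simp_all add: e_def J_def)
  have epow: "e s [^]\<^bsub>K\<^esub> \<mu> s = \<one>\<^bsub>K\<^esub>" if "s \<in> S" for s
    using that cK(2)[of s] by (cases "s = \<one>") (simp_all add: e_def J_def)
  \<comment> \<open>Left multiplication on the coset representatives, with each edge weighted by the
    abstract copy of its Schreier generator.\<close>
  define M where "M s = monomial T K (\<sigma> s) (\<lambda>x. e (\<gamma> s x))" for s
  have at: "s \<in> carrier Q" "\<And>x. x \<in> T \<Longrightarrow> \<gamma> s x \<in> S" if "s = a \<or> s = t" for s
    using that by (auto simp: S_def)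
  have MW: "M s \<in> carrier (wreath T K)" if "s = a \<or> s = t" for s
    unfolding M_def by (rule monomial_wreath) (use K.group_axioms \<sigma> at[OF that] eK in auto)
  have M: "M s (x, k) = (\<rho> (s \<otimes> x), e (\<gamma> s x) \<otimes>\<^bsub>K\<^esub> k)" if "x \<in> T" "k \<in> carrier K" for s x k
    using that by (simp add: M_def monomial_def \<sigma>_def)
  have M_tree: "M s (x, k) = (s \<otimes> x, k)" if "x \<in> T" "k \<in> carrier K" "s \<otimes> x \<in> T" for s x k
    using M[OF that(1,2), of s] \<gamma>_tree[OF that(3)] that(2) by (simp add: e_def)
  have a_type: "\<exists>g\<^sub>0\<in>T. \<exists>l j. j < l \<and> segment H T g\<^sub>0 l \<and> x = a [^] j \<otimes> g\<^sub>0" if "x \<in> T" for x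
    using T that unfolding transversal_def by blast
  have seg_end: "\<rho> (a \<otimes> (a [^] j \<otimes> g)) = g \<and> \<gamma> a (a [^] j \<otimes> g) = inv g \<otimes> a [^] Suc j \<otimes> g"
    if g: "g \<in> T" "segment H T g (Suc j)" for g j
  proof -
    have *: "inv g \<otimes> (a \<otimes> (a [^] j \<otimes> g)) = inv g \<otimes> a [^] Suc j \<otimes> g"
      using TQ[OF g(1)] a_pow_Suc[OF TQ[OF g(1)], of j] by (simp add: m_assoc del: nat_pow_Suc)
    moreover have "\<rho> (a \<otimes> (a [^] j \<otimes> g)) = g"
      by (rule \<rho>_eq) (use g TQ[OF g(1)] in \<open>simp_all add: * segment_def del: nat_pow_Suc\<close>)
    ultimately show ?thesis by (simp add: \<gamma>_def del: nat_pow_Suc)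
  qed
  \<comment> \<open>The relation a^n = 1 for the action. In a segment of length \<open>l\<close>
    only the closing edge can have a nontrivial weight, namely \<open>e c\<close>, and the order of
    \<open>c\<close> divides n/l.\<close>
  have "(M a ^^ n) z = z" for z
  proof (cases "z \<in> T \<times> carrier K")
    case False
    have "M a ^^ n \<in> carrier (wreath T K)"
      using W.nat_pow_closed[of "M a" n] MW[of a] by (simp add: wreath_pow)
    then have "(M a ^^ n) permutes T \<times> carrier K" by (simp add: wreath_def)
    then show ?thesis using False by (rule permutes_not_in)
  next
    case True
    then obtain x k where z: "z = (x, k)" "x \<in> T" "k \<in> carrier K" by blast
    obtain g\<^sub>0 l j where g: "g\<^sub>0 \<in> T" "j < l" "segment H T g\<^sub>0 l" "x = a [^] j \<otimes> g\<^sub>0"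
      using a_type[OF z(2)] by blast
    note gQ = TQ[OF g(1)]
    have segT: "a [^] i \<otimes> g\<^sub>0 \<in> T" if "i < l" for i using g(3) that by (simp add: segment_def)
    have run: "(M a ^^ i) (g\<^sub>0, k') = (a [^] i \<otimes> g\<^sub>0, k')" if "i < l" "k' \<in> carrier K" for i k'
      using that
    proof (induction i)
      case (Suc i)
      have "a [^] i \<otimes> g\<^sub>0 \<in> T" "a \<otimes> (a [^] i \<otimes> g\<^sub>0) \<in> T"
        using segT[of i] segT[OF Suc.prems(1)] Suc.prems(1) unfolding a_pow_Suc[OF gQ] by simp_all
      then show ?case
        using Suc M_tree[of "a [^] i \<otimes> g\<^sub>0" k' a] a_pow_Suc[OF gQ, of i] by simp
    qed (use gQ in simp)
    obtain i where i: "l = Suc i" using g(2) by (cases l) auto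
    have gi: "a [^] i \<otimes> g\<^sub>0 \<in> T" using g(3) i by (simp add: segment_def)
    define c where "c = inv g\<^sub>0 \<otimes> a [^] l \<otimes> g\<^sub>0"
    have ci: "\<gamma> a (a [^] i \<otimes> g\<^sub>0) = c" using seg_end[OF g(1)] g(3) by (simp add: i c_def del: nat_pow_Suc)
    then have cS: "c \<in> S" "c \<in> \<gamma> a ` T" using gi by (auto simp: S_def)
    obtain q where q: "n = l * q" using g(3) by (auto simp: segment_def)
    have "c [^] q = \<one>"
      unfolding c_def using conj_pow[of "a [^] l" g\<^sub>0 q] gQ a_pow_n nat_pow_pow[OF a_closed, of l q]
      by (simp add: q)
    then obtain r where "q = ord c * r" using pow_eq_id[of c q] cS(1) SQ by (auto elim: dvdE)
    then have "e c [^]\<^bsub>K\<^esub> q = \<one>\<^bsub>K\<^esub>"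
      using K.nat_pow_pow[OF eK[OF cS(1)], of "ord c" r] epow[OF cS(1)] cS(2) by (simp add: \<mu>_def)
    moreover have "(M a ^^ l) (g\<^sub>0, \<one>\<^bsub>K\<^esub>) = (g\<^sub>0, e c)"
      using run[of i "\<one>\<^bsub>K\<^esub>"] M[OF gi, of "\<one>\<^bsub>K\<^esub>" a] seg_end[OF g(1), of i] g(3) eK[OF cS(1)]
      by (simp add: i ci)
    ultimately have "(M a ^^ (l * q)) ((M a ^^ j) (g\<^sub>0, k)) = (M a ^^ j) (g\<^sub>0, k)"
      using wreath_pow_fixes_orbit[OF K.group_axioms MW g(1) _ eK[OF cS(1)] _ z(3), of a l q j] by blast
    then show ?thesis using run[OF g(2) z(3)] by (simp add: q z g(4))
  qed
  then have "M a [^]\<^bsub>wreath T K\<^esub> n = \<one>\<^bsub>wreath T K\<^esub>" by (auto simp: wreath_pow)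
  then obtain \<Phi> where \<Phi>: "\<Phi> \<in> hom Q (wreath T K)" and \<Phi>a: "\<Phi> a = M a" and \<Phi>t: "\<Phi> t = M t"
    using Q_hom[OF W.group_axioms MW[of a] _ MW[of t]] by blast
  interpret \<Phi>: group_hom Q "wreath T K" \<Phi>
    using \<Phi> by (simp add: group_hom_def group_hom_axioms_def group_axioms W.group_axioms)
  have \<Phi>m: "\<Phi> (g \<otimes> h) z = \<Phi> g (\<Phi> h z)" if "g \<in> carrier Q" "h \<in> carrier Q" for g h z
    using \<Phi>.hom_mult[OF that] by simp
  have \<Phi>i: "\<Phi> (inv g) z = z'" if "g \<in> carrier Q" "\<Phi> g z' = z" for g z z'
    using \<Phi>m[of "inv g" g z'] that \<Phi>.hom_one by simp
  have \<Phi>tr: "\<Phi> g (\<one>, k) = (y, m \<otimes>\<^bsub>K\<^esub> k)"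
    if "g \<in> carrier Q" "\<Phi> g (\<one>, \<one>\<^bsub>K\<^esub>) = (y, m)" "k \<in> carrier K" for g y m k
    by (rule wreath_translate_one[OF K.group_axioms \<Phi>.hom_closed[OF that(1)] T1 that(3,2)])
  have \<Phi>at: "\<Phi> s = M s" if "s = a \<or> s = t" for s using that \<Phi>a \<Phi>t by auto
  \<comment> \<open>The word of \<open>g\<close> is read along edges inside \<open>T\<close>, all of
    weight 1.\<close>
  have linked: "\<Phi> g (\<one>, \<one>\<^bsub>K\<^esub>) = (g, \<one>\<^bsub>K\<^esub>)" if "linked T g" for g
    using that
  proof (induction rule: linked.induct)
    case (a g)
    then show ?case using \<Phi>m[of a g] TQ[OF a(2)] M_tree[of g "\<one>\<^bsub>K\<^esub>" a] by (simp add: \<Phi>a)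
  next
    case (t g)
    then show ?case using \<Phi>m[of t g] TQ[OF t(2)] M_tree[of g "\<one>\<^bsub>K\<^esub>" t] by (simp add: \<Phi>t)
  next
    case (inv_t g)
    have "t \<otimes> (inv t \<otimes> g) = g" using TQ[OF inv_t(2)] by (simp add: inv_cancel)
    then have "\<Phi> t (inv t \<otimes> g, \<one>\<^bsub>K\<^esub>) = (g, \<one>\<^bsub>K\<^esub>)"
      using M_tree[OF inv_t(3), of "\<one>\<^bsub>K\<^esub>" t] inv_t(2) by (simp add: \<Phi>t)
    from \<Phi>i[OF t_closed this] show ?case using \<Phi>m[of "inv t" g] TQ[OF inv_t(2)] inv_t(4) by simp
  qed (use \<Phi>.hom_one in simp)
  have \<Phi>T: "\<Phi> x (\<one>, k) = (x, k)" if "x \<in> T" "k \<in> carrier K" for x k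
  proof -
    have "linked T x" using T that(1) by (simp add: transversal_def)
    from \<Phi>tr[OF TQ[OF that(1)] linked[OF this] that(2)] that(2) show ?thesis by simp
  qed
  \<comment> \<open>The path goes out to \<open>x\<close>, crosses the edge labelled
    \<open>u\<close>, and returns to the root from \<open>\<rho> (u \<otimes> x)\<close>. Only the
    middle edge contributes a weight.\<close>
  have \<Phi>S: "\<Phi> s (\<one>, \<one>\<^bsub>K\<^esub>) = (\<one>, e s)" if "s \<in> S" for s
  proof -
    obtain u x where u: "u = a \<or> u = t" and x: "x \<in> T" and s: "s = \<gamma> u x"
      using \<open>s \<in> S\<close> unfolding S_def by blast
    note uQ = at(1)[OF u]
    let ?y = "\<rho> (u \<otimes> x)"
    have y: "?y \<in> T" using \<rho>T uQ TQ[OF x] by simp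
    have "\<Phi> (u \<otimes> x) (\<one>, \<one>\<^bsub>K\<^esub>) = (?y, e s)"
      using \<Phi>m[OF uQ TQ[OF x]] \<Phi>T[OF x] M[OF x, of "\<one>\<^bsub>K\<^esub>" u] eK[OF that] s by (simp add: \<Phi>at[OF u])
    moreover have "\<Phi> (inv ?y) (?y, e s) = (\<one>, e s)"
      by (rule \<Phi>i[OF TQ[OF y] \<Phi>T[OF y eK[OF that]]])
    ultimately show ?thesis
      using \<Phi>m[of "inv ?y" "u \<otimes> x"] TQ[OF y] uQ TQ[OF x] by (simp add: s \<gamma>_def)
  qed
  have subS: "subgroup (generate Q S) Q" by (rule generate_is_subgroup[OF SQ])
  \<comment> \<open>Schreier rewriting: \<gamma> satisfies the cocycle identity \<open>\<gamma> (u
    \<otimes> g) x = \<gamma> u (\<rho> (g \<otimes> x)) \<otimes> \<gamma> g x\<close>, so it can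
    be expanded letter by letter.\<close>
  have step: "\<gamma> (u \<otimes> g) x \<in> generate Q S"
    if u: "u \<in> carrier Q" "\<And>y. y \<in> T \<Longrightarrow> \<gamma> u y \<in> generate Q S"
      and g: "g \<in> carrier Q" "\<gamma> g x \<in> generate Q S" and x: "x \<in> T" for u g x
  proof -
    let ?y = "\<rho> (g \<otimes> x)"
    have gx: "g \<otimes> x \<in> carrier Q" using g TQ[OF x] by simp
    have y: "?y \<in> T" by (rule \<rho>T[OF gx])
    have uy: "u \<otimes> ?y \<in> carrier Q" using u(1) TQ[OF y] by simp
    have *: "inv (\<rho> (u \<otimes> ?y)) \<otimes> (u \<otimes> g \<otimes> x) = \<gamma> u ?y \<otimes> \<gamma> g x"
      using u(1) g(1) TQ[OF x] TQ[OF y] \<rho>Q[OF uy] by (simp add: \<gamma>_def m_assoc inv_cancel)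
    have "\<gamma> u ?y \<otimes> \<gamma> g x \<in> H" using \<gamma>H u(1) y g(1) x Hm by blast
    then have "\<rho> (u \<otimes> g \<otimes> x) = \<rho> (u \<otimes> ?y)"
      using \<rho>_eq[of "u \<otimes> g \<otimes> x" "\<rho> (u \<otimes> ?y)"] * \<rho>T[OF uy] u(1) g(1) TQ[OF x] by simp
    then have "\<gamma> (u \<otimes> g) x = \<gamma> u ?y \<otimes> \<gamma> g x" using * by (simp add: \<gamma>_def)
    then show ?thesis using u(2)[OF y] g(2) subgroup.m_closed[OF subS] by simp
  qed
  have \<gamma>gen: "\<gamma> u y \<in> generate Q S" if "u = a \<or> u = t" "y \<in> T" for u y
    using at(2)[OF that] by (rule generate.incl)
  have \<gamma>gen': "\<gamma> (inv t) y \<in> generate Q S" if y: "y \<in> T" for y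
  proof -
    let ?z = "\<rho> (inv t \<otimes> y)"
    have z: "?z \<in> T" using \<rho>T TQ[OF y] by simp
    have "\<rho> (t \<otimes> ?z) = y" using \<rho>_inv[of "inv t" y] y by simp
    then have "\<gamma> (inv t) y = inv (\<gamma> t ?z)"
      using TQ[OF z] TQ[OF y] by (simp add: \<gamma>_def inv_mult_group m_assoc)
    then show ?thesis using \<gamma>gen[of t, OF _ z] subgroup.m_inv_closed[OF subS] by simp
  qed
  have gam: "\<gamma> g x \<in> generate Q S" if "g \<in> carrier Q" "x \<in> T" for g x
    using that(1)
  proof (induction rule: Q_induct)
    case one
    have "\<gamma> \<one> x = \<one>" by (rule \<gamma>_tree) (use that(2) TQ in simp)
    then show ?case by (simp add: generate.one)
  next
    case (a g)
    show ?case by (rule step[OF a_closed _ a that(2)]) (use \<gamma>gen in simp)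
  next
    case (t g)
    show ?case by (rule step[OF t_closed _ t that(2)]) (use \<gamma>gen in simp)
  next
    case (inv_t g)
    show ?case by (rule step[OF _ _ inv_t that(2)]) (use \<gamma>gen' in simp_all)
  qed
  have genS: "generate Q S = H"
  proof
    show "generate Q S \<subseteq> H" by (rule generate_subgroup_incl[OF SH H])
    show "H \<subseteq> generate Q S"
    proof
      fix h assume h: "h \<in> H"
      then have hQ: "h \<in> carrier Q" using HQ by blast
      \<comment> \<open>An element of \<open>H\<close> fixes the base coset, so it is its own
        Schreier generator at the root.\<close>
      have "\<rho> (h \<otimes> \<one>) = \<one>" by (rule \<rho>_eq) (use hQ h T1 in simp_all)
      then have "\<gamma> h \<one> = h" using hQ by (simp add: \<gamma>_def)
      then show "h \<in> generate Q S" using gam[OF hQ T1] by simp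
    qed
  qed
  define F where "F h = snd (\<Phi> h (\<one>, \<one>\<^bsub>K\<^esub>))" for h
  have F: "F h \<in> carrier K \<and> \<Phi> h (\<one>, \<one>\<^bsub>K\<^esub>) = (\<one>, F h)" if "h \<in> generate Q S" for h
    using that
  proof (induction rule: generate.induct)
    case one
    then show ?case using \<Phi>.hom_one by (simp add: F_def)
  next
    case (incl h)
    then show ?case using \<Phi>S[OF incl] eK[OF incl] by (simp add: F_def)
  next
    case (inv h)
    have hQ: "h \<in> carrier Q" using inv SQ by blast
    have "\<Phi> h (\<one>, inv\<^bsub>K\<^esub> e h) = (\<one>, \<one>\<^bsub>K\<^esub>)"
      using \<Phi>tr[OF hQ \<Phi>S[OF inv]] eK[OF inv] by simp
    then have "\<Phi> (inv h) (\<one>, \<one>\<^bsub>K\<^esub>) = (\<one>, inv\<^bsub>K\<^esub> e h)"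
      by (rule \<Phi>i[OF hQ])
    then show ?case using eK[OF inv] by (simp add: F_def)
  next
    case (eng g h)
    then have "g \<in> carrier Q" "h \<in> carrier Q" using genS HQ by blast+
    then have "\<Phi> (g \<otimes> h) (\<one>, \<one>\<^bsub>K\<^esub>) = (\<one>, F g \<otimes>\<^bsub>K\<^esub> F h)"
      using \<Phi>m[of g h] \<Phi>tr[of g \<one> "F g" "F h"] eng by simp
    then show ?case using eng by (simp add: F_def[of "g \<otimes> h"])
  qed
  have Fhom: "F \<in> hom (Q\<lparr>carrier := generate Q S\<rparr>) (cyc_pres J \<mu>)"
  proof (rule homI)
    show "F h \<in> carrier (cyc_pres J \<mu>)" if "h \<in> carrier (Q\<lparr>carrier := generate Q S\<rparr>)" for h
      using that F by (simp add: K_def[symmetric])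
    fix g h assume gh: "g \<in> carrier (Q\<lparr>carrier := generate Q S\<rparr>)" "h \<in> carrier (Q\<lparr>carrier := generate Q S\<rparr>)"
    then have "g \<in> carrier Q" "h \<in> carrier Q" using genS HQ by auto
    then have "\<Phi> (g \<otimes> h) (\<one>, \<one>\<^bsub>K\<^esub>) = (\<one>, F g \<otimes>\<^bsub>K\<^esub> F h)"
      using \<Phi>m[of g h] \<Phi>tr[of g \<one> "F g" "F h"] F gh by simp
    then show "F (g \<otimes>\<^bsub>Q\<lparr>carrier := generate Q S\<rparr>\<^esub> h) = F g \<otimes>\<^bsub>cyc_pres J \<mu>\<^esub> F h"
      by (simp add: F_def[of "g \<otimes> h"] K_def)
  qed
  have FJ: "F j = cgen J \<mu> j" if "j \<in> J" for j
    using \<Phi>S[of j] that by (simp add: F_def e_def J_def)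
  have \<mu>_ord: "\<mu> j = ord j" if "j \<in> J" for j
  proof (cases "j \<in> \<gamma> a ` T")
    case False
    then have "\<mu> j = 0" by (simp add: \<mu>_def)
    moreover have "j \<in> generate Q S" using that by (auto simp: J_def intro: generate.incl)
    ultimately show ?thesis
      using ord_eq_of_cyc_pres_hom[OF group_axioms subS Fhom that _ FJ[OF that]] by simp
  qed (simp add: \<mu>_def)
  have rel: "cyc_rels J \<mu> = cyc_rels J ord" by (rule cyc_rels_cong[OF \<mu>_ord])
  have "cyc_indep Q J"
    unfolding J_def
  proof (rule cyc_indepI[OF SQ])
    show "F \<in> hom (Q\<lparr>carrier := generate Q S\<rparr>) (cyc_pres (S - {\<one>}) ord)"
      using Fhom rel by (simp add: cyc_pres_def J_def)
    show "F s = cgen (S - {\<one>}) ord s" if "s \<in> S" "s \<noteq> \<one>" for s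
      using FJ[of s] that rel by (simp add: cgen_def J_def)
  qed
  moreover have "generate Q J = H" using generate_diff_one[OF SQ] genS by (simp add: J_def)
  moreover have "\<exists>g\<in>carrier Q. \<exists>l::nat. j = inv g \<otimes> a [^] l \<otimes> g" if j: "j \<in> J" "ord j \<noteq> 0" for j
  proof -
    have "j \<in> \<gamma> a ` T" using \<mu>_ord[OF j(1)] j(2) by (auto simp: \<mu>_def split: if_splits)
    then obtain x where x: "x \<in> T" "j = \<gamma> a x" by blast
    obtain g\<^sub>0 l i where g: "g\<^sub>0 \<in> T" "i < l" "segment H T g\<^sub>0 l" "x = a [^] i \<otimes> g\<^sub>0"
      using a_type[OF x(1)] by blast
    \<comment> \<open>Any earlier edge of the segment stays inside \<open>T\<close> and would give
      the trivial generator, which \<open>J\<close> excludes.\<close>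
    have "\<not> Suc i < l"
    proof
      assume "Suc i < l"
      then have "a [^] Suc i \<otimes> g\<^sub>0 \<in> T" using g(3) unfolding segment_def by blast
      then have "a \<otimes> x \<in> T" using a_pow_Suc[OF TQ[OF g(1)], of i] g(4) by simp
      then show False using \<gamma>_tree(2) x(2) j(1) by (simp add: J_def)
    qed
    then have "l = Suc i" using g(2) by simp
    then have "j = inv g\<^sub>0 \<otimes> a [^] l \<otimes> g\<^sub>0" using seg_end[OF g(1)] g(3,4) x(2) by (simp del: nat_pow_Suc)
    then show ?thesis using TQ[OF g(1)] by blast
  qed
  ultimately show ?thesis by (rule that)
qed

end

section \<open>Embedding free products of cyclic groups\<close>

text \<open>The exponent \<open>k = 0\<close> encodes the element of infinite order \<open>a\<^sup>-\<^sup>1 t a\<close>.\<close>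

definition branch :: "('a, 'b) monoid_scheme \<Rightarrow> 'a \<Rightarrow> 'a \<Rightarrow> nat \<Rightarrow> nat \<Rightarrow> 'a" where
  "branch G a t p k = inv\<^bsub>G\<^esub> (t [^]\<^bsub>G\<^esub> p) \<otimes>\<^bsub>G\<^esub>
    (if k = 0 then inv\<^bsub>G\<^esub> a \<otimes>\<^bsub>G\<^esub> t \<otimes>\<^bsub>G\<^esub> a else a [^]\<^bsub>G\<^esub> k) \<otimes>\<^bsub>G\<^esub> t [^]\<^bsub>G\<^esub> p"

lemma (in group) branch_closed:
  "a \<in> carrier G \<Longrightarrow> t \<in> carrier G \<Longrightarrow> branch G a t p k \<in> carrier G"
  by (simp add: branch_def)

lemma (in group) branch_pow:
  "a \<in> carrier G \<Longrightarrow> t \<in> carrier G \<Longrightarrow> k \<noteq> 0 \<Longrightarrow>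
    branch G a t p k [^] (m::nat) = inv (t [^] p) \<otimes> a [^] (k * m) \<otimes> t [^] p"
  by (simp add: branch_def conj_pow nat_pow_pow)

lemma (in group_hom) hom_branch:
  "a \<in> carrier G \<Longrightarrow> t \<in> carrier G \<Longrightarrow> h (branch G a t p k) = branch H (h a) (h t) p k"
  by (simp add: branch_def hom_nat_pow)

text \<open>The group acts on \<open>(\<int> \<times> \<nat>) \<times> P\<close>: \<open>t\<close> shifts the line \<open>\<int> \<times> {0}\<close> and \<open>a\<close> rotates finite
  cycles attached to it. The cycle at position \<open>f j\<close> carries the weight that makes the
  corresponding branch element multiply the \<open>P\<close>-component by \<open>j\<close>.\<close>

theorem (in Zn_free_Z) embed_cyclic_free_product:
  fixes P :: "('p, 'c) monoid_scheme"
  assumes P: "group P" and J: "cyc_indep P J" and gen: "generate P J = carrier P"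
    and fin: "finite J" and n2: "n \<ge> 2"
    and dvd: "\<And>j. j \<in> J \<Longrightarrow> group.ord P j \<noteq> 0 \<Longrightarrow> group.ord P j dvd n"
    and root: "\<And>j. j \<in> J \<Longrightarrow> group.ord P j \<noteq> 0 \<Longrightarrow>
      \<alpha> j \<in> carrier P \<and> \<alpha> j [^]\<^bsub>P\<^esub> s j = j \<and> \<alpha> j [^]\<^bsub>P\<^esub> group.ord P j = \<one>\<^bsub>P\<^esub>"
  obtains \<psi> f where "\<psi> \<in> hom P Q" "inj_on \<psi> (carrier P)"
    "\<And>j. j \<in> J \<Longrightarrow> \<psi> j = branch Q a t (f j)
        (if group.ord P j = 0 then 0 else n div group.ord P j * s j)"
proof -
  interpret P: group P by (rule P)
  let ?X = "UNIV :: (int \<times> nat) set"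
  interpret W: group "wreath ?X P" by (rule group_wreath[OF P])
  obtain f :: "'p \<Rightarrow> nat" where f: "inj_on f J"
    using finite_imp_inj_to_nat_seg[OF fin] by blast
  define pos where "pos j = int (f j)" for j
  have pos: "inj_on pos J" using f by (auto simp: inj_on_def pos_def)
  define lab where "lab p = inv_into J pos p" for p
  have lab: "lab (pos j) = j" if "j \<in> J" for j using pos that by (simp add: lab_def)
  \<comment> \<open>For finite order m the cycle has length n/m, so a^n goes round m times. An
    infinite factor needs only a second point on its cycle, which length n \<ge> 2 provides; all
    other positions are fixed by \<open>a\<close>.\<close>
  define len where "len p = (if p \<in> pos ` J then if P.ord (lab p) = 0 then n else n div P.ord (lab p) else 1)" for p
  \<comment> \<open>The weight is the root \<open>\<alpha>\<close> and not \<open>j\<close>: the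
    chosen exponent of \<open>a\<close> runs \<open>s j\<close> times round the cycle and so
    collects \<open>\<alpha> j\<close> to the power \<open>s j\<close>, which is
    \<open>j\<close>.\<close>
  define wa where "wa p = (if p \<in> pos ` J \<and> P.ord (lab p) \<noteq> 0 then \<alpha> (lab p) else \<one>\<^bsub>P\<^esub>)" for p
  \<comment> \<open>For infinite order the weight sits on the loop of \<open>t\<close> at the second
    point of the cycle, off the line that \<open>t\<close> shifts.\<close>
  define wt where "wt p = (if p \<in> pos ` J \<and> P.ord (lab p) = 0 then lab p else \<one>\<^bsub>P\<^esub>)" for p
  have JP: "j \<in> carrier P" if "j \<in> J" for j using cyc_indep_subset[OF J] that by blast
  have waP: "wa p \<in> carrier P" for p using root by (auto simp: wa_def lab)
  have wtP: "wt p \<in> carrier P" for p using JP by (auto simp: wt_def lab)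
  have len: "len p > 0 \<and> (\<exists>q. n = len p * q \<and> wa p [^]\<^bsub>P\<^esub> q = \<one>\<^bsub>P\<^esub>)" for p
  proof (cases "p \<in> pos ` J \<and> P.ord (lab p) \<noteq> 0")
    case True
    then obtain j where j: "j \<in> J" "p = pos j" "P.ord j \<noteq> 0" using lab by auto
    then have "n = len p * P.ord j" "len p > 0"
      using dvd[OF j(1,3)] n_pos by (auto simp: len_def lab div_greater_zero_iff dvd_imp_le)
    then show ?thesis using root[OF j(1,3)] j by (auto simp: wa_def lab)
  next
    case False
    then have "len p = n \<or> len p = 1" "wa p = \<one>\<^bsub>P\<^esub>" by (auto simp: len_def wa_def)
    then show ?thesis using n_pos by auto
  qed
  \<comment> \<open>The points with index at least \<open>len p\<close> are fixed; they only serve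
    to make the set of points a full product.\<close>
  define \<sigma>a where "\<sigma>a = (\<lambda>(p, i). if Suc i < len p then (p, Suc i) else if Suc i = len p then (p, 0) else (p, i))"
  define \<sigma>t where "\<sigma>t = (\<lambda>(p::int, i::nat). if i = 0 then (p + 1, 0) else (p, i))"
  have "bij \<sigma>a"
  proof (rule o_bij)
    let ?g = "\<lambda>(p, i). if i = 0 then (p, len p - 1) else if i < len p then (p, i - 1) else (p, i)"
    show "?g \<circ> \<sigma>a = id" "\<sigma>a \<circ> ?g = id" using len by (auto simp: \<sigma>a_def fun_eq_iff)
  qed
  then have \<sigma>a: "\<sigma>a permutes ?X" using bij_imp_permutes[of \<sigma>a ?X] by simp
  have "bij \<sigma>t"
  proof (rule o_bij)
    let ?g = "\<lambda>(p::int, i::nat). if i = 0 then (p - 1, 0) else (p, i)"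
    show "?g \<circ> \<sigma>t = id" "\<sigma>t \<circ> ?g = id" by (auto simp: \<sigma>t_def fun_eq_iff)
  qed
  then have \<sigma>t: "\<sigma>t permutes ?X" using bij_imp_permutes[of \<sigma>t ?X] by simp
  define A where "A = monomial ?X P \<sigma>a (\<lambda>(p, i). if Suc i = len p then wa p else \<one>\<^bsub>P\<^esub>)"
  define B where "B = monomial ?X P \<sigma>t (\<lambda>(p, i). if i = 1 then wt p else \<one>\<^bsub>P\<^esub>)"
  have AW: "A \<in> carrier (wreath ?X P)"
    unfolding A_def by (rule monomial_wreath[OF P \<sigma>a]) (use waP in \<open>auto split: prod.split\<close>)
  have BW: "B \<in> carrier (wreath ?X P)"
    unfolding B_def by (rule monomial_wreath[OF P \<sigma>t]) (use wtP in \<open>auto split: prod.split\<close>)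
  have A: "A ((p, i), k) = (if Suc i < len p then ((p, Suc i), k)
      else if Suc i = len p then ((p, 0), wa p \<otimes>\<^bsub>P\<^esub> k) else ((p, i), k))"
    if "k \<in> carrier P" for p i k
    using that by (simp add: A_def monomial_def \<sigma>a_def)
  have B: "B ((p, i), k) = (if i = 0 then ((p + 1, 0), k) else ((p, i), (if i = 1 then wt p else \<one>\<^bsub>P\<^esub>) \<otimes>\<^bsub>P\<^esub> k))"
    if "k \<in> carrier P" for p i k
    using that by (simp add: B_def monomial_def \<sigma>t_def)
  have run: "(A ^^ i) ((p, 0), k) = ((p, i), k)" if "i < len p" "k \<in> carrier P" for i p k
    using that by (induction i) (auto simp: A)
  have cycle: "(A ^^ len p) ((p, 0), \<one>\<^bsub>P\<^esub>) = ((p, 0), wa p)" for p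
  proof -
    obtain i where i: "len p = Suc i" using len[of p] by (cases "len p") auto
    then show ?thesis using run[of i p "\<one>\<^bsub>P\<^esub>"] waP by (simp add: A)
  qed
  have "(A ^^ n) z = z" for z
  proof (cases "snd z \<in> carrier P")
    case False
    have "A ^^ n \<in> carrier (wreath ?X P)" using W.nat_pow_closed[OF AW, of n] by (simp add: wreath_pow)
    then have "(A ^^ n) permutes ?X \<times> carrier P" by (simp add: wreath_def)
    then show ?thesis by (rule permutes_not_in) (use False in \<open>auto simp: mem_Times_iff\<close>)
  next
    case True
    obtain p i k where z: "z = ((p, i), k)" by (metis prod.exhaust)
    then have k: "k \<in> carrier P" using True by simp
    show ?thesis
    proof (cases "i < len p")
      case False
      then have "A z = z" using k by (simp add: z A)
      then have "(A ^^ m) z = z" for m by (induction m) simp_all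
      then show ?thesis .
    next
      case True
      obtain q where q: "n = len p * q" "wa p [^]\<^bsub>P\<^esub> q = \<one>\<^bsub>P\<^esub>" using len by blast
      have "(A ^^ (len p * q)) ((A ^^ i) ((p, 0), k)) = (A ^^ i) ((p, 0), k)"
        by (rule wreath_pow_fixes_orbit[OF P AW _ cycle waP q(2) k]) simp
      then show ?thesis using run[OF True k] q(1) by (simp add: z)
    qed
  qed
  then have "A [^]\<^bsub>wreath ?X P\<^esub> n = \<one>\<^bsub>wreath ?X P\<^esub>" by (auto simp: wreath_pow)
  then obtain \<Phi> where \<Phi>: "\<Phi> \<in> hom Q (wreath ?X P)" and \<Phi>a: "\<Phi> a = A" and \<Phi>t: "\<Phi> t = B"
    using Q_hom[OF W.group_axioms AW _ BW] by blast
  interpret \<Phi>: group_hom Q "wreath ?X P" \<Phi>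
    using \<Phi> by (simp add: group_hom_def group_hom_axioms_def group_axioms W.group_axioms)
  have \<Phi>m: "\<Phi> (g \<otimes> h) z = \<Phi> g (\<Phi> h z)" if "g \<in> carrier Q" "h \<in> carrier Q" for g h z
    using \<Phi>.hom_mult[OF that] by simp
  have \<Phi>i: "\<Phi> (inv g) z = z'" if "g \<in> carrier Q" "\<Phi> g z' = z" for g z z'
    using \<Phi>m[of "inv g" g z'] that \<Phi>.hom_one by simp
  have \<Phi>tp: "\<Phi> (t [^] m) ((0, 0), k) = ((int m, 0), k)" if "k \<in> carrier P" for m k
  proof -
    have "(B ^^ m) ((0, 0), k) = ((int m, 0), k)" by (induction m) (use that in \<open>auto simp: B\<close>)
    then show ?thesis using \<Phi>.hom_nat_pow[OF t_closed, of m] by (simp add: \<Phi>t wreath_pow)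
  qed
  define r where "r j = (if P.ord j = 0 then 0 else n div P.ord j * s j)" for j
  define v where "v j = branch Q a t (f j) (r j)" for j
  have vQ: "v j \<in> carrier Q" for j by (simp add: v_def branch_closed)
  have r0: "r j \<noteq> 0" "r j = len (pos j) * s j" "r j * P.ord j = n * s j" if j: "j \<in> J" "P.ord j \<noteq> 0" for j
  proof -
    have "s j \<noteq> 0"
    proof
      assume "s j = 0"
      then have "j = \<one>\<^bsub>P\<^esub>" using root[OF j] by simp
      then show False using j(1) cyc_indep_not_one[OF J] by simp
    qed
    moreover have "n div P.ord j > 0" using dvd[OF j] n_pos j(2) by (simp add: div_greater_zero_iff dvd_imp_le)
    ultimately show "r j \<noteq> 0" using j(2) by (simp add: r_def)
    show "r j = len (pos j) * s j" using j lab by (simp add: r_def len_def)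
    show "r j * P.ord j = n * s j" using dvd[OF j] j(2) by (auto simp: r_def elim!: dvdE)
  qed
  \<comment> \<open>For infinite order, \<open>a\<close> moves to the point with index 1,
    \<open>t\<close> multiplies by \<open>j\<close> there, and \<open>inv a\<close> returns. For
    finite order, \<open>a\<close> makes \<open>s j\<close> full rounds.\<close>
  have core: "\<Phi> (if r j = 0 then inv a \<otimes> t \<otimes> a else a [^] r j) ((pos j, 0), \<one>\<^bsub>P\<^esub>) = ((pos j, 0), j)"
    if j: "j \<in> J" for j
  proof (cases "P.ord j = 0")
    case True
    then have l: "len (pos j) = n" and w: "wt (pos j) = j" using j lab by (auto simp: len_def wt_def)
    have "\<Phi> a ((pos j, 0), k) = ((pos j, 1), k)" if "k \<in> carrier P" for k
      using A[OF that, of "pos j" 0] l n2 by (simp add: \<Phi>a)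
    then have "\<Phi> a ((pos j, 0), \<one>\<^bsub>P\<^esub>) = ((pos j, 1), \<one>\<^bsub>P\<^esub>)" "\<Phi> a ((pos j, 0), j) = ((pos j, 1), j)"
      using JP[OF j] by auto
    moreover have "\<Phi> t ((pos j, 1), \<one>\<^bsub>P\<^esub>) = ((pos j, 1), j)"
      using JP[OF j] w by (simp add: \<Phi>t B)
    ultimately have "\<Phi> (inv a \<otimes> t \<otimes> a) ((pos j, 0), \<one>\<^bsub>P\<^esub>) = ((pos j, 0), j)"
      using \<Phi>i[OF a_closed, of "((pos j, 0), j)"] by (simp add: \<Phi>m)
    then show ?thesis using True by (simp add: r_def)
  next
    case False
    then have w: "wa (pos j) = \<alpha> j" using j lab by (auto simp: wa_def)
    have "(A ^^ r j) ((pos j, 0), \<one>\<^bsub>P\<^esub>) = ((pos j, 0), wa (pos j) [^]\<^bsub>P\<^esub> s j \<otimes>\<^bsub>P\<^esub> \<one>\<^bsub>P\<^esub>)"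
      unfolding r0(2)[OF j False] by (rule wreath_pow_orbit[OF P AW _ cycle waP]) simp_all
    then show ?thesis
      using r0(1)[OF j False] root[OF j False] w JP[OF j] \<Phi>.hom_nat_pow[OF a_closed, of "r j"]
      by (simp add: \<Phi>a wreath_pow)
  qed
  have \<Phi>v: "\<Phi> (v j) ((0, 0), \<one>\<^bsub>P\<^esub>) = ((0, 0), j)" if j: "j \<in> J" for j
  proof -
    have "\<Phi> (t [^] f j) ((0, 0), k) = ((pos j, 0), k)" if "k \<in> carrier P" for k
      using \<Phi>tp[OF that] by (simp add: pos_def)
    then have "\<Phi> (t [^] f j) ((0, 0), \<one>\<^bsub>P\<^esub>) = ((pos j, 0), \<one>\<^bsub>P\<^esub>)" "\<Phi> (t [^] f j) ((0, 0), j) = ((pos j, 0), j)"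
      using JP[OF j] by auto
    then show ?thesis using core[OF j] \<Phi>i[of "t [^] f j" "((0, 0), j)"]
      unfolding v_def branch_def by (subst \<Phi>m; simp add: \<Phi>m)
  qed
  have vpow: "v j [^] P.ord j = \<one>" if j: "j \<in> J" for j
  proof (cases "P.ord j = 0")
    case False
    have "v j [^] P.ord j = inv (t [^] f j) \<otimes> a [^] (n * s j) \<otimes> t [^] f j"
      using branch_pow[OF a_closed t_closed r0(1)[OF j False], of "f j" "P.ord j"] r0(3)[OF j False]
      by (simp add: v_def)
    also have "a [^] (n * s j) = \<one>" using nat_pow_pow[OF a_closed, of n "s j"] a_pow_n by simp
    finally show ?thesis by simp
  qed simp
  obtain \<psi> where "\<psi> \<in> hom (P\<lparr>carrier := generate P J\<rparr>) Q" and \<psi>J: "\<And>j. j \<in> J \<Longrightarrow> \<psi> j = v j"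
    by (rule P.cyc_indep_hom[OF J group_axioms, of v]) (use vQ vpow in auto)
  then have \<psi>: "\<psi> \<in> hom P Q" by (simp add: gen)
  interpret \<psi>: group_hom P Q \<psi>
    using \<psi> by (simp add: group_hom_def group_hom_axioms_def group_axioms P)
  have tr: "\<Phi> g ((0, 0), k) = ((0, 0), m \<otimes>\<^bsub>P\<^esub> k)"
    if "g \<in> carrier Q" "\<Phi> g ((0, 0), \<one>\<^bsub>P\<^esub>) = ((0, 0), m)" "k \<in> carrier P" for g m k
    by (rule wreath_translate_one[OF P \<Phi>.hom_closed[OF that(1)] _ that(3,2)]) simp
  \<comment> \<open>The weight at the base point recovers \<open>x\<close> from
    \<open>\<psi> x\<close>; this is what makes \<open>\<psi>\<close> injective.\<close>
  have *: "\<Phi> (\<psi> x) ((0, 0), \<one>\<^bsub>P\<^esub>) = ((0, 0), x)" if "x \<in> generate P J" for x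
    using that
  proof (induction rule: generate.induct)
    case one
    then show ?case using \<Phi>.hom_one \<psi>.hom_one by simp
  next
    case (incl j)
    then show ?case using \<Phi>v \<psi>J by simp
  next
    case (inv j)
    have "\<Phi> (\<psi> j) ((0, 0), inv\<^bsub>P\<^esub> j) = ((0, 0), j \<otimes>\<^bsub>P\<^esub> inv\<^bsub>P\<^esub> j)"
      by (rule tr) (use \<Phi>v[OF inv] \<psi>J[OF inv] vQ JP[OF inv] in simp_all)
    then have "\<Phi> (\<psi> j) ((0, 0), inv\<^bsub>P\<^esub> j) = ((0, 0), \<one>\<^bsub>P\<^esub>)" using JP[OF inv] by simp
    from \<Phi>i[OF _ this] show ?case using JP[OF inv] by simp
  next
    case (eng x y)
    then have "x \<in> carrier P" "y \<in> carrier P" by (simp_all add: gen)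
    then show ?case using eng tr[of "\<psi> x" x y] by (simp add: \<Phi>m)
  qed
  have "inj_on \<psi> (carrier P)"
  proof (rule inj_onI)
    fix x y assume xy: "x \<in> carrier P" "y \<in> carrier P" "\<psi> x = \<psi> y"
    have "((0, 0), x) = \<Phi> (\<psi> x) ((0, 0), \<one>\<^bsub>P\<^esub>)" by (rule *[symmetric]) (simp add: gen xy(1))
    also have "\<dots> = ((0, 0), y)" unfolding xy(3) by (rule *) (simp add: gen xy(2))
    finally show "x = y" by simp
  qed
  from \<psi> this show ?thesis
    by (rule that) (simp add: \<psi>J v_def r_def)
qed

section \<open>The Baumslag-Solitar group as a central extension\<close>

lemma (in group) normal_generate_central:
  assumes "z \<in> carrier G" "\<And>x. x \<in> carrier G \<Longrightarrow> z \<otimes> x = x \<otimes> z"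
  shows "generate G {z} \<lhd> G"
proof (rule normal_generateI)
  show "g \<otimes> h \<otimes> inv g \<in> {z}" if "h \<in> {z}" "g \<in> carrier G" for h g
    using that assms(1) assms(2)[of g, symmetric] by (simp add: m_assoc)
qed (use assms in simp)

definition bs_rels :: "nat \<Rightarrow> (bs_gen word \<times> bs_gen word) set" where
  "bs_rels n = {([(Gen_t, True)] @ replicate n (Gen_a, True) @ [(Gen_t, False)], replicate n (Gen_a, True))}"

lemma BS_eq: "BS n n = presented_group UNIV (bs_rels n)"
  by (simp add: BS_def bs_rels_def)

definition bs_a :: "nat \<Rightarrow> bs_gen word set" where "bs_a n = pgen UNIV (bs_rels n) Gen_a"
definition bs_t :: "nat \<Rightarrow> bs_gen word set" where "bs_t n = pgen UNIV (bs_rels n) Gen_t"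

lemma group_BS: "group (BS n n)"
  by (simp add: BS_eq group_presented_group)

lemma bs_a_closed [simp, intro]: "bs_a n \<in> carrier (BS n n)"
  and bs_t_closed [simp, intro]: "bs_t n \<in> carrier (BS n n)"
  by (simp_all add: BS_eq bs_a_def bs_t_def pgen_closed)

lemma (in group) weval_bs_rel:
  assumes "f Gen_a \<in> carrier G" "f Gen_t \<in> carrier G"
  shows "weval G f ([(Gen_t, True)] @ replicate n (Gen_a, True) @ [(Gen_t, False)]) =
    f Gen_t \<otimes> f Gen_a [^] n \<otimes> inv f Gen_t"
proof -
  have f: "f \<in> UNIV \<rightarrow> carrier G" using assms by (auto simp: Pi_iff) (metis bs_gen.exhaust)
  have "weval G f (replicate n (Gen_a, True) @ [(Gen_t, False)]) = f Gen_a [^] n \<otimes> inv f Gen_t"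
    using weval_append[OF _ _ f, of "replicate n (Gen_a, True)" "[(Gen_t, False)]"] assms
    by (simp add: words_replicate weval_replicate)
  then show ?thesis using assms by (simp add: m_assoc)
qed

lemma BS_hom:
  fixes L (structure)
  assumes L: "group L" and \<alpha>: "\<alpha> \<in> carrier L" and \<tau>: "\<tau> \<in> carrier L"
    and rel: "\<tau> \<otimes> \<alpha> [^] n = \<alpha> [^] n \<otimes> \<tau>"
  obtains F where "F \<in> hom (BS n n) L" "F (bs_a n) = \<alpha>" "F (bs_t n) = \<tau>"
proof -
  interpret L: group L by (rule L)
  obtain F where "F \<in> hom (BS n n) L"
    and F: "\<And>x. x \<in> UNIV \<Longrightarrow> F (pgen UNIV (bs_rels n) x) = case_bs_gen \<alpha> \<tau> x"
    unfolding BS_eq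
  proof (rule L.presented_group_hom[of "case_bs_gen \<alpha> \<tau>" UNIV "bs_rels n"])
    show "case_bs_gen \<alpha> \<tau> \<in> UNIV \<rightarrow> carrier L" using \<alpha> \<tau> by (auto split: bs_gen.split)
    show "weval L (case_bs_gen \<alpha> \<tau>) r = weval L (case_bs_gen \<alpha> \<tau>) s" if "(r, s) \<in> bs_rels n" for r s
    proof -
      have rs: "r = [(Gen_t, True)] @ replicate n (Gen_a, True) @ [(Gen_t, False)]" "s = replicate n (Gen_a, True)"
        using \<open>(r, s) \<in> bs_rels n\<close> by (simp_all add: bs_rels_def)
      have "\<tau> \<otimes> \<alpha> [^] n \<otimes> inv \<tau> = \<alpha> [^] n" using \<alpha> \<tau> by (simp add: rel L.m_assoc)
      then show ?thesis
        unfolding rs using L.weval_bs_rel[of "case_bs_gen \<alpha> \<tau>" n] \<alpha> \<tau> by (simp add: L.weval_replicate)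
    qed
  qed auto
  then show ?thesis using that F[of Gen_a] F[of Gen_t] by (simp add: bs_a_def bs_t_def)
qed

lemma generate_BS: "generate (BS n n) {bs_a n, bs_t n} = carrier (BS n n)"
  using generate_presented_group[of UNIV "bs_rels n"] by (simp add: BS_eq bs_a_def bs_t_def range_bs_gen)

lemma BS_central:
  assumes x: "x \<in> carrier (BS n n)"
  shows "bs_a n [^]\<^bsub>BS n n\<^esub> n \<otimes>\<^bsub>BS n n\<^esub> x = x \<otimes>\<^bsub>BS n n\<^esub> bs_a n [^]\<^bsub>BS n n\<^esub> n"
proof -
  interpret B: group "BS n n" by (rule group_BS)
  let ?z = "bs_a n [^]\<^bsub>BS n n\<^esub> n"
  have "weval (BS n n) (pgen UNIV (bs_rels n)) ([(Gen_t, True)] @ replicate n (Gen_a, True) @ [(Gen_t, False)]) =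
      weval (BS n n) (pgen UNIV (bs_rels n)) (replicate n (Gen_a, True))"
    unfolding BS_eq by (rule presented_group_relation) (auto simp: bs_rels_def words_replicate)
  then have "bs_t n \<otimes>\<^bsub>BS n n\<^esub> ?z \<otimes>\<^bsub>BS n n\<^esub> inv\<^bsub>BS n n\<^esub> bs_t n = ?z"
    using B.weval_bs_rel[of "pgen UNIV (bs_rels n)" n] bs_a_closed[of n] bs_t_closed[of n]
      B.weval_replicate[of "pgen UNIV (bs_rels n)" Gen_a n]
    by (simp only: bs_a_def[symmetric] bs_t_def[symmetric])
  then have t: "bs_t n \<otimes>\<^bsub>BS n n\<^esub> ?z = ?z \<otimes>\<^bsub>BS n n\<^esub> bs_t n"
    by (metis B.inv_solve_right' B.m_closed B.nat_pow_closed bs_a_closed bs_t_closed)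
  have a: "bs_a n \<otimes>\<^bsub>BS n n\<^esub> ?z = ?z \<otimes>\<^bsub>BS n n\<^esub> bs_a n"
    using B.nat_pow_comm[of "bs_a n" 1 n] by simp
  have inv: "?z \<otimes>\<^bsub>BS n n\<^esub> inv\<^bsub>BS n n\<^esub> h = inv\<^bsub>BS n n\<^esub> h \<otimes>\<^bsub>BS n n\<^esub> ?z"
    if "h \<in> carrier (BS n n)" "h \<otimes>\<^bsub>BS n n\<^esub> ?z = ?z \<otimes>\<^bsub>BS n n\<^esub> h" for h
    by (metis B.inv_solve_left B.inv_solve_right B.inv_closed B.m_assoc B.m_closed B.nat_pow_closed bs_a_closed that)
  have "?z \<otimes>\<^bsub>BS n n\<^esub> x = x \<otimes>\<^bsub>BS n n\<^esub> ?z" if "x \<in> generate (BS n n) {bs_a n, bs_t n}" for x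
    using that
  proof (induction rule: generate.induct)
    case (inv h)
    then show ?case using \<open>\<And>h. h \<in> carrier (BS n n) \<Longrightarrow> _ \<Longrightarrow> _\<close>[of h] a t by auto
  next
    case (eng g h)
    then have "g \<in> carrier (BS n n)" "h \<in> carrier (BS n n)" by (simp_all add: generate_BS)
    then show ?case using eng.IH by (metis B.m_assoc B.nat_pow_closed bs_a_closed)
  qed (use a t in auto)
  then show ?thesis using x by (simp add: generate_BS)
qed

text \<open>The exponent sum in \<open>a\<close> respects the relation because \<open>a\<close>
  occurs with the same exponent \<open>n\<close> on both sides. It shows that a^n has infinite
  order.\<close>

lemma BS_exponent:
  obtains \<epsilon> where "\<epsilon> \<in> hom (BS n n) integer_group" "\<epsilon> (bs_a n) = 1"
  by (rule BS_hom[of integer_group 1 0 n]) auto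

context Zn_free_Z
begin

lemma BS_central_pow_inj:
  assumes "(bs_a n [^]\<^bsub>BS n n\<^esub> n) [^]\<^bsub>BS n n\<^esub> (k::int) = \<one>\<^bsub>BS n n\<^esub>"
  shows "k = 0"
proof -
  interpret B: group "BS n n" by (rule group_BS)
  obtain \<epsilon> where \<epsilon>: "\<epsilon> \<in> hom (BS n n) integer_group" "\<epsilon> (bs_a n) = 1" by (rule BS_exponent)
  interpret \<epsilon>: group_hom "BS n n" integer_group \<epsilon>
    using \<epsilon>(1) by (simp add: group_hom_def group_hom_axioms_def group_BS)
  have "k * int n = 0"
    using arg_cong[OF assms, of \<epsilon>] \<epsilon>.hom_int_pow[of "bs_a n [^]\<^bsub>BS n n\<^esub> n" k]
      \<epsilon>.hom_nat_pow[of "bs_a n" n] \<epsilon>.hom_one \<epsilon>(2) by simp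
  then show ?thesis using n_pos by simp
qed

text \<open>The kernel is no larger than the span of a^n: \<open>Q\<close> maps back to the quotient
  of BS(n,n) by this span, and the composite is the coset map.\<close>

lemma BS_quotient:
  obtains q where "q \<in> hom (BS n n) Q" "q (bs_a n) = a" "q (bs_t n) = t"
    "q ` carrier (BS n n) = carrier Q"
    "\<And>x. x \<in> carrier (BS n n) \<Longrightarrow> q x = \<one> \<Longrightarrow> \<exists>k::int. x = (bs_a n [^]\<^bsub>BS n n\<^esub> n) [^]\<^bsub>BS n n\<^esub> k"
proof -
  interpret B: group "BS n n" by (rule group_BS)
  let ?B = "BS n n" let ?z = "bs_a n [^]\<^bsub>BS n n\<^esub> n"
  obtain q where q: "q \<in> hom ?B Q" "q (bs_a n) = a" "q (bs_t n) = t"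
    by (rule BS_hom[OF group_axioms a_closed t_closed]) (use a_pow_n in auto)
  interpret q: group_hom ?B Q q using q(1) by (simp add: group_hom_def group_hom_axioms_def group_BS group_axioms)
  have "generate Q (q ` {bs_a n, bs_t n}) = q ` generate ?B {bs_a n, bs_t n}"
    by (rule q.generate_img) simp
  then have surj: "q ` carrier ?B = carrier Q" by (simp add: generate_BS generate_Q q(2,3))
  let ?N = "generate ?B {?z}"
  have N: "?N \<lhd> ?B" by (rule B.normal_generate_central) (use BS_central in auto)
  interpret N: normal ?N ?B by (rule N)
  interpret M: group "?B Mod ?N" by (rule N.factorgroup_is_group)
  have r: "(\<lambda>x. ?N #>\<^bsub>?B\<^esub> x) \<in> hom ?B (?B Mod ?N)" by (rule N.r_coset_hom_Mod)
  interpret r: group_hom ?B "?B Mod ?N" "\<lambda>x. ?N #>\<^bsub>?B\<^esub> x"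
    using r by (simp add: group_hom_def group_hom_axioms_def group_BS M.group_axioms)
  have "(?N #>\<^bsub>?B\<^esub> bs_a n) [^]\<^bsub>?B Mod ?N\<^esub> n = ?N #>\<^bsub>?B\<^esub> ?z"
    using r.hom_nat_pow[of "bs_a n" n] by simp
  also have "\<dots> = ?N" by (rule B.coset_join2[OF _ N.subgroup_axioms]) (auto intro: generate.incl)
  finally obtain \<delta> where \<delta>: "\<delta> \<in> hom Q (?B Mod ?N)" "\<delta> a = ?N #>\<^bsub>?B\<^esub> bs_a n" "\<delta> t = ?N #>\<^bsub>?B\<^esub> bs_t n"
    using Q_hom[OF M.group_axioms, of "?N #>\<^bsub>?B\<^esub> bs_a n" "?N #>\<^bsub>?B\<^esub> bs_t n"] r.hom_closed by auto
  interpret \<delta>: group_hom Q "?B Mod ?N" \<delta>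
    using \<delta>(1) by (simp add: group_hom_def group_hom_axioms_def M.group_axioms group_axioms)
  have "\<exists>k::int. x = ?z [^]\<^bsub>?B\<^esub> k" if x: "x \<in> carrier ?B" "q x = \<one>" for x
  proof -
    have "\<delta> (q x) = ?N #>\<^bsub>?B\<^esub> x"
      by (rule hom_eq_on_generate[OF group_BS M.group_axioms, where S = "{bs_a n, bs_t n}"
            and F = "\<lambda>x. \<delta> (q x)" and F' = "\<lambda>x. ?N #>\<^bsub>?B\<^esub> x"])
        (use hom_comp[OF q(1) \<delta>(1)] r x(1) in \<open>auto simp: generate_BS q(2,3) \<delta>(2,3)\<close>)
    then have "?N #>\<^bsub>?B\<^esub> x = ?N" using x(2) \<delta>.hom_one by simp
    then have "x \<in> ?N" using B.coset_join1[OF _ x(1) N.subgroup_axioms] by simp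
    then show ?thesis using B.generate_pow[of ?z] by auto
  qed
  with q surj show ?thesis by (intro that[of q])
qed

text \<open>Torsion in \<open>BS(n,n)\<close> has \<open>a\<close>-exponent \<open>0\<close>, so the finite cyclic subgroup that it
  generates in the quotient cannot contain a nontrivial conjugate of a power of \<open>a\<close>.\<close>

theorem torsion_free_BS: "torsion_free (BS n n)"
  unfolding torsion_free_def
proof (intro ballI allI impI)
  interpret B: group "BS n n" by (rule group_BS)
  fix x :: "bs_gen word set" and k :: nat
  assume x: "x \<in> carrier (BS n n)" and k: "k > 0" "x [^]\<^bsub>BS n n\<^esub> k = \<one>\<^bsub>BS n n\<^esub>"
  obtain \<epsilon> where \<epsilon>: "\<epsilon> \<in> hom (BS n n) integer_group" "\<epsilon> (bs_a n) = 1" by (rule BS_exponent)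
  interpret \<epsilon>: group_hom "BS n n" integer_group \<epsilon>
    using \<epsilon>(1) by (simp add: group_hom_def group_hom_axioms_def group_BS)
  obtain q where q: "q \<in> hom (BS n n) Q" "q (bs_a n) = a" "q (bs_t n) = t" "q ` carrier (BS n n) = carrier Q"
    and ker: "\<And>x. x \<in> carrier (BS n n) \<Longrightarrow> q x = \<one> \<Longrightarrow> \<exists>k::int. x = (bs_a n [^]\<^bsub>BS n n\<^esub> n) [^]\<^bsub>BS n n\<^esub> k"
    by (rule BS_quotient) blast
  interpret q: group_hom "BS n n" Q q
    using q(1) by (simp add: group_hom_def group_hom_axioms_def group_BS group_axioms)
  have \<epsilon>z: "\<epsilon> ((bs_a n [^]\<^bsub>BS n n\<^esub> n) [^]\<^bsub>BS n n\<^esub> i) = i * int n" for i :: int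
    using \<epsilon>.hom_int_pow[of "bs_a n [^]\<^bsub>BS n n\<^esub> n" i] \<epsilon>.hom_nat_pow[of "bs_a n" n] \<epsilon>(2) by simp
  have "int k * \<epsilon> x = 0" using arg_cong[OF k(2), of \<epsilon>] \<epsilon>.hom_nat_pow[OF x, of k] \<epsilon>.hom_one by simp
  then have \<epsilon>x: "\<epsilon> x = 0" using k(1) by simp
  let ?H = "generate Q {q x}"
  have qx: "q x \<in> carrier Q" using x by simp
  have H: "subgroup ?H Q" by (rule generate_is_subgroup) (use qx in simp)
  obtain J where J: "cyc_indep Q J" "generate Q J = ?H"
    and conj: "\<And>j. j \<in> J \<Longrightarrow> ord j \<noteq> 0 \<Longrightarrow> \<exists>g\<in>carrier Q. \<exists>l::nat. j = inv g \<otimes> a [^] l \<otimes> g"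
    by (rule kurosh[OF H]) blast
  \<comment> \<open>A member of \<open>J\<close> is a power of the torsion element
    \<open>q x\<close>, hence of finite order, hence conjugate to a power of \<open>a\<close> by the
    Kurosh theorem.\<close>
  have "J = {}"
  proof (rule ccontr)
    assume "J \<noteq> {}"
    then obtain j where j: "j \<in> J" by blast
    then have "j \<in> ?H" using J(2) generate.incl[of j J Q] by simp
    then obtain i :: int where i: "j = q x [^] i" using generate_pow[OF qx] by auto
    have jQ: "j \<in> carrier Q" using i qx by simp
    have jx: "j = q (x [^]\<^bsub>BS n n\<^esub> i)" using i q.hom_int_pow[OF x, of i] by simp
    have "q x [^] k = \<one>" using arg_cong[OF k(2), of q] q.hom_nat_pow[OF x, of k] q.hom_one by simp
    then have "ord (q x) dvd k" using pow_eq_id[OF qx] by simp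
    then have "j [^] k = \<one>"
      using int_pow_eq_id[OF qx, of "i * int k"] int_pow_pow[OF qx, of i "int k"] i
      by (simp add: int_pow_int)
    then have "ord j dvd k" using pow_eq_id[OF jQ] by simp
    then have "ord j \<noteq> 0" using k(1) by auto
    from conj[OF j this] obtain g l where g: "g \<in> carrier Q" "j = inv g \<otimes> a [^] (l::nat) \<otimes> g" by blast
    obtain g' where g': "g' \<in> carrier (BS n n)" "g = q g'" using g(1) q(4) by blast
    \<comment> \<open>A lift of \<open>j\<close> with exponent sum \<open>l\<close>. It differs from
      a power of \<open>x\<close>, which has exponent sum 0, by a power of a^n; so \<open>n\<close>
      divides \<open>l\<close> and \<open>j\<close> is trivial.\<close>
    let ?y = "inv\<^bsub>BS n n\<^esub> g' \<otimes>\<^bsub>BS n n\<^esub> bs_a n [^]\<^bsub>BS n n\<^esub> l \<otimes>\<^bsub>BS n n\<^esub> g'"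
    have y: "?y \<in> carrier (BS n n)" using g'(1) by simp
    have "q ?y = j" using g g' q(2) q.hom_nat_pow[of "bs_a n" l] by simp
    then have "q (inv\<^bsub>BS n n\<^esub> ?y \<otimes>\<^bsub>BS n n\<^esub> x [^]\<^bsub>BS n n\<^esub> i) = inv j \<otimes> j"
      using jx x y q.hom_mult[of "inv\<^bsub>BS n n\<^esub> ?y" "x [^]\<^bsub>BS n n\<^esub> i"] q.hom_inv[OF y] by simp
    then have "q (inv\<^bsub>BS n n\<^esub> ?y \<otimes>\<^bsub>BS n n\<^esub> x [^]\<^bsub>BS n n\<^esub> i) = \<one>" using jQ by simp
    then obtain r :: int where
      r: "inv\<^bsub>BS n n\<^esub> ?y \<otimes>\<^bsub>BS n n\<^esub> x [^]\<^bsub>BS n n\<^esub> i = (bs_a n [^]\<^bsub>BS n n\<^esub> n) [^]\<^bsub>BS n n\<^esub> r"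
      using ker[of "inv\<^bsub>BS n n\<^esub> ?y \<otimes>\<^bsub>BS n n\<^esub> x [^]\<^bsub>BS n n\<^esub> i"] x y by auto
    have "\<epsilon> ?y = int l" using g'(1) \<epsilon>.hom_nat_pow[of "bs_a n" l] \<epsilon>(2) by simp
    then have "\<epsilon> (inv\<^bsub>BS n n\<^esub> ?y \<otimes>\<^bsub>BS n n\<^esub> x [^]\<^bsub>BS n n\<^esub> i) = - int l"
      using x y \<epsilon>.hom_mult[of "inv\<^bsub>BS n n\<^esub> ?y" "x [^]\<^bsub>BS n n\<^esub> i"] \<epsilon>.hom_inv[OF y]
        \<epsilon>.hom_int_pow[OF x, of i] \<epsilon>x by simp
    then have "int l = - r * int n" using \<epsilon>z[of r] r by simp
    then have "int n dvd int l" by simp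
    then obtain c where "l = n * c" by auto
    then have "a [^] l = \<one>" using nat_pow_pow[OF a_closed, of n c] a_pow_n by simp
    then have "j = \<one>" using g by simp
    then show False using j cyc_indep_not_one[OF J(1)] by simp
  qed
  then have "?H = {\<one>}" using J(2) generate_empty by simp
  then have "q x = \<one>" using generate.incl[of "q x" "{q x}" Q] by simp
  then obtain i :: int where i: "x = (bs_a n [^]\<^bsub>BS n n\<^esub> n) [^]\<^bsub>BS n n\<^esub> i" using ker[OF x] by blast
  then have "i = 0" using \<epsilon>z[of i] \<epsilon>x n_pos by simp
  then show "x = \<one>\<^bsub>BS n n\<^esub>" using i by simp
qed

end

section \<open>Subgroups of BS(n,n)\<close>

lemma (in group) int_pow_commute:
  assumes "z \<in> carrier G" "x \<in> carrier G" "z \<otimes> x = x \<otimes> z"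
  shows "z [^] (k::int) \<otimes> x = x \<otimes> z [^] k"
proof -
  have "inv x \<otimes> z \<otimes> x = z" using assms by (simp add: m_assoc inv_cancel)
  then have nat: "z [^] (m::nat) \<otimes> x = x \<otimes> z [^] m" for m
    using conj_pow[of z x m] assms(1,2) inv_cancel(2)[of x "z [^] m \<otimes> x"] by (simp add: m_assoc)
  show ?thesis
  proof (cases k rule: int_cases2)
    case (nonneg m)
    then show ?thesis using nat[of m] by (simp add: int_pow_int)
  next
    case (nonpos m)
    have "inv (z [^] m) \<otimes> (z [^] m \<otimes> x) \<otimes> inv (z [^] m) = inv (z [^] m) \<otimes> (x \<otimes> z [^] m) \<otimes> inv (z [^] m)"
      by (simp only: nat)
    then show ?thesis using assms(1,2) by (simp add: nonpos int_pow_neg int_pow_int m_assoc inv_cancel)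
  qed
qed

lemma (in normal) kernel_r_coset: "kernel G (G Mod H) (\<lambda>x. H #> x) = H"
  using coset_join1[OF _ _ subgroup_axioms] coset_join2[OF _ subgroup_axioms] subset
  by (auto simp: kernel_def)

lemma torsion_free_hom:
  assumes G: "group G" and H: "group H" "torsion_free H" and h: "h \<in> mon G H"
  shows "torsion_free G"
  unfolding torsion_free_def
proof (intro ballI allI impI)
  fix x and n :: nat
  assume x: "x \<in> carrier G" "n > 0" "x [^]\<^bsub>G\<^esub> n = \<one>\<^bsub>G\<^esub>"
  interpret h: group_hom G H h using G H(1) h by (simp add: group_hom_def group_hom_axioms_def mon_def)
  have "h x [^]\<^bsub>H\<^esub> n = \<one>\<^bsub>H\<^esub>" using h.hom_nat_pow[OF x(1), of n] x(3) h.hom_one by simp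
  then have "h x = h \<one>\<^bsub>G\<^esub>" using H(2) x h.hom_one unfolding torsion_free_def by (metis h.hom_closed)
  then show "x = \<one>\<^bsub>G\<^esub>" using h x(1) h.G.one_closed unfolding mon_def inj_on_def by blast
qed

text \<open>A nonzero subgroup of the integers is generated by its least positive element; division
  with remainder is carried out through the injection \<open>e\<close>.\<close>

lemma (in group) subgroup_cyclic_of_int_hom:
  assumes N: "subgroup N G" "N \<noteq> {\<one>}" and e: "e \<in> hom (G\<lparr>carrier := N\<rparr>) integer_group" "inj_on e N"
  obtains g where "g \<in> N" "N = range (\<lambda>k::int. g [^] k)" "inj (\<lambda>k::int. g [^] k)"
proof -
  interpret N: group "G\<lparr>carrier := N\<rparr>" by (rule subgroup_imp_group[OF N(1)])
  interpret e: group_hom "G\<lparr>carrier := N\<rparr>" integer_group e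
    using e(1) by (simp add: group_hom_def group_hom_axioms_def N.group_axioms)
  have NG: "x \<in> carrier G" if "x \<in> N" for x using subgroup.subset[OF N(1)] that by blast
  have e1: "e \<one> = 0" using e.hom_one by simp
  have em: "e (x \<otimes> y) = e x + e y" if "x \<in> N" "y \<in> N" for x y using e.hom_mult[of x y] that by simp
  have ei: "e (inv x) = - e x" if "x \<in> N" for x
    using em[of "inv x" x] that subgroup.m_inv_closed[OF N(1)] NG e1 by simp
  have pN: "x [^] k \<in> N" if "x \<in> N" for x and k :: int by (rule subgroup_int_pow_closed[OF N(1) that])
  have ep: "e (x [^] k) = k * e x" if "x \<in> N" for x and k :: int
    using e.hom_int_pow[of x k] that int_pow_consistent[OF N(1) that, of k] by simp
  have inj: "x = y" if "x \<in> N" "y \<in> N" "e x = e y" for x y using e(2) that by (auto simp: inj_on_def)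
  obtain x where x: "x \<in> N" "x \<noteq> \<one>" using N subgroup.one_closed by blast
  have "e x \<noteq> 0" using inj[of x \<one>] x e1 subgroup.one_closed[OF N(1)] by auto
  let ?D = "\<lambda>d::nat. d > 0 \<and> (\<exists>y\<in>N. e y = int d)"
  have "\<exists>d. ?D d"
  proof (cases "e x > 0")
    case True
    then have "?D (nat (e x))" using x(1) by auto
    then show ?thesis ..
  next
    case False
    then have "?D (nat (- e x))"
      using \<open>e x \<noteq> 0\<close> x(1) ei[OF x(1)] subgroup.m_inv_closed[OF N(1) x(1)] by (auto intro!: bexI[of _ "inv x"])
    then show ?thesis ..
  qed
  define d where "d = Least ?D"
  have d: "d > 0" "\<exists>y\<in>N. e y = int d" using LeastI_ex[OF \<open>\<exists>d. ?D d\<close>] by (simp_all add: d_def)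
  have least: "c = 0" if "c < d" "\<exists>y\<in>N. e y = int c" for c
    using not_less_Least[of c ?D] that by (auto simp: d_def)
  obtain g where g: "g \<in> N" "e g = int d" using d(2) by blast
  have "y \<in> range (\<lambda>k::int. g [^] k)" if y: "y \<in> N" for y
  proof -
    let ?k = "e y div int d"
    let ?r = "y \<otimes> g [^] (- ?k)"
    have r: "?r \<in> N" using y pN[OF g(1)] subgroup.m_closed[OF N(1)] by blast
    have "e ?r = e y mod int d"
      using em[OF y pN[OF g(1)]] ep[OF g(1)] g(2) by (simp add: minus_div_mult_eq_mod[symmetric])
    then have "e ?r = int (nat (e y mod int d))" "nat (e y mod int d) < d"
      using d(1) by (simp_all add: nat_less_iff)
    then have "nat (e y mod int d) = 0" using least[of "nat (e y mod int d)"] r by blast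
    then have "e ?r = 0" using \<open>e ?r = int (nat (e y mod int d))\<close> by simp
    have "e y = e (g [^] ?k)"
      using \<open>e ?r = 0\<close> em[OF y pN[OF g(1)], of "- ?k"] ep[OF g(1)] by simp
    then show ?thesis using inj[OF y pN[OF g(1)]] by blast
  qed
  then have "N = range (\<lambda>k::int. g [^] k)" using pN[OF g(1)] by blast
  moreover have "inj (\<lambda>k::int. g [^] k)"
  proof (rule injI)
    fix k l :: int assume "g [^] k = g [^] l"
    then have "e (g [^] k) = e (g [^] l)" by simp
    then have "k * int d = l * int d" unfolding ep[OF g(1)] g(2) .
    then show "k = l" using d(1) by auto
  qed
  ultimately show ?thesis using that g(1) by blast
qed

context Zn_free_Z
begin

text \<open>The Kurosh theorem for the image, pulled back along \<open>h\<close>. It serves both for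
  a group mapped injectively to \<open>Q\<close> and for the quotient by the kernel of a map to
  \<open>Q\<close>.\<close>

lemma cyc_basis_of_mon:
  assumes G: "group G" and h: "h \<in> hom G Q" "inj_on h (carrier G)"
  obtains J where "cyc_indep G J" "generate G J = carrier G"
proof -
  interpret h: group_hom G Q h using G h(1) by (simp add: group_hom_def group_hom_axioms_def group_axioms)
  have "subgroup (h ` carrier G) Q" by (rule h.img_is_subgroup)
  then obtain J where J: "cyc_indep Q J" "generate Q J = h ` carrier G" by (rule kurosh) (rule that)
  have sub: "J \<subseteq> h ` carrier G" unfolding J(2)[symmetric] by (rule subsetI) (rule generate.incl)
  let ?J = "{x \<in> carrier G. h x \<in> J}"
  note v = cyc_indep_vimage[OF group_axioms G h J(1) sub]
  have "generate G ?J \<subseteq> carrier G" by (rule h.G.generate_incl) auto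
  then have "generate G ?J = carrier G"
    using v(2) J(2) inj_on_image_eq_iff[OF h(2), of "generate G ?J" "carrier G"] by simp
  with v(1) show ?thesis by (rule that)
qed

theorem subgroup_BS:
  fixes G :: "('g, 'c) monoid_scheme"
  assumes G: "group G" and h: "h \<in> mon G (BS n n)"
  shows "torsion_free G \<and> (is_free_group G \<or> is_central_extension_of_Z_by_free_product_of_cyclic_groups G)"
proof
  interpret G: group G by (rule G)
  interpret B: group "BS n n" by (rule group_BS)
  interpret Z: group integer_group by simp
  show tf: "torsion_free G" by (rule torsion_free_hom[OF G group_BS torsion_free_BS h])
  interpret h: group_hom G "BS n n" h
    using h G by (simp add: group_hom_def group_hom_axioms_def group_BS mon_def)
  have inj: "x = y" if "x \<in> carrier G" "y \<in> carrier G" "h x = h y" for x y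
    using h that by (auto simp: mon_def inj_on_def)
  obtain q where q: "q \<in> hom (BS n n) Q" "q (bs_a n) = a" "q (bs_t n) = t" "q ` carrier (BS n n) = carrier Q"
    and ker: "\<And>x. x \<in> carrier (BS n n) \<Longrightarrow> q x = \<one> \<Longrightarrow> \<exists>k::int. x = (bs_a n [^]\<^bsub>BS n n\<^esub> n) [^]\<^bsub>BS n n\<^esub> k"
    by (rule BS_quotient) blast
  let ?z = "bs_a n [^]\<^bsub>BS n n\<^esub> n"
  let ?p = "\<lambda>x. q (h x)"
  have p: "?p \<in> hom G Q" by (rule hom_comp[OF h.homh q(1)])
  interpret p: group_hom G Q ?p
    using p G by (simp add: group_hom_def group_hom_axioms_def group_axioms)
  let ?N = "kernel G Q ?p"
  have N: "?N \<lhd> G" by (rule p.normal_kernel)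
  interpret N: normal ?N G by (rule N)
  show "is_free_group G \<or> is_central_extension_of_Z_by_free_product_of_cyclic_groups G"
  proof (cases "?N = {\<one>\<^bsub>G\<^esub>}")
    case True
    then have "inj_on ?p (carrier G)" using p.inj_iff_trivial_ker by simp
    from cyc_basis_of_mon[OF G p this]
    obtain J where J: "cyc_indep G J" "generate G J = carrier G" .
    have "G.ord j = 0" if "j \<in> J" for j
    proof -
      have "j \<in> carrier G" "j \<noteq> \<one>\<^bsub>G\<^esub>" using that cyc_indep_subset[OF J(1)] cyc_indep_not_one[OF J(1)] by auto
      then show ?thesis using tf G.ord_eq_0 unfolding torsion_free_def by blast
    qed
    then have "G \<cong> free_group J"
      using iso_trans[OF cyc_basis_iso[OF G J] cyc_pres_free[of J G.ord]] by blast
    then show ?thesis unfolding is_free_group_def by (intro disjI1 exI)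
  next
    case False
    have NG: "x \<in> carrier G" and Nq: "q (h x) = \<one>" if "x \<in> ?N" for x
      using that unfolding kernel_def by blast+
    \<comment> \<open>On the kernel, \<open>h\<close> takes values in the powers of a^n. The
      exponent is unique, so it embeds the kernel in the integers.\<close>
    define e where "e x = (SOME k::int. h x = ?z [^]\<^bsub>BS n n\<^esub> k)" for x
    have e: "h x = ?z [^]\<^bsub>BS n n\<^esub> e x" if "x \<in> ?N" for x
      unfolding e_def by (rule someI_ex) (rule ker[OF h.hom_closed[OF NG[OF that]] Nq[OF that]])
    have zinj: "k = l" if "?z [^]\<^bsub>BS n n\<^esub> k = ?z [^]\<^bsub>BS n n\<^esub> l" for k l :: int
    proof -
      have "?z [^]\<^bsub>BS n n\<^esub> (k - l) = \<one>\<^bsub>BS n n\<^esub>" using that B.int_pow_diff[of ?z k l] by simp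
      from BS_central_pow_inj[OF this] show ?thesis by simp
    qed
    have "e \<in> hom (G\<lparr>carrier := ?N\<rparr>) integer_group"
    proof (rule homI)
      fix x y assume xy: "x \<in> carrier (G\<lparr>carrier := ?N\<rparr>)" "y \<in> carrier (G\<lparr>carrier := ?N\<rparr>)"
      then have "x \<otimes>\<^bsub>G\<^esub> y \<in> ?N" by (simp add: N.m_closed)
      then have "?z [^]\<^bsub>BS n n\<^esub> e (x \<otimes>\<^bsub>G\<^esub> y) = ?z [^]\<^bsub>BS n n\<^esub> (e x + e y)"
        using e[of x] e[of y] e[of "x \<otimes>\<^bsub>G\<^esub> y"] xy h.hom_mult[OF NG NG, of x y] B.int_pow_mult[of ?z "e x" "e y"] by simp
      then show "e (x \<otimes>\<^bsub>G\<lparr>carrier := ?N\<rparr>\<^esub> y) = e x \<otimes>\<^bsub>integer_group\<^esub> e y" using zinj by simp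
    qed simp
    moreover have "inj_on e ?N"
    proof (rule inj_onI)
      fix x y assume xy: "x \<in> ?N" "y \<in> ?N" "e x = e y"
      then show "x = y" using inj[OF NG[OF xy(1)] NG[OF xy(2)]] e[OF xy(1)] e[OF xy(2)] by simp
    qed
    ultimately obtain g where g: "g \<in> ?N" "?N = range (\<lambda>k::int. g [^]\<^bsub>G\<^esub> k)" "inj (\<lambda>k::int. g [^]\<^bsub>G\<^esub> k)"
      by (rule G.subgroup_cyclic_of_int_hom[OF N.subgroup_axioms False])
    \<comment> \<open>The cosets have the element type required by the definition, and the quotient
      embeds in \<open>Q\<close> by the isomorphism theorem.\<close>
    let ?P = "G Mod ?N"
    have P: "group ?P" by (rule N.factorgroup_is_group)
    obtain J where J: "cyc_indep ?P J" "generate ?P J = carrier ?P"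
      by (rule cyc_basis_of_mon[OF P p.FactGroup_hom p.FactGroup_inj_on])
    have "is_free_product_of_cyclic_groups ?P" by (rule cyc_basis_free_product[OF P J])
    moreover have "is_central_extension integer_group G ?P"
      unfolding is_central_extension_def
    proof (intro exI conjI ballI)
      show "(\<lambda>k::int. g [^]\<^bsub>G\<^esub> k) \<in> mon integer_group G"
        using G.hom_integer_group_pow[OF NG[OF g(1)]] g(3) by (simp add: mon_def)
      show "(\<lambda>x. ?N #>\<^bsub>G\<^esub> x) \<in> epi G ?P"
        using N.r_coset_hom_Mod by (simp add: epi_def carrier_FactGroup)
      have "kernel G ?P (\<lambda>x. ?N #>\<^bsub>G\<^esub> x) = ?N" by (rule N.kernel_r_coset)
      then show "kernel G ?P (\<lambda>x. ?N #>\<^bsub>G\<^esub> x) = (\<lambda>k::int. g [^]\<^bsub>G\<^esub> k) ` carrier integer_group"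
        using g(2) by simp
      fix y x assume "y \<in> (\<lambda>k::int. g [^]\<^bsub>G\<^esub> k) ` carrier integer_group" and x: "x \<in> carrier G"
      then have y: "y \<in> ?N" using g(2) by simp
      have zc: "?z [^]\<^bsub>BS n n\<^esub> k \<otimes>\<^bsub>BS n n\<^esub> b = b \<otimes>\<^bsub>BS n n\<^esub> ?z [^]\<^bsub>BS n n\<^esub> k"
        if "b \<in> carrier (BS n n)" for b and k :: int
        using B.int_pow_commute[OF _ that BS_central[OF that], of k] that by simp
      have "h (y \<otimes>\<^bsub>G\<^esub> x) = h (x \<otimes>\<^bsub>G\<^esub> y)"
        using e[OF y] zc[of "h x" "e y"] NG[OF y] x by simp
      then show "y \<otimes>\<^bsub>G\<^esub> x = x \<otimes>\<^bsub>G\<^esub> y" using inj NG[OF y] x by simp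
    qed
    ultimately show ?thesis
      unfolding is_central_extension_of_Z_by_free_product_of_cyclic_groups_def by (intro disjI2 exI conjI)
  qed
qed

end

section \<open>Embedding groups into BS(n,n)\<close>

lemma hom_on_subset: "f \<in> hom G H \<Longrightarrow> S \<subseteq> carrier G \<Longrightarrow> f \<in> hom (G\<lparr>carrier := S\<rparr>) H"
  by (auto simp: hom_def)

lemma Zn_free_Z_presented:
  assumes "n > 0"
  shows "Zn_free_Z (presented_group UNIV (quot_rels n)) n
    (pgen UNIV (quot_rels n) Gen_a) (pgen UNIV (quot_rels n) Gen_t)"
  using assms by (intro Zn_free_Z.intro group_presented_group Zn_free_Z_axioms.intro) simp_all

text \<open>All basis elements have infinite order, so their images in \<open>Q\<close> lift to
  BS(n,n) with no relation to check; the lift is injective because its composite with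
  \<open>q\<close> is.\<close>

lemma (in Zn_free_Z) embed_free:
  fixes G :: "('g, 'c) monoid_scheme"
  assumes G: "group G" "torsion_free G" and J: "cyc_indep G J" "generate G J = carrier G" "finite J"
    and n: "n \<ge> 2"
  shows "mon G (BS n n) \<noteq> {}"
proof -
  interpret G: group G by (rule G)
  interpret B: group "BS n n" by (rule group_BS)
  have ord: "G.ord j = 0" if "j \<in> J" for j
  proof -
    have "j \<in> carrier G" "j \<noteq> \<one>\<^bsub>G\<^esub>" using that cyc_indep_subset[OF J(1)] cyc_indep_not_one[OF J(1)] by auto
    then show ?thesis using G(2) G.ord_eq_0 unfolding torsion_free_def by blast
  qed
  obtain \<psi> f where \<psi>: "\<psi> \<in> hom G Q" "inj_on \<psi> (carrier G)"
    \<comment> \<open>The last factor \<open>0\<close> is a dummy value for \<open>s\<close>; every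
      order is 0, so that branch is never taken.\<close>
    and \<psi>J: "\<And>j. j \<in> J \<Longrightarrow> \<psi> j = branch Q a t (f j) (if G.ord j = 0 then 0 else n div G.ord j * 0)"
    by (rule embed_cyclic_free_product[OF G(1) J n]) (use ord in \<open>simp_all\<close>)
  obtain q where q: "q \<in> hom (BS n n) Q" "q (bs_a n) = a" "q (bs_t n) = t" by (rule BS_quotient) (rule that)
  interpret q: group_hom "BS n n" Q q
    using q(1) by (simp add: group_hom_def group_hom_axioms_def group_BS group_axioms)
  obtain F where "F \<in> hom (G\<lparr>carrier := generate G J\<rparr>) (BS n n)"
    and FJ: "\<And>j. j \<in> J \<Longrightarrow> F j = branch (BS n n) (bs_a n) (bs_t n) (f j) 0"
    by (rule G.cyc_indep_hom[OF J(1) group_BS[of n], of "\<lambda>j. branch (BS n n) (bs_a n) (bs_t n) (f j) 0"])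
      (use ord B.branch_closed in auto)
  then have F: "F \<in> hom G (BS n n)" by (simp add: J(2))
  have qF: "q (F x) = \<psi> x" if "x \<in> carrier G" for x
    by (rule hom_eq_on_generate[OF G(1) group_axioms cyc_indep_subset[OF J(1)],
          where F = "\<lambda>x. q (F x)" and F' = \<psi>])
      (simp_all add: J(2) that hom_comp[OF F q(1)] \<psi>(1) FJ \<psi>J ord q.hom_branch q(2,3))
  have "inj_on F (carrier G)"
  proof (rule inj_onI)
    fix x y assume xy: "x \<in> carrier G" "y \<in> carrier G" "F x = F y"
    then have "\<psi> x = \<psi> y" using qF[OF xy(1)] qF[OF xy(2)] by simp
    then show "x = y" using \<psi>(2) xy by (simp add: inj_on_def)
  qed
  then show ?thesis using F by (auto simp: mon_def)
qed

text \<open>Torsion-freeness makes the exponents \<open>m\<close> and \<open>s\<close> in \<open>u\<^sup>m = z\<^sup>s\<close> coprime.\<close>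

lemma central_lift:
  fixes G (structure)
  assumes G: "group G" "torsion_free G" and P: "group P" and p: "\<pi> \<in> hom G P"
    and z: "z \<in> carrier G" "\<And>x. x \<in> carrier G \<Longrightarrow> z \<otimes> x = x \<otimes> z"
    and ker: "kernel G P \<pi> = range (\<lambda>k::int. z [^] k)"
    and u: "u\<^sub>0 \<in> carrier G" and m: "group.ord P (\<pi> u\<^sub>0) = m" "m \<noteq> 0"
  obtains u \<alpha> and s :: nat where "u \<in> carrier G" "\<pi> u = \<pi> u\<^sub>0" "u [^] m = z [^] s"
    "\<alpha> \<in> carrier P" "\<alpha> [^]\<^bsub>P\<^esub> s = \<pi> u\<^sub>0" "\<alpha> [^]\<^bsub>P\<^esub> m = \<one>\<^bsub>P\<^esub>"
proof -
  interpret G: group G by (rule G)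
  interpret P: group P by (rule P)
  interpret p: group_hom G P \<pi> using G(1) P p by (simp add: group_hom_def group_hom_axioms_def)
  let ?j = "\<pi> u\<^sub>0"
  have j: "?j \<in> carrier P" using u by simp
  have zker: "\<pi> (z [^] k) = \<one>\<^bsub>P\<^esub>" for k :: int
  proof -
    have "z [^] k \<in> kernel G P \<pi>" unfolding ker by simp
    then show ?thesis by (simp add: kernel_def)
  qed
  have zc: "z [^] k \<otimes> x = x \<otimes> z [^] k" if "x \<in> carrier G" for x and k :: int
    by (rule G.int_pow_commute[OF z(1) that z(2)[OF that]])
  have "\<pi> (u\<^sub>0 [^] m) = \<one>\<^bsub>P\<^esub>" using p.hom_nat_pow[OF u, of m] P.pow_ord_eq_1[OF j] m(1) by simp
  then have "u\<^sub>0 [^] m \<in> kernel G P \<pi>" using u by (simp add: kernel_def)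
  then obtain s\<^sub>0 :: int where s0: "u\<^sub>0 [^] m = z [^] s\<^sub>0" unfolding ker by blast
  \<comment> \<open>Multiplying the lift by z^y changes the exponent to
    \<open>s\<^sub>0 + y * int m\<close>. The absolute value makes it nonnegative, so a natural
    exponent \<open>s\<close> can be used.\<close>
  define y where "y = \<bar>s\<^sub>0\<bar>"
  define u where "u = u\<^sub>0 \<otimes> z [^] y"
  have uG: "u \<in> carrier G" using \<open>u\<^sub>0 \<in> carrier G\<close> z(1) by (simp add: u_def)
  have pu: "\<pi> u = ?j" using \<open>u\<^sub>0 \<in> carrier G\<close> z(1) zker j by (simp add: u_def)
  define s where "s = nat (s\<^sub>0 + y * int m)"
  have "1 * y \<le> int m * y" using m(2) by (intro mult_right_mono) (auto simp: y_def)
  then have "s\<^sub>0 + y * int m \<ge> 0" by (simp add: y_def mult.commute)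
  then have s: "int s = s\<^sub>0 + y * int m" by (simp add: s_def)
  have "u [^] m = u\<^sub>0 [^] m \<otimes> (z [^] y) [^] m"
    unfolding u_def using \<open>u\<^sub>0 \<in> carrier G\<close> z(1) zc by (intro G.pow_mult_distrib) simp_all
  also have "(z [^] y) [^] m = z [^] (y * int m)" using G.int_pow_pow[OF z(1), of y "int m"] by (simp add: int_pow_int)
  also have "u\<^sub>0 [^] m \<otimes> z [^] (y * int m) = z [^] (int s)" using G.int_pow_mult[OF z(1)] by (simp add: s0 s)
  finally have us: "u [^] m = z [^] s" by (simp add: int_pow_int)
  have "coprime s m"
  proof (rule ccontr)
    assume "\<not> coprime s m"
    then have d1: "gcd s m \<noteq> 1" by (simp add: coprime_iff_gcd_eq_1)
    define d where "d = gcd s m"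
    obtain s' m' where sm: "s = d * s'" "m = d * m'" unfolding d_def by (meson dvdE gcd_dvd1 gcd_dvd2)
    have d0: "d > 0" "m' > 0" using m(2) sm by (auto intro: gr0I)
    \<comment> \<open>With a common divisor \<open>d\<close> of the exponents, \<open>w\<close>
      satisfies w^d = 1 and is therefore trivial. Then the m'-th power of \<open>\<pi> u\<close> is
      trivial although its order is m = d m', which forces d = 1.\<close>
    define w where "w = u [^] m' \<otimes> inv (z [^] s')"
    have wG: "w \<in> carrier G" using uG z(1) by (simp add: w_def)
    have zi: "inv (z [^] s') = z [^] (- int s')" using z(1) by (simp add: G.int_pow_neg int_pow_int)
    have "w [^] d = (u [^] m') [^] d \<otimes> (inv (z [^] s')) [^] d"
      unfolding w_def zi by (rule G.pow_mult_distrib) (use uG z(1) zc[of "u [^] m'" "- int s'"] in simp_all)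
    also have "\<dots> = u [^] m \<otimes> inv (z [^] s)"
      using uG z(1) by (simp add: G.nat_pow_pow G.nat_pow_inv sm mult.commute)
    finally have "w [^] d = \<one>" using us z(1) by simp
    then have "w = \<one>" using G(2) wG d0(1) unfolding torsion_free_def by blast
    then have "\<pi> (u [^] m' \<otimes> inv (z [^] s')) = \<one>\<^bsub>P\<^esub>" by (simp add: w_def)
    moreover have "\<pi> (inv (z [^] s')) = \<one>\<^bsub>P\<^esub>" unfolding zi by (rule zker)
    ultimately have "?j [^]\<^bsub>P\<^esub> m' = \<one>\<^bsub>P\<^esub>"
      using p.hom_mult[of "u [^] m'" "inv (z [^] s')"] p.hom_nat_pow[OF uG, of m'] uG z(1) pu j by simp
    then have "m dvd m'" using P.pow_eq_id[OF j, of m'] m(1) by simp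
    then have "d * m' \<le> 1 * m'" using dvd_imp_le[OF _ d0(2)] sm(2) by simp
    then have "d = 1" using d0 by simp
    then show False using d1 by (simp add: d_def)
  qed
  then have "gcd (int s) (int m) = 1" by (simp add: coprime_iff_gcd_eq_1)
  then obtain x v where xv: "x * int s + v * int m = 1" using bezout_int[of "int s" "int m"] by auto
  \<comment> \<open>\<open>x\<close> is an inverse of \<open>s\<close> modulo \<open>m\<close>, so
    the \<open>s\<close>-th power undoes it.\<close>
  define \<alpha> where "\<alpha> = ?j [^]\<^bsub>P\<^esub> x"
  have \<alpha>p: "\<alpha> [^]\<^bsub>P\<^esub> k = ?j [^]\<^bsub>P\<^esub> (x * int k)" for k :: nat
    using P.int_pow_pow[OF j, of x "int k"] by (simp add: \<alpha>_def int_pow_int)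
  have "\<alpha> [^]\<^bsub>P\<^esub> m = \<one>\<^bsub>P\<^esub>" unfolding \<alpha>p using P.int_pow_eq_id[OF j] m(1) by simp
  moreover have "\<alpha> [^]\<^bsub>P\<^esub> s = ?j"
  proof -
    have "x * int s = 1 - v * int m" using xv by simp
    then have "?j [^]\<^bsub>P\<^esub> (x * int s) = ?j [^]\<^bsub>P\<^esub> (1::int)"
      unfolding P.int_pow_eq[OF j] using m(1) by simp
    then show ?thesis unfolding \<alpha>p using j by simp
  qed
  moreover have "\<alpha> \<in> carrier P" using j by (simp add: \<alpha>_def)
  ultimately show ?thesis using that[OF uG pu us] by blast
qed

text \<open>The embedding is the subgroup of \<open>G \<times> BS(n,n)\<close> generated by the pairs of corresponding
  elements: modulo its central cyclic subgroup generated by \<open>(z, a\<^sup>n)\<close> it is determined by its image in \<open>P\<close>,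
  so it is the graph of an injective map.\<close>

theorem (in Zn_free_Z) embed_central_extension:
  fixes G :: "('g, 'c) monoid_scheme" and P :: "('p, 'd) monoid_scheme"
  assumes G: "group G" and P: "group P" and p: "\<pi> \<in> epi G P"
    and z: "z \<in> carrier G" "\<And>x. x \<in> carrier G \<Longrightarrow> z \<otimes>\<^bsub>G\<^esub> x = x \<otimes>\<^bsub>G\<^esub> z"
    and ker: "kernel G P \<pi> = range (\<lambda>k::int. z [^]\<^bsub>G\<^esub> k)"
    and zinf: "\<And>k::int. z [^]\<^bsub>G\<^esub> k = \<one>\<^bsub>G\<^esub> \<Longrightarrow> k = 0"
    and J: "cyc_indep P J" "generate P J = carrier P" "finite J" and n: "n \<ge> 2"
    and dvd: "\<And>j. j \<in> J \<Longrightarrow> group.ord P j \<noteq> 0 \<Longrightarrow> group.ord P j dvd n"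
    and u: "\<And>j. j \<in> J \<Longrightarrow> u j \<in> carrier G \<and> \<pi> (u j) = j"
    and us: "\<And>j. j \<in> J \<Longrightarrow> group.ord P j \<noteq> 0 \<Longrightarrow> u j [^]\<^bsub>G\<^esub> group.ord P j = z [^]\<^bsub>G\<^esub> (s j :: nat)"
    and root: "\<And>j. j \<in> J \<Longrightarrow> group.ord P j \<noteq> 0 \<Longrightarrow>
      \<alpha> j \<in> carrier P \<and> \<alpha> j [^]\<^bsub>P\<^esub> s j = j \<and> \<alpha> j [^]\<^bsub>P\<^esub> group.ord P j = \<one>\<^bsub>P\<^esub>"
  shows "mon G (BS n n) \<noteq> {}"
proof -
  interpret G: group G by (rule G)
  interpret P: group P by (rule P)
  interpret B: group "BS n n" by (rule group_BS)
  have ph: "\<pi> \<in> hom G P" and psurj: "\<pi> ` carrier G = carrier P" using p by (simp_all add: epi_def)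
  interpret p: group_hom G P \<pi> using ph G P by (simp add: group_hom_def group_hom_axioms_def)
  let ?B = "BS n n" let ?b = "bs_a n [^]\<^bsub>BS n n\<^esub> n"
  have bB: "?b \<in> carrier ?B" by simp
  obtain q where q: "q \<in> hom ?B Q" "q (bs_a n) = a" "q (bs_t n) = t" by (rule BS_quotient) (rule that)
  interpret q: group_hom ?B Q q
    using q(1) by (simp add: group_hom_def group_hom_axioms_def group_BS group_axioms)
  obtain \<psi> f where \<psi>: "\<psi> \<in> hom P Q" "inj_on \<psi> (carrier P)"
    and \<psi>J: "\<And>j. j \<in> J \<Longrightarrow> \<psi> j = branch Q a t (f j) (if P.ord j = 0 then 0 else n div P.ord j * s j)"
    by (rule embed_cyclic_free_product[OF P J n dvd root]) (assumption | rule that)+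
  interpret \<psi>: group_hom P Q \<psi>
    using \<psi>(1) P by (simp add: group_hom_def group_hom_axioms_def group_axioms)
  define v where "v j = branch ?B (bs_a n) (bs_t n) (f j) (if P.ord j = 0 then 0 else n div P.ord j * s j)" for j
  have vB: "v j \<in> carrier ?B" for j by (simp add: v_def B.branch_closed)
  have qv: "q (v j) = \<psi> j" if "j \<in> J" for j
    using \<psi>J[OF that] by (simp add: v_def q.hom_branch q(2,3))
  \<comment> \<open>The same relation as the one for \<open>u j\<close>, with a^n in place of
    \<open>z\<close>. The exponent n/m times \<open>s j\<close> is chosen for this match;
    conjugation by powers of \<open>t\<close> does not affect a central element.\<close>
  have vpow: "v j [^]\<^bsub>?B\<^esub> P.ord j = ?b [^]\<^bsub>?B\<^esub> s j" if j: "j \<in> J" "P.ord j \<noteq> 0" for j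
  proof -
    have "s j \<noteq> 0"
    proof
      assume "s j = 0"
      then have "j = \<one>\<^bsub>P\<^esub>" using root[OF j] by simp
      then show False using j(1) cyc_indep_not_one[OF J(1)] by simp
    qed
    moreover obtain c where c: "n = P.ord j * c" using dvd[OF j] by blast
    then have "c > 0" using n by (intro gr0I) auto
    ultimately have r: "n div P.ord j * s j \<noteq> 0" "n div P.ord j * s j * P.ord j = n * s j"
      using j(2) c by (simp_all add: mult.commute mult.left_commute)
    have "v j = branch ?B (bs_a n) (bs_t n) (f j) (n div P.ord j * s j)" using j(2) by (simp add: v_def)
    then have "v j [^]\<^bsub>?B\<^esub> P.ord j = inv\<^bsub>?B\<^esub> (bs_t n [^]\<^bsub>?B\<^esub> f j) \<otimes>\<^bsub>?B\<^esub> bs_a n [^]\<^bsub>?B\<^esub> (n * s j) \<otimes>\<^bsub>?B\<^esub> bs_t n [^]\<^bsub>?B\<^esub> f j"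
      using B.branch_pow[OF bs_a_closed bs_t_closed r(1), of "f j" "P.ord j"] by (simp only: r(2))
    also have "bs_a n [^]\<^bsub>?B\<^esub> (n * s j) = ?b [^]\<^bsub>?B\<^esub> s j" by (simp add: B.nat_pow_pow)
    also have "inv\<^bsub>?B\<^esub> (bs_t n [^]\<^bsub>?B\<^esub> f j) \<otimes>\<^bsub>?B\<^esub> ?b [^]\<^bsub>?B\<^esub> s j \<otimes>\<^bsub>?B\<^esub> bs_t n [^]\<^bsub>?B\<^esub> f j = ?b [^]\<^bsub>?B\<^esub> s j"
    proof -
      have "?b [^]\<^bsub>?B\<^esub> (int (s j)) \<otimes>\<^bsub>?B\<^esub> bs_t n [^]\<^bsub>?B\<^esub> f j = bs_t n [^]\<^bsub>?B\<^esub> f j \<otimes>\<^bsub>?B\<^esub> ?b [^]\<^bsub>?B\<^esub> (int (s j))"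
        by (rule B.int_pow_commute) (use BS_central in simp_all)
      then show ?thesis by (simp add: int_pow_int B.m_assoc B.inv_cancel)
    qed
    finally show ?thesis .
  qed
  define L where "L = G \<times>\<times> ?B"
  interpret L: group L unfolding L_def by (rule DirProd_group[OF G group_BS])
  have Lc: "(g, b) \<in> carrier L \<longleftrightarrow> g \<in> carrier G \<and> b \<in> carrier ?B" for g b by (simp add: L_def)
  have Lm: "(g, b) \<otimes>\<^bsub>L\<^esub> (g', b') = (g \<otimes>\<^bsub>G\<^esub> g', b \<otimes>\<^bsub>?B\<^esub> b')" for g b g' b' by (simp add: L_def)
  have L1: "\<one>\<^bsub>L\<^esub> = (\<one>\<^bsub>G\<^esub>, \<one>\<^bsub>?B\<^esub>)" by (simp add: L_def)
  have fst: "fst \<in> hom L G" and snd: "snd \<in> hom L ?B" by (auto simp: L_def hom_def)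
  interpret fst: group_hom L G fst using fst by (simp add: group_hom_def group_hom_axioms_def G L.group_axioms)
  interpret snd: group_hom L ?B snd using snd by (simp add: group_hom_def group_hom_axioms_def group_BS L.group_axioms)
  define y where "y = (z, ?b)"
  have yL: "y \<in> carrier L" using z(1) by (simp add: y_def Lc)
  define N where "N = generate L {y}"
  have "N \<lhd> L" unfolding N_def
  proof (rule L.normal_generate_central[OF yL])
    show "y \<otimes>\<^bsub>L\<^esub> x = x \<otimes>\<^bsub>L\<^esub> y" if "x \<in> carrier L" for x
      using that z(2) BS_central by (cases x) (simp add: Lc Lm y_def)
  qed
  then interpret N: normal N L .
  interpret M: group "L Mod N" by (rule N.factorgroup_is_group)
  have r: "(\<lambda>x. N #>\<^bsub>L\<^esub> x) \<in> hom L (L Mod N)" by (rule N.r_coset_hom_Mod)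
  interpret r: group_hom L "L Mod N" "\<lambda>x. N #>\<^bsub>L\<^esub> x"
    using r by (simp add: group_hom_def group_hom_axioms_def L.group_axioms M.group_axioms)
  have yN: "y [^]\<^bsub>L\<^esub> (k::int) \<in> N" for k
    unfolding N_def using L.generate_pow[OF yL] by auto
  have Npow: "\<exists>k::int. e = y [^]\<^bsub>L\<^esub> k" if "e \<in> N" for e
    using that L.generate_pow[OF yL] by (auto simp: N_def)
  have ypow: "fst (y [^]\<^bsub>L\<^esub> k) = z [^]\<^bsub>G\<^esub> k" "snd (y [^]\<^bsub>L\<^esub> k) = ?b [^]\<^bsub>?B\<^esub> k" for k :: int
    using fst.hom_int_pow[OF yL, of k] snd.hom_int_pow[OF yL, of k] by (simp_all add: y_def)
  define c where "c j = (u j, v j)" for j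
  have cL: "c j \<in> carrier L" if "j \<in> J" for j using u[OF that] vB by (simp add: c_def Lc)
  \<comment> \<open>Modulo (z, a^n) the pair of lifts satisfies the power relation of
    \<open>j\<close>, by the matching relations in both components.\<close>
  obtain \<delta> where "\<delta> \<in> hom (P\<lparr>carrier := generate P J\<rparr>) (L Mod N)" and \<delta>J: "\<And>j. j \<in> J \<Longrightarrow> \<delta> j = N #>\<^bsub>L\<^esub> c j"
  proof (rule P.cyc_indep_hom[OF J(1) M.group_axioms, of "\<lambda>j. N #>\<^bsub>L\<^esub> c j"])
    show "(\<lambda>j. N #>\<^bsub>L\<^esub> c j) \<in> J \<rightarrow> carrier (L Mod N)" using r.hom_closed cL by blast
    show "(N #>\<^bsub>L\<^esub> c j) [^]\<^bsub>L Mod N\<^esub> P.ord j = \<one>\<^bsub>L Mod N\<^esub>" if j: "j \<in> J" for j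
    proof (cases "P.ord j = 0")
      case False
      have "fst (c j [^]\<^bsub>L\<^esub> P.ord j) = z [^]\<^bsub>G\<^esub> s j" "snd (c j [^]\<^bsub>L\<^esub> P.ord j) = ?b [^]\<^bsub>?B\<^esub> s j"
        using fst.hom_nat_pow[OF cL[OF j], of "P.ord j"] snd.hom_nat_pow[OF cL[OF j], of "P.ord j"]
          us[OF j False] vpow[OF j False] by (simp_all add: c_def)
      then have "c j [^]\<^bsub>L\<^esub> P.ord j = y [^]\<^bsub>L\<^esub> (int (s j))"
        using ypow[of "int (s j)"] by (simp add: prod_eq_iff int_pow_int)
      then have "c j [^]\<^bsub>L\<^esub> P.ord j \<in> N" using yN by simp
      then have "N #>\<^bsub>L\<^esub> (c j [^]\<^bsub>L\<^esub> P.ord j) = N"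
        using L.coset_join2[OF _ N.subgroup_axioms] cL[OF j] by simp
      then show ?thesis using r.hom_nat_pow[OF cL[OF j], of "P.ord j"] by simp
    qed simp
  qed blast
  then have \<delta>: "\<delta> \<in> hom P (L Mod N)" by (simp add: J(2))
  interpret \<delta>: group_hom P "L Mod N" \<delta>
    using \<delta> by (simp add: group_hom_def group_hom_axioms_def P M.group_axioms)
  define S where "S = insert y (c ` J)"
  define \<Gamma> where "\<Gamma> = generate L S"
  have SL: "S \<subseteq> carrier L" using yL cL by (auto simp: S_def)
  have \<Gamma>: "subgroup \<Gamma> L" unfolding \<Gamma>_def by (rule L.generate_is_subgroup[OF SL])
  have \<Gamma>L: "e \<in> carrier L" if "e \<in> \<Gamma>" for e using that subgroup.subset[OF \<Gamma>] by blast
  have pz: "\<pi> z = \<one>\<^bsub>P\<^esub>"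
  proof -
    have "z \<in> kernel G P \<pi>" unfolding ker using G.int_pow_1[OF z(1)] by (metis rangeI)
    then show ?thesis by (simp add: kernel_def)
  qed
  have qb: "q ?b = \<one>" using q.hom_nat_pow[of "bs_a n" n] q(2) a_pow_n by simp
  \<comment> \<open>Both components of an element of \<open>\<Gamma>\<close> induce the same element
    of \<open>Q\<close>, so a trivial second component forces a trivial image in \<open>P\<close>,
    as \<open>\<psi>\<close> is injective.\<close>
  have q\<psi>: "q (snd e) = \<psi> (\<pi> (fst e))" if "e \<in> \<Gamma>" for e
  proof (rule hom_eq_on_generate[OF L.group_axioms group_axioms SL,
        where F = "\<lambda>e. q (snd e)" and F' = "\<lambda>e. \<psi> (\<pi> (fst e))"])
    show "(\<lambda>e. q (snd e)) \<in> hom (L\<lparr>carrier := generate L S\<rparr>) Q"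
      by (rule hom_on_subset[OF hom_comp[OF snd q(1)] L.generate_incl[OF SL]])
    show "(\<lambda>e. \<psi> (\<pi> (fst e))) \<in> hom (L\<lparr>carrier := generate L S\<rparr>) Q"
      by (rule hom_on_subset[OF hom_comp[OF hom_comp[OF fst ph] \<psi>(1)] L.generate_incl[OF SL]])
    show "q (snd x) = \<psi> (\<pi> (fst x))" if "x \<in> S" for x
      using that u qv pz qb \<psi>.hom_one by (auto simp: S_def y_def c_def)
    show "e \<in> generate L S" using \<open>e \<in> \<Gamma>\<close> by (simp add: \<Gamma>_def)
  qed
  \<comment> \<open>The class of an element of \<open>\<Gamma>\<close> modulo \<open>N\<close>
    depends only on its image in \<open>P\<close>; if that is trivial, the element is a power of (z,
    a^n).\<close>
  have \<delta>N: "\<delta> (\<pi> (fst e)) = N #>\<^bsub>L\<^esub> e" if "e \<in> \<Gamma>" for e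
  proof (rule hom_eq_on_generate[OF L.group_axioms M.group_axioms SL,
        where F = "\<lambda>e. \<delta> (\<pi> (fst e))" and F' = "\<lambda>e. N #>\<^bsub>L\<^esub> e"])
    show "(\<lambda>e. \<delta> (\<pi> (fst e))) \<in> hom (L\<lparr>carrier := generate L S\<rparr>) (L Mod N)"
      by (rule hom_on_subset[OF hom_comp[OF hom_comp[OF fst ph] \<delta>] L.generate_incl[OF SL]])
    show "(\<lambda>e. N #>\<^bsub>L\<^esub> e) \<in> hom (L\<lparr>carrier := generate L S\<rparr>) (L Mod N)"
      by (rule hom_on_subset[OF r L.generate_incl[OF SL]])
    have "N #>\<^bsub>L\<^esub> y = N"
      using L.coset_join2[OF yL N.subgroup_axioms] yN[of 1] L.int_pow_1[OF yL] by simp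
    then show "\<delta> (\<pi> (fst x)) = N #>\<^bsub>L\<^esub> x" if "x \<in> S" for x
      using that u \<delta>J pz \<delta>.hom_one by (auto simp: S_def y_def c_def)
    show "e \<in> generate L S" using \<open>e \<in> \<Gamma>\<close> by (simp add: \<Gamma>_def)
  qed
  have toN: "\<exists>k::int. e = y [^]\<^bsub>L\<^esub> k" if "e \<in> \<Gamma>" "\<pi> (fst e) = \<one>\<^bsub>P\<^esub>" for e
  proof -
    have "N #>\<^bsub>L\<^esub> e = N" using \<delta>N[OF that(1)] that(2) \<delta>.hom_one by simp
    then have "e \<in> N" using L.coset_join1[OF _ \<Gamma>L[OF that(1)] N.subgroup_axioms] by simp
    then show ?thesis by (rule Npow)
  qed
  \<comment> \<open>Both z and a^n have infinite order, so a power of (z, a^n) with one trivial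
    component is trivial. This gives injectivity of both projections of
    \<open>\<Gamma>\<close>.\<close>
  have left: "e = \<one>\<^bsub>L\<^esub>" if "e \<in> \<Gamma>" "fst e = \<one>\<^bsub>G\<^esub>" for e
  proof -
    have "\<pi> (fst e) = \<one>\<^bsub>P\<^esub>" using that(2) p.hom_one by simp
    from toN[OF that(1) this] obtain k :: int where k: "e = y [^]\<^bsub>L\<^esub> k" ..
    then have "z [^]\<^bsub>G\<^esub> k = \<one>\<^bsub>G\<^esub>" using that(2) ypow(1)[of k] by simp
    then have "k = 0" by (rule zinf)
    then show ?thesis using k by simp
  qed
  have right: "e = \<one>\<^bsub>L\<^esub>" if "e \<in> \<Gamma>" "snd e = \<one>\<^bsub>?B\<^esub>" for e
  proof -
    have pe: "\<pi> (fst e) \<in> carrier P" using \<Gamma>L[OF that(1)] by simp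
    have "\<psi> (\<pi> (fst e)) = \<psi> \<one>\<^bsub>P\<^esub>" using q\<psi>[OF that(1)] that(2) q.hom_one \<psi>.hom_one by simp
    then have "\<pi> (fst e) = \<one>\<^bsub>P\<^esub>" using \<psi>(2) pe P.one_closed by (simp add: inj_on_def)
    from toN[OF that(1) this] obtain k :: int where k: "e = y [^]\<^bsub>L\<^esub> k" ..
    then have "?b [^]\<^bsub>?B\<^esub> k = \<one>\<^bsub>?B\<^esub>" using that(2) ypow(2)[of k] by simp
    then have "k = 0" by (rule BS_central_pow_inj)
    then show ?thesis using k by simp
  qed
  have diff: "e \<otimes>\<^bsub>L\<^esub> inv\<^bsub>L\<^esub> e' \<in> \<Gamma>" if "e \<in> \<Gamma>" "e' \<in> \<Gamma>" for e e'
    using that subgroup.m_closed[OF \<Gamma>] subgroup.m_inv_closed[OF \<Gamma>] by blast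
  have eq: "e = e'" if "e \<in> \<Gamma>" "e' \<in> \<Gamma>" "fst e = fst e' \<or> snd e = snd e'" for e e'
  proof -
    have eL: "e \<in> carrier L" "e' \<in> carrier L" using \<Gamma>L that by auto
    have "e \<otimes>\<^bsub>L\<^esub> inv\<^bsub>L\<^esub> e' = \<one>\<^bsub>L\<^esub>"
      using that(3)
    proof
      assume "fst e = fst e'"
      then show ?thesis using left[OF diff[OF that(1,2)]] eL fst.hom_mult[of e "inv\<^bsub>L\<^esub> e'"] fst.hom_inv[of e'] fst.hom_closed[of e'] by simp
    next
      assume "snd e = snd e'"
      then show ?thesis using right[OF diff[OF that(1,2)]] eL snd.hom_mult[of e "inv\<^bsub>L\<^esub> e'"] snd.hom_inv[of e'] snd.hom_closed[of e'] by simp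
    qed
    then show ?thesis using eL by (metis L.inv_closed L.inv_equality L.inv_inv)
  qed
  \<comment> \<open>The first projection of \<open>\<Gamma>\<close> maps onto \<open>P\<close>
    because it meets all basis elements, and it contains \<open>z\<close>, hence the whole
    kernel.\<close>
  have surj: "\<exists>e\<in>\<Gamma>. fst e = g" if g: "g \<in> carrier G" for g
  proof -
    let ?Y = "fst ` \<Gamma>"
    have Y: "subgroup ?Y G" by (rule fst.subgroup_img_is_subgroup[OF \<Gamma>])
    have "J \<subseteq> \<pi> ` ?Y"
    proof
      fix j assume "j \<in> J"
      then have "c j \<in> \<Gamma>" "\<pi> (fst (c j)) = j" using u by (auto simp: \<Gamma>_def S_def c_def intro: generate.incl)
      then show "j \<in> \<pi> ` ?Y" by (metis image_eqI)
    qed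
    then have "generate P J \<subseteq> \<pi> ` ?Y"
      by (rule P.generate_subgroup_incl) (rule p.subgroup_img_is_subgroup[OF Y])
    then have "\<pi> g \<in> \<pi> ` ?Y" using p.hom_closed[OF g] J(2) by blast
    then obtain x where x: "x \<in> ?Y" "\<pi> g = \<pi> x" by blast
    have xG: "x \<in> carrier G" using x(1) subgroup.subset[OF Y] by blast
    have "inv\<^bsub>G\<^esub> x \<otimes>\<^bsub>G\<^esub> g \<in> kernel G P \<pi>" using xG g x(2) by (simp add: kernel_def)
    then obtain k :: int where k: "inv\<^bsub>G\<^esub> x \<otimes>\<^bsub>G\<^esub> g = z [^]\<^bsub>G\<^esub> k" unfolding ker by blast
    have "y \<in> \<Gamma>" by (auto simp: \<Gamma>_def S_def intro: generate.incl)
    then have "z \<in> ?Y" by (force simp: y_def)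
    then have "x \<otimes>\<^bsub>G\<^esub> z [^]\<^bsub>G\<^esub> k \<in> ?Y"
      using x(1) subgroup.m_closed[OF Y] G.subgroup_int_pow_closed[OF Y] by blast
    moreover have "x \<otimes>\<^bsub>G\<^esub> z [^]\<^bsub>G\<^esub> k = g" using xG g by (simp add: k[symmetric] G.inv_cancel)
    ultimately have "g \<in> ?Y" by simp
    then show ?thesis by blast
  qed
  define F where "F g = snd (SOME e. e \<in> \<Gamma> \<and> fst e = g)" for g
  have F: "(g, F g) \<in> \<Gamma>" if "g \<in> carrier G" for g
  proof -
    have "\<exists>e. e \<in> \<Gamma> \<and> fst e = g" using surj[OF that] by blast
    then have e: "(SOME e. e \<in> \<Gamma> \<and> fst e = g) \<in> \<Gamma> \<and> fst (SOME e. e \<in> \<Gamma> \<and> fst e = g) = g" by (rule someI_ex)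
    then have "(SOME e. e \<in> \<Gamma> \<and> fst e = g) = (g, F g)" by (intro prod_eqI) (simp_all add: F_def)
    with e show ?thesis by simp
  qed
  have "F \<in> hom G ?B"
  proof (rule homI)
    show "F g \<in> carrier ?B" if "g \<in> carrier G" for g using \<Gamma>L[OF F[OF that]] by (simp add: Lc)
    fix g h assume gh: "g \<in> carrier G" "h \<in> carrier G"
    have "(g \<otimes>\<^bsub>G\<^esub> h, F g \<otimes>\<^bsub>?B\<^esub> F h) \<in> \<Gamma>"
      using subgroup.m_closed[OF \<Gamma> F[OF gh(1)] F[OF gh(2)]] by (simp add: Lm)
    from eq[OF F[OF G.m_closed[OF gh]] this] show "F (g \<otimes>\<^bsub>G\<^esub> h) = F g \<otimes>\<^bsub>?B\<^esub> F h" by simp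
  qed
  moreover have "inj_on F (carrier G)"
  proof (rule inj_onI)
    fix g h assume gh: "g \<in> carrier G" "h \<in> carrier G" "F g = F h"
    from eq[OF F[OF gh(1)] F[OF gh(2)]] gh(3) show "g = h" by simp
  qed
  ultimately show ?thesis by (auto simp: mon_def)
qed


section \<open>Choice of n and conclusion\<close>

lemma finitely_generated_epi:
  assumes G: "group G" "finitely_generated G" and H: "group H" and h: "h \<in> epi G H"
  shows "finitely_generated H"
proof -
  interpret h: group_hom G H h using G(1) H h by (simp add: group_hom_def group_hom_axioms_def epi_def)
  obtain S where S: "finite S" "S \<subseteq> carrier G" "generate G S = carrier G"
    using G(2) by (auto simp: finitely_generated_def)
  have "generate H (h ` S) = carrier H" using h.generate_img[OF S(2)] S(3) h by (simp add: epi_def)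
  moreover have "h ` S \<subseteq> carrier H" using S(2) h.hom_closed by blast
  ultimately show ?thesis using S(1) unfolding finitely_generated_def by blast
qed

lemma central_extension_embeds:
  fixes G :: "('a, 'b) monoid_scheme"
  assumes G: "group G" "finitely_generated G" "torsion_free G"
    and P: "is_free_product_of_cyclic_groups P" and ext: "is_central_extension integer_group G P"
  shows "\<exists>n::nat. n \<ge> 1 \<and> embeds_into G (BS n n)"
proof -
  interpret G: group G by (rule G(1))
  interpret P: group P using P by (simp add: is_free_product_of_cyclic_groups_def)
  obtain I :: "'c set" and C :: "'c \<Rightarrow> 'c monoid" where
    C: "\<And>i. i \<in> I \<Longrightarrow> group (C i) \<and> cyclic_group (C i)" "P \<cong> free_product I C"
    using P unfolding is_free_product_of_cyclic_groups_def by blast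
  obtain J where J: "cyc_indep P J" "generate P J = carrier P" by (rule P.free_product_basis[OF C])
  obtain \<iota> \<pi> where \<iota>: "\<iota> \<in> mon integer_group G" and \<pi>: "\<pi> \<in> epi G P"
    and ker: "kernel G P \<pi> = \<iota> ` carrier integer_group"
    and central: "\<forall>z\<in>\<iota> ` carrier integer_group. \<forall>x\<in>carrier G. z \<otimes>\<^bsub>G\<^esub> x = x \<otimes>\<^bsub>G\<^esub> z"
    using ext unfolding is_central_extension_def by blast
  have fin: "finite J"
    by (rule P.cyc_basis_finite[OF J finitely_generated_epi[OF G(1,2) P.group_axioms \<pi>]])
  interpret \<iota>: group_hom integer_group G \<iota>
    using \<iota> G(1) by (simp add: group_hom_def group_hom_axioms_def mon_def)
  have \<pi>h: "\<pi> \<in> hom G P" "\<pi> ` carrier G = carrier P" using \<pi> by (simp_all add: epi_def)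
  define z where "z = \<iota> 1"
  have \<iota>z: "\<iota> k = z [^]\<^bsub>G\<^esub> k" for k
    using \<iota>.hom_int_pow[of 1 k] by (simp add: z_def)
  have zG: "z \<in> carrier G" by (simp add: z_def)
  have zc: "z \<otimes>\<^bsub>G\<^esub> x = x \<otimes>\<^bsub>G\<^esub> z" if "x \<in> carrier G" for x
    using central that by (simp add: z_def)
  have kerz: "kernel G P \<pi> = range (\<lambda>k::int. z [^]\<^bsub>G\<^esub> k)" by (simp add: ker \<iota>z)
  have zinf: "k = 0" if "z [^]\<^bsub>G\<^esub> k = \<one>\<^bsub>G\<^esub>" for k :: int
  proof -
    have "\<iota> k = \<iota> 0" using that \<iota>z by simp
    then show ?thesis using \<iota> by (simp add: mon_def inj_on_def)
  qed
  have "\<exists>u (s::nat) \<alpha>. u \<in> carrier G \<and> \<pi> u = j \<and> (P.ord j \<noteq> 0 \<longrightarrow> u [^]\<^bsub>G\<^esub> P.ord j = z [^]\<^bsub>G\<^esub> s \<and>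
      \<alpha> \<in> carrier P \<and> \<alpha> [^]\<^bsub>P\<^esub> s = j \<and> \<alpha> [^]\<^bsub>P\<^esub> P.ord j = \<one>\<^bsub>P\<^esub>)" if j: "j \<in> J" for j
  proof -
    have "j \<in> \<pi> ` carrier G" using cyc_indep_subset[OF J(1)] j \<pi>h(2) by blast
    then obtain u\<^sub>0 where u0: "u\<^sub>0 \<in> carrier G" "\<pi> u\<^sub>0 = j" by blast
    show ?thesis
    proof (cases "P.ord j = 0")
      case True
      then show ?thesis using u0 by blast
    next
      case False
      then obtain u \<alpha> and s :: nat where "u \<in> carrier G" "\<pi> u = \<pi> u\<^sub>0" "u [^]\<^bsub>G\<^esub> P.ord j = z [^]\<^bsub>G\<^esub> s"
        "\<alpha> \<in> carrier P" "\<alpha> [^]\<^bsub>P\<^esub> s = \<pi> u\<^sub>0" "\<alpha> [^]\<^bsub>P\<^esub> P.ord j = \<one>\<^bsub>P\<^esub>"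
        using central_lift[OF G(1,3) P.group_axioms \<pi>h(1) zG zc kerz u0(1), of "P.ord j"] u0(2) by metis
      then show ?thesis using u0(2) by blast
    qed
  qed
  then obtain u \<alpha> and s :: "'c \<Rightarrow> nat" where
    u: "\<And>j. j \<in> J \<Longrightarrow> u j \<in> carrier G \<and> \<pi> (u j) = j"
    and us: "\<And>j. j \<in> J \<Longrightarrow> P.ord j \<noteq> 0 \<Longrightarrow> u j [^]\<^bsub>G\<^esub> P.ord j = z [^]\<^bsub>G\<^esub> s j"
    and root: "\<And>j. j \<in> J \<Longrightarrow> P.ord j \<noteq> 0 \<Longrightarrow>
      \<alpha> j \<in> carrier P \<and> \<alpha> j [^]\<^bsub>P\<^esub> s j = j \<and> \<alpha> j [^]\<^bsub>P\<^esub> P.ord j = \<one>\<^bsub>P\<^esub>"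
    by metis
  \<comment> \<open>A common multiple of the finite orders, with infinite factors counted as 1. The
    factor 2 guarantees n \<ge> 2 even when there is no torsion.\<close>
  define n where "n = 2 * (\<Prod>j\<in>J. if P.ord j = 0 then 1 else P.ord j)"
  have prod: "(\<Prod>j\<in>J. if P.ord j = 0 then 1 else P.ord j) > 0" by (rule prod_pos) simp
  then have n: "n \<ge> 2" "n > 0" by (simp_all add: n_def)
  have dvd: "P.ord j dvd n" if "j \<in> J" "P.ord j \<noteq> 0" for j
    using dvd_prodI[OF fin that(1), of "\<lambda>j. if P.ord j = 0 then 1 else P.ord j"] that(2)
    by (simp add: n_def)
  interpret Q: Zn_free_Z "presented_group UNIV (quot_rels n)" n
    "pgen UNIV (quot_rels n) Gen_a" "pgen UNIV (quot_rels n) Gen_t"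
    by (rule Zn_free_Z_presented[OF n(2)])
  have "mon G (BS n n) \<noteq> {}"
    by (rule Q.embed_central_extension[OF G(1) P.group_axioms \<pi> zG zc kerz zinf J fin n(1) dvd u us root])
  then show ?thesis using n(1) by (auto simp: embeds_into_def intro!: exI[of _ n])
qed

theorem theorem1p4:
  fixes G :: "('a, 'b) monoid_scheme"
  assumes "group G" and "finitely_generated G"
  shows "(\<exists>n::nat. n \<ge> 1 \<and> embeds_into G (BS n n)) \<longleftrightarrow>
    torsion_free G \<and>
    (is_free_group G \<or> is_central_extension_of_Z_by_free_product_of_cyclic_groups G)"
proof
  assume "\<exists>n::nat. n \<ge> 1 \<and> embeds_into G (BS n n)"
  then obtain n h where n: "n \<ge> 1" and h: "h \<in> mon G (BS n n)" by (auto simp: embeds_into_def)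
  interpret Q: Zn_free_Z "presented_group UNIV (quot_rels n)" n
    "pgen UNIV (quot_rels n) Gen_a" "pgen UNIV (quot_rels n) Gen_t"
    by (rule Zn_free_Z_presented) (use n in simp)
  show "torsion_free G \<and>
      (is_free_group G \<or> is_central_extension_of_Z_by_free_product_of_cyclic_groups G)"
    by (rule Q.subgroup_BS[OF assms(1) h])
next
  assume G: "torsion_free G \<and>
      (is_free_group G \<or> is_central_extension_of_Z_by_free_product_of_cyclic_groups G)"
  interpret group G by (rule assms(1))
  show "\<exists>n::nat. n \<ge> 1 \<and> embeds_into G (BS n n)"
  proof (cases "is_free_group G")
    case True
    obtain J where J: "cyc_indep G J" "generate G J = carrier G" by (rule free_basis[OF True])
    \<comment> \<open>No finite orders have to divide n here, so the smallest value with
      \<open>a\<close> nontrivial in \<open>Q\<close> is taken.\<close>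
    interpret Q: Zn_free_Z "presented_group UNIV (quot_rels 2)" 2
      "pgen UNIV (quot_rels 2) Gen_a" "pgen UNIV (quot_rels 2) Gen_t"
      by (rule Zn_free_Z_presented) simp
    have "mon G (BS 2 2) \<noteq> {}"
      by (rule Q.embed_free[OF assms(1) _ J cyc_basis_finite[OF J assms(2)]]) (use G in simp_all)
    then show ?thesis by (auto simp: embeds_into_def intro!: exI[of _ 2])
  next
    case False
    then obtain P :: "'a set monoid"
      where "is_free_product_of_cyclic_groups P" "is_central_extension integer_group G P"
      using G unfolding is_central_extension_of_Z_by_free_product_of_cyclic_groups_def by blast
    then show ?thesis using central_extension_embeds[OF assms] G by blast
  qed
qed

end
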